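(* Let $\{X_n:n\ge 0\}$ be a time-homogeneous Markov chain on $(S,\mathcal{B})$ satisfying conditions (A1), (A2), (A3) stated in the context. Then $\{X_n\}$ has a unique stationary probability measure $\pi$, and $\int V\,d\pi<\infty$. Assume in addition that the chain is reversible with respect to $\pi$, that is, $$\int_S Pf(x)g(x)\,\pi(dx)=\int_S f(x)Pg(x)\,\pi(dx)\qquad\text{for all }f,g\in L^2(\pi).$$ Define $R_2$ as follows. If $C$ is an atom, $$R_2=\begin{cases}\sup\{0<r<\lambda^{-1}:1+2\beta r>r^{1+(\log K)/(\log\lambda^{-1})}\}, & \text{if }K>\lambda+2\beta,\\ \lambda^{-1}, & \text{if }K\le\lambda+2\beta;\end{cases}$$ if $C$ is not an atom, $$R_2=\begin{cases}\sup\{0<r<R_0:1+2\beta r>L(r)\}, & \text{if }L(R_0)>1+2\beta R_0,\\ R_0, & \text{if }L(R_0)\le 1+2\beta R_0.\end{cases}$$ Let $\rho=R_2^{-1}$ and, for $\rho<\gamma<1$, let $$M=\begin{cases}M_{\mathrm{at}}\big(\gamma,\,1+\tfrac{1}{\gamma-\rho}\big), & \text{if } C \text{ is an atom},\\ M_{\mathrm{non}}\big(\gamma,\,1+\tfrac{\sqrt{\tilde\beta}}{\gamma-\rho}\big), & \text{if } C \text{ is not an atom}.\end{cases}$$ Then $\rho<1$, and for every $\gamma$ with $\rho<\gamma<1$ we have $M<\infty$ and $$\sup_{|g|\le V}\left|(P^ng)(x)-\int g\,d\pi\right|\le M\,V(x)\,\gamma^n\qquad\text{for all }x\in S\text{ and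 all }n\ge 0,$$ where the supremum is over all measurable $g:S\to\mathbf{R}$ with $|g(y)|\le V(y)$ for all $y\in S$. In particular, $P^ng(x)$ and $\int g\,d\pi$ are both well defined for every measurable $g$ with $\sup\{|g(x)|/V(x):x\in S\}<\infty$.
   Context: $P(x,A)$ ($x\in S$, $A\in\mathcal{B}$) is the transition probability of the chain, and $P$ also denotes the operator $Pg(x)=\int g(y)P(x,dy)$. Assumptions. (A1) Minorization: there exist $C\in\mathcal{B}$, $\tilde\beta>0$ and a probability measure $\nu$ on $(S,\mathcal{B})$ with $P(x,A)\ge\tilde\beta\,\nu(A)$ for all $x\in C$, $A\in\mathcal{B}$. (A2) Drift: there exist a measurable $V:S\to[1,\infty)$ and constants $0<\lambda<1$, $K<\infty$ with $PV(x)\le\lambda V(x)$ if $x\notin C$ and $PV(x)\le K$ if $x\in C$. (A3) Strong aperiodicity: there exists $\beta>0$ with $\tilde\beta\,\nu(C)\ge\beta$. $C$ is an atom if $P(x,\cdot)=P(y,\cdot)$ for all $x,y\in C$; in this case it is assumed that $\tilde\beta=1$ and $\nu=P(x,\cdot)$ for any $x\in C$. If $C$ is not an atom then $\tilde\beta<1$. Non-atomic case ($\tilde\beta<1$): put $\alpha_1=1+\big(\log\frac{K-\tilde\beta}{1-\tilde\beta}\big)/(\log\lambda^{-1})$. The number $\alpha_2$ is $1+\big(\log\frac{K}{\tilde\beta}\big)/(\log\lambda^{-1})$; alternatively, one may take $\alpha_2=1$ if $\nu(C)=1$, or, more generally, $\alpha_2=1+(\log\widetilde K)/(\log\lambda^{-1})$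 if $\nu(C)+\int_{S\setminus C}V\,d\nu\le\widetilde K<\infty$. Put $R_0=\min(\lambda^{-1},(1-\tilde\beta)^{-1/\alpha_1})$ and, for $0<r\le R_0$, $L(r)=\dfrac{\tilde\beta r^{\alpha_2}}{1-(1-\tilde\beta)r^{\alpha_1}}$ (equal to $+\infty$ if the denominator vanishes). For a real number $\kappa$ define $$M_{\mathrm{at}}(\gamma,\kappa)=\frac{\max(\lambda,K-\lambda/\gamma)}{\gamma-\lambda}+\frac{K(K-\lambda/\gamma)}{\gamma(\gamma-\lambda)}\kappa+\frac{(K-\lambda/\gamma)\max(\lambda,K-\lambda)}{(\gamma-\lambda)(1-\lambda)}+\frac{\lambda(K-1)}{(\gamma-\lambda)(1-\lambda)}$$ and, with $D=1-(1-\tilde\beta)\gamma^{-\alpha_1}$, $$\begin{aligned}M_{\mathrm{non}}(\gamma,\kappa)={}&\frac{\max(\lambda,K-\lambda/\gamma)}{\gamma-\lambda}+\frac{K[K\gamma-\lambda-\tilde\beta(\gamma-\lambda)]}{\gamma^2(\gamma-\lambda)D}+\frac{\tilde\beta\gamma^{-\alpha_2-2}K(K\gamma-\lambda)}{(\gamma-\lambda)D^2}\kappa\\&+\frac{\gamma^{-\alpha_2-1}(K\gamma-\lambda)}{(\gamma-\lambda)D^2}\left(\frac{\tilde\beta\max(\lambda,K-\lambda)}{1-\lambda}+\frac{(1-\tilde\beta)(\gamma^{-\alpha_1}-1)}{\gamma^{-1}-1}\right)+\frac{\gamma^{-\alpha_2}\lambda(K-1)}{(1-\lambda)(\gamma-\lambda)D}\\&+\frac{K-\lambda-\tilde\beta(1-\lambda)}{(1-\lambda)(1-\gamma)D}\left((\gamma^{-\alpha_2}-1)+\frac{(1-\tilde\beta)(\gamma^{-\alpha_1}-1)}{\tilde\beta}\right).\end{aligned}$$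 *)

theory Defs
  imports "HOL-Probability.Probability"
begin

section \<open>Markov kernels\<close>

text \<open>A Markov kernel on the measurable space \<^term>\<open>S\<close> is an element of
  \<^term>\<open>S \<rightarrow>\<^sub>M prob_algebra S\<close>.  A measure used as a measurable space only contributes its
  carrier and its sigma-algebra.\<close>

definition kernel_op :: "('a \<Rightarrow> 'a measure) \<Rightarrow> ('a \<Rightarrow> real) \<Rightarrow> 'a \<Rightarrow> real" where
  "kernel_op P g x = (\<integral>y. g y \<partial>P x)"

text \<open>The \<^term>\<open>n\<close>-step transition probabilities.\<close>

primrec kernel_pow :: "'a measure \<Rightarrow> ('a \<Rightarrow> 'a measure) \<Rightarrow> nat \<Rightarrow> 'a \<Rightarrow> 'a measure" where
  "kernel_pow S P 0 = return S"
| "kernel_pow S P (Suc n) = (\<lambda>x. P x \<bind> kernel_pow S P n)"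

definition stationary :: "'a measure \<Rightarrow> ('a \<Rightarrow> 'a measure) \<Rightarrow> 'a measure \<Rightarrow> bool" where
  "stationary S P \<pi> \<longleftrightarrow> \<pi> \<in> space (prob_algebra S) \<and> \<pi> \<bind> P = \<pi>"

definition square_integrable :: "'a measure \<Rightarrow> ('a \<Rightarrow> real) \<Rightarrow> bool" where
  "square_integrable \<pi> f \<longleftrightarrow> f \<in> borel_measurable \<pi> \<and> integrable \<pi> (\<lambda>x. (f x)\<^sup>2)"

definition reversible :: "('a \<Rightarrow> 'a measure) \<Rightarrow> 'a measure \<Rightarrow> bool" where
  "reversible P \<pi> \<longleftrightarrow>
     (\<forall>f g. square_integrable \<pi> f \<longrightarrow> square_integrable \<pi> g \<longrightarrow>
        (\<integral>x. kernel_op P f x * g x \<partial>\<pi>) = (\<integral>x. f x * kernel_op P g x \<partial>\<pi>))"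

section \<open>Minorization and drift\<close>

definition minorization ::
  "'a measure \<Rightarrow> ('a \<Rightarrow> 'a measure) \<Rightarrow> 'a set \<Rightarrow> real \<Rightarrow> 'a measure \<Rightarrow> bool" where
  "minorization S P C bt \<nu> \<longleftrightarrow>
     C \<in> sets S \<and> bt > 0 \<and> \<nu> \<in> space (prob_algebra S) \<and>
     (\<forall>x\<in>C. \<forall>A\<in>sets S. measure (P x) A \<ge> bt * measure \<nu> A)"

text \<open>\<^term>\<open>PV\<close> is a nonnegative Lebesgue integral here, so that the bounds include
  the integrability of \<^term>\<open>V\<close> under \<^term>\<open>P x\<close>.\<close>

definition drift ::
  "'a measure \<Rightarrow> ('a \<Rightarrow> 'a measure) \<Rightarrow> 'a set \<Rightarrow> ('a \<Rightarrow> real) \<Rightarrow> real \<Rightarrow> real \<Rightarrow> bool" where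
  "drift S P C V lam K \<longleftrightarrow>
     V \<in> borel_measurable S \<and> (\<forall>x\<in>space S. V x \<ge> 1) \<and> 0 < lam \<and> lam < 1 \<and>
     (\<forall>x\<in>space S - C. (\<integral>\<^sup>+y. ennreal (V y) \<partial>P x) \<le> ennreal (lam * V x)) \<and>
     (\<forall>x\<in>C. (\<integral>\<^sup>+y. ennreal (V y) \<partial>P x) \<le> ennreal K)"

definition strong_aperiodicity :: "'a set \<Rightarrow> real \<Rightarrow> 'a measure \<Rightarrow> real \<Rightarrow> bool" where
  "strong_aperiodicity C bt \<nu> \<beta> \<longleftrightarrow> \<beta> > 0 \<and> bt * measure \<nu> C \<ge> \<beta>"

definition is_atom :: "('a \<Rightarrow> 'a measure) \<Rightarrow> 'a set \<Rightarrow> bool" where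
  "is_atom P C \<longleftrightarrow> (\<forall>x\<in>C. \<forall>y\<in>C. P x = P y)"

section \<open>Constants\<close>

definition alpha1 :: "real \<Rightarrow> real \<Rightarrow> real \<Rightarrow> real" where
  "alpha1 bt lam K = 1 + ln ((K - bt) / (1 - bt)) / ln (1 / lam)"

definition alpha2_admissible ::
  "'a measure \<Rightarrow> 'a set \<Rightarrow> ('a \<Rightarrow> real) \<Rightarrow> 'a measure \<Rightarrow> real \<Rightarrow> real \<Rightarrow> real \<Rightarrow> real \<Rightarrow> bool" where
  "alpha2_admissible S C V \<nu> bt lam K a2 \<longleftrightarrow>
     a2 = 1 + ln (K / bt) / ln (1 / lam) \<or>
     (measure \<nu> C = 1 \<and> a2 = 1) \<or>
     (\<exists>Kt::real. emeasure \<nu> C + (\<integral>\<^sup>+x\<in>space S - C. ennreal (V x) \<partial>\<nu>) \<le> ennreal Kt \<and>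
        a2 = 1 + ln Kt / ln (1 / lam))"

definition R0 :: "real \<Rightarrow> real \<Rightarrow> real \<Rightarrow> real" where
  "R0 bt lam K = min (1 / lam) ((1 - bt) powr (- 1 / alpha1 bt lam K))"

definition L_fun :: "real \<Rightarrow> real \<Rightarrow> real \<Rightarrow> real \<Rightarrow> real \<Rightarrow> ereal" where
  "L_fun bt lam K a2 r =
     (let d = 1 - (1 - bt) * r powr alpha1 bt lam K
      in if d = 0 then \<infinity> else ereal (bt * r powr a2 / d))"

definition R2_at :: "real \<Rightarrow> real \<Rightarrow> real \<Rightarrow> real" where
  "R2_at \<beta> lam K =
     (if K > lam + 2 * \<beta>
      then Sup {r. 0 < r \<and> r < 1 / lam \<and> 1 + 2 * \<beta> * r > r powr (1 + ln K / ln (1 / lam))}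
      else 1 / lam)"

definition R2_non :: "real \<Rightarrow> real \<Rightarrow> real \<Rightarrow> real \<Rightarrow> real \<Rightarrow> real" where
  "R2_non \<beta> bt lam K a2 =
     (if L_fun bt lam K a2 (R0 bt lam K) > ereal (1 + 2 * \<beta> * R0 bt lam K)
      then Sup {r. 0 < r \<and> r < R0 bt lam K \<and> ereal (1 + 2 * \<beta> * r) > L_fun bt lam K a2 r}
      else R0 bt lam K)"

text \<open>The quotients in the next two definitions are taken in \<^typ>\<open>ereal\<close>, where a positive number
  divided by \<^term>\<open>0\<close> is \<^term>\<open>\<infinity>\<close>; so finiteness of these constants is not automatic.\<close>

definition M_at :: "real \<Rightarrow> real \<Rightarrow> real \<Rightarrow> real \<Rightarrow> ereal" where
  "M_at lam K \<gamma> \<kappa> =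
     ereal (max lam (K - lam / \<gamma>)) / ereal (\<gamma> - lam)
   + ereal (K * (K - lam / \<gamma>)) / ereal (\<gamma> * (\<gamma> - lam)) * ereal \<kappa>
   + ereal ((K - lam / \<gamma>) * max lam (K - lam)) / ereal ((\<gamma> - lam) * (1 - lam))
   + ereal (lam * (K - 1)) / ereal ((\<gamma> - lam) * (1 - lam))"

definition M_non :: "real \<Rightarrow> real \<Rightarrow> real \<Rightarrow> real \<Rightarrow> real \<Rightarrow> real \<Rightarrow> ereal" where
  "M_non bt lam K a2 \<gamma> \<kappa> =
    (let a1 = alpha1 bt lam K;
         D = 1 - (1 - bt) * \<gamma> powr (- a1)
     in
     ereal (max lam (K - lam / \<gamma>)) / ereal (\<gamma> - lam)
   + ereal (K * (K * \<gamma> - lam - bt * (\<gamma> - lam))) / ereal (\<gamma>\<^sup>2 * (\<gamma> - lam) * D)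
   + ereal (bt * \<gamma> powr (- a2 - 2) * K * (K * \<gamma> - lam)) / ereal ((\<gamma> - lam) * D\<^sup>2) * ereal \<kappa>
   + ereal (\<gamma> powr (- a2 - 1) * (K * \<gamma> - lam)) / ereal ((\<gamma> - lam) * D\<^sup>2)
     * (ereal (bt * max lam (K - lam)) / ereal (1 - lam)
        + ereal ((1 - bt) * (\<gamma> powr (- a1) - 1)) / ereal (1 / \<gamma> - 1))
   + ereal (\<gamma> powr (- a2) * lam * (K - 1)) / ereal ((1 - lam) * (\<gamma> - lam) * D)
   + ereal (K - lam - bt * (1 - lam)) / ereal ((1 - lam) * (1 - \<gamma>) * D)
     * (ereal (\<gamma> powr (- a2) - 1)
        + ereal ((1 - bt) * (\<gamma> powr (- a1) - 1)) / ereal bt))"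

definition rho ::
  "('a \<Rightarrow> 'a measure) \<Rightarrow> 'a set \<Rightarrow> real \<Rightarrow> real \<Rightarrow> real \<Rightarrow> real \<Rightarrow> real \<Rightarrow> real" where
  "rho P C \<beta> bt lam K a2 =
     1 / (if is_atom P C then R2_at \<beta> lam K else R2_non \<beta> bt lam K a2)"

definition M_const ::
  "('a \<Rightarrow> 'a measure) \<Rightarrow> 'a set \<Rightarrow> real \<Rightarrow> real \<Rightarrow> real \<Rightarrow> real \<Rightarrow> real \<Rightarrow> real \<Rightarrow> ereal" where
  "M_const P C \<beta> bt lam K a2 \<gamma> =
     (if is_atom P C
      then M_at lam K \<gamma> (1 + 1 / (\<gamma> - rho P C \<beta> bt lam K a2))
      else M_non bt lam K a2 \<gamma> (1 + sqrt bt / (\<gamma> - rho P C \<beta> bt lam K a2)))"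

end

theory Submission
  imports Defs "HOL-Complex_Analysis.Complex_Analysis"
begin

text \<open>
  Put \<open>T = P - bt 1_C \<otimes> \<nu>\<close>.  Iterating \<open>P = T + bt 1_C \<otimes> \<nu>\<close> expresses \<open>P ^ n g\<close> through the powers
  of \<open>T\<close> and the renewal sequence \<open>u_0 = 1\<close>, \<open>u_{n+1} = bt \<nu> P ^ n 1_C\<close>; the stationary measure is a
  multiple of the potential \<open>\<Sum>k. \<nu> T ^ k\<close>.  The drift condition provides explicit supersolutions
  \<open>W \<ge> f + r T W\<close>, which bound all weighted sums \<open>\<Sum>k. r ^ k T ^ k f\<close> that occur, so that only
  the rate at which \<open>u_n\<close> converges is missing.

  For a reversible chain, \<open>v_n = \<langle>P ^ n f, f\<rangle>\<close> with \<open>f = 1_C - \<pi>(C)\<close> has \<open>v_{2n} = \<parallel>P ^ n f\<parallel>\<^sup>2\<close>, a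
  nonnegative log-convex sequence.  Its generating function is a quotient of power series with
  denominator \<open>1 - b(z)\<close>, where \<open>b(z)\<close> generates the increments of \<open>u\<close>.  On the positive axis
  \<open>b(z) = 1\<close> only at \<open>z = 1\<close>, and that pole is removed; on the negative axis
  \<open>b(- r) \<le> b(r) - 2 \<beta> r < 1\<close> for \<open>r < R_2\<close>.  Pringsheim's theorem then makes \<open>R_2\<close> a lower bound of the
  radius of convergence, log-convexity gives \<open>v_{2n} \<le> v_0 R_2 ^ (- 2 n)\<close> without a spectral theorem, and
  \<open>bt \<pi>(C) \<nu> \<le> \<pi>\<close> transfers the bound to \<open>u_n\<close>.
\<close>

text \<open>Reversibility enters only through the rate of \<open>un\<close>; all other estimates
  hold under minorization and drift alone. Two points shape the constants. First, the integral
  \<open>v1\<close> of \<open>V - 1\<close> under \<nu> is unknown. Every bound is therefore kept as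
  a combination of \<open>V - 1\<close>, \<open>Phi r\<close> and 1, on which the residual kernel
  acts by explicit scalars, and \<open>v1\<close> is eliminated only at the end. Second, the
  exponents come from Jensen's inequality: for the weight \<open>r = lam powr (- s)\<close>, a mean
  \<open>a\<close> of \<open>V\<close> becomes
  \<open>a powr s = r powr (ln a / ln (1 / lam))\<close>. The mean over a residual step from
  \<open>C\<close> gives \<open>alpha1\<close>, the mean under \<nu> (with \<open>V\<close> replaced
  by 1 on \<open>C\<close>) gives \<alpha>_2, and the leading 1 in both counts the step itself.
  Hence \<open>bgen r \<le> bt * r powr a2 / DD r\<close>, which is \<open>L_fun\<close> on
  \<open>[1, R0)\<close>, and the condition defining R_2 compares this bound with
  \<open>1 + 2 * \<beta> * r\<close>. An atom is the same computation with \<open>bt = 1\<close> and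
  \<open>DD r = 1\<close>. The sharper constant \<open>MM\<close> is proved first and then compared
  with the stated ones; time 0 is estimated separately.\<close>

section \<open>Countable sums of measures\<close>

lemma nn_integral_sums_measure:
  fixes N :: "nat \<Rightarrow> 'a measure"
  assumes sets: "\<And>i. sets (N i) = sets M"
    and M: "\<And>A. A \<in> sets M \<Longrightarrow> emeasure M A = (\<Sum>i. emeasure (N i) A)"
    and f: "f \<in> borel_measurable M"
  shows "(\<integral>\<^sup>+x. f x \<partial>M) = (\<Sum>i. \<integral>\<^sup>+x. f x \<partial>N i)"
  using f
proof (induction f rule: borel_measurable_induct)
  note [measurable_cong] = sets
  note space = sets_eq_imp_space_eq[OF sets]
  {
    case (cong f g)
    have "(\<integral>\<^sup>+x. f x \<partial>N i) = (\<integral>\<^sup>+x. g x \<partial>N i)" for i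
      using cong by (intro nn_integral_cong) (auto simp: space)
    with cong show ?case by (simp cong: nn_integral_cong)
  next
    case (set A)
    then show ?case using M by (simp add: sets)
  next
    case (mult u c)
    have [measurable]: "u \<in> borel_measurable M" by fact
    show ?case using mult by (simp add: nn_integral_cmult)
  next
    case (add u v)
    have [measurable]: "u \<in> borel_measurable M" "v \<in> borel_measurable M" by fact+
    show ?case using add by (simp add: nn_integral_add suminf_add)
  next
    case (seq U)
    have [measurable]: "\<And>i. U i \<in> borel_measurable M" by fact
    have *: "incseq (\<lambda>n. \<integral>\<^sup>+x. U n x \<partial>N i)" for i
      using incseqD[OF \<open>incseq U\<close>] by (auto simp: le_fun_def intro!: incseq_SucI nn_integral_mono)
    have "(\<integral>\<^sup>+x. (SUP i. U i) x \<partial>M) = (SUP n. \<integral>\<^sup>+x. U n x \<partial>M)"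
      using \<open>incseq U\<close> by (simp add: nn_integral_monotone_convergence_SUP image_comp)
    also have "\<dots> = (SUP n. \<Sum>i. \<integral>\<^sup>+x. U n x \<partial>N i)"
      by (simp add: seq)
    also have "\<dots> = (\<Sum>i. SUP n. \<integral>\<^sup>+x. U n x \<partial>N i)"
      using * by (rule ennreal_suminf_SUP_eq[symmetric])
    also have "\<dots> = (\<Sum>i. \<integral>\<^sup>+x. (SUP n. U n) x \<partial>N i)"
      using \<open>incseq U\<close> by (simp add: nn_integral_monotone_convergence_SUP image_comp)
    finally show ?case .
  }
qed

text \<open>Countable additivity of the sum is an interchange of two nonnegative series, done as
  integrals over a counting measure. The result turns the potential
  \<open>\<Sum>k. \<nu> T ^ k\<close> into a measure.\<close>

lemma exists_sums_measure:
  fixes N :: "nat \<Rightarrow> 'a measure"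
  assumes sets: "\<And>i. sets (N i) = sets S"
  obtains M where "sets M = sets S" "\<And>A. A \<in> sets M \<Longrightarrow> emeasure M A = (\<Sum>i. emeasure (N i) A)"
proof -
  define \<mu> where "\<mu> A = (\<Sum>i. emeasure (N i) A)" for A
  define M where "M = measure_of (space S) (sets S) \<mu>"
  have sM: "sets M = sets S" by (simp add: M_def)
  moreover have "emeasure M A = \<mu> A" if "A \<in> sets M" for A
    unfolding M_def
  proof (rule emeasure_measure_of_sigma)
    show "sigma_algebra (space S) (sets S)" ..
    show "positive (sets S) \<mu>" by (simp add: positive_def \<mu>_def)
    show "countably_additive (sets S) \<mu>"
    proof (rule countably_additiveI)
      fix A :: "nat \<Rightarrow> _" assume A: "range A \<subseteq> sets S" "disjoint_family A"
      have "(\<Sum>k. \<mu> (A k)) = (\<Sum>i. \<Sum>k. emeasure (N i) (A k))"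
        unfolding \<mu>_def nn_integral_count_space_nat[symmetric]
        by (rule nn_integral_count_space_nn_integral) auto
      also have "\<dots> = (\<Sum>i. emeasure (N i) (\<Union>k. A k))"
        using A sets by (simp add: suminf_emeasure)
      finally show "(\<Sum>k. \<mu> (A k)) = \<mu> (\<Union>k. A k)" by (simp add: \<mu>_def)
    qed
    show "A \<in> sets S" using that sM by simp
  qed
  ultimately show thesis using that by (simp add: \<mu>_def)
qed

section \<open>The residual kernel\<close>

text \<open>The bound \<open>bt \<le> 1\<close> admits both cases of the theorem at once:
  \<open>bt = 1\<close> for an atom and \<open>bt < 1\<close> otherwise.\<close>

locale minorized_kernel =
  fixes S :: "'a measure" and P :: "'a \<Rightarrow> 'a measure" and C :: "'a set" and bt :: real
    and \<nu> :: "'a measure"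
  assumes kernel: "P \<in> S \<rightarrow>\<^sub>M prob_algebra S"
    and minor: "minorization S P C bt \<nu>"
    and bt_le_1: "bt \<le> 1"
begin

lemma C_sets [measurable]: "C \<in> sets S" and bt_pos: "bt > 0"
  and nu_prob: "prob_space \<nu>" and sets_nu [simp, measurable_cong]: "sets \<nu> = sets S"
  using minor by (auto simp: minorization_def space_prob_algebra)

lemma space_nu [simp]: "space \<nu> = space S"
  by (rule sets_eq_imp_space_eq) simp

sublocale nu: prob_space \<nu> by (rule nu_prob)

lemma C_subset: "x \<in> C \<Longrightarrow> x \<in> space S"
  using C_sets sets.sets_into_space by blast

lemma P_subprob [measurable]: "P \<in> S \<rightarrow>\<^sub>M subprob_algebra S"
  using kernel by (rule measurable_prob_algebraD)

lemma P_prob: "x \<in> space S \<Longrightarrow> prob_space (P x)"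
  and sets_P: "x \<in> space S \<Longrightarrow> sets (P x) = sets S"
  using measurable_space[OF kernel] by (auto simp: space_prob_algebra)

lemma space_P: "x \<in> space S \<Longrightarrow> space (P x) = space S"
  by (rule sets_eq_imp_space_eq) (rule sets_P)

lemma minor_emeasure:
  assumes "x \<in> C" "A \<in> sets S"
  shows "ennreal bt * emeasure \<nu> A \<le> emeasure (P x) A"
proof -
  interpret P: prob_space "P x" by (rule P_prob) (rule C_subset[OF assms(1)])
  have "bt * measure \<nu> A \<le> measure (P x) A"
    using minor assms by (auto simp: minorization_def)
  then show ?thesis
    using bt_pos by (simp add: P.emeasure_eq_measure nu.emeasure_eq_measure ennreal_mult[symmetric])
qed

text \<open>\<open>diff_measure\<close> takes the expected values when the subtracted measure is
  finite and dominated; on \<open>C\<close> the domination is \<open>minor_emeasure\<close>.\<close>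

definition residual :: "'a \<Rightarrow> 'a measure" where
  "residual x = (if x \<in> C then diff_measure (P x) (scale_measure (ennreal bt) \<nu>) else P x)"

lemma sets_residual: "x \<in> space S \<Longrightarrow> sets (residual x) = sets S"
  by (simp add: residual_def sets_P)

lemma space_residual: "x \<in> space S \<Longrightarrow> space (residual x) = space S"
  by (rule sets_eq_imp_space_eq) (rule sets_residual)

lemma emeasure_residual:
  assumes "x \<in> space S" "A \<in> sets S"
  shows "emeasure (residual x) A = emeasure (P x) A - ennreal bt * indicator C x * emeasure \<nu> A"
proof (cases "x \<in> C")
  case True
  interpret P: prob_space "P x" by (rule P_prob) fact
  have "finite_measure (scale_measure (ennreal bt) \<nu>)"
    by (rule finite_measureI) (auto simp: ennreal_mult_eq_top_iff)
  then have "emeasure (diff_measure (P x) (scale_measure (ennreal bt) \<nu>)) A =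
      emeasure (P x) A - emeasure (scale_measure (ennreal bt) \<nu>) A"
    using minor_emeasure[OF True] assms
    by (intro emeasure_diff_measure) (auto simp: sets_P P.finite_measure_axioms)
  then show ?thesis using True by (simp add: residual_def)
qed (simp add: residual_def)

lemma emeasure_P_residual:
  assumes "x \<in> space S" "A \<in> sets S"
  shows "emeasure (P x) A = emeasure (residual x) A + ennreal bt * indicator C x * emeasure \<nu> A"
proof -
  have "ennreal bt * indicator C x * emeasure \<nu> A \<le> emeasure (P x) A"
    using minor_emeasure[OF _ assms(2)] by (cases "x \<in> C") auto
  then show ?thesis
    unfolding emeasure_residual[OF assms] by (rule diff_add_cancel_ennreal[symmetric])
qed

lemma residual_measurable [measurable]: "residual \<in> S \<rightarrow>\<^sub>M subprob_algebra S"
proof (rule measurable_subprob_algebra)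
  fix x assume x: "x \<in> space S"
  interpret P: prob_space "P x" by (rule P_prob) fact
  show "sets (residual x) = sets S" by (rule sets_residual) fact
  show "subprob_space (residual x)"
  proof (rule subprob_spaceI)
    have "emeasure (residual x) (space S) \<le> emeasure (P x) (space S)"
      unfolding emeasure_P_residual[OF x sets.top] by simp
    then show "emeasure (residual x) (space (residual x)) \<le> 1"
      using P.emeasure_space_1 x by (simp add: space_residual space_P)
    show "space (residual x) \<noteq> {}" using x by (auto simp: space_residual)
  qed
next
  fix A assume A [measurable]: "A \<in> sets S"
  have "(\<lambda>x. emeasure (P x) A - ennreal bt * indicator C x * emeasure \<nu> A) \<in> borel_measurable S"
    by measurable
  then show "(\<lambda>x. emeasure (residual x) A) \<in> borel_measurable S"
    by (rule measurable_cong[THEN iffD1, rotated]) (simp add: emeasure_residual)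
qed

text \<open>Integration against the residual kernel \<open>P - bt 1_C \<nu>\<close>.  Its powers take the role of the
  excursions of the split chain between regenerations, so that no path space is needed.\<close>

definition T :: "('a \<Rightarrow> ennreal) \<Rightarrow> 'a \<Rightarrow> ennreal" where
  "T f x = (\<integral>\<^sup>+y. f y \<partial>residual x)"

definition N :: "('a \<Rightarrow> ennreal) \<Rightarrow> 'a \<Rightarrow> ennreal" where
  "N f x = (\<integral>\<^sup>+y. f y \<partial>P x)"

lemma T_measurable [measurable]: "f \<in> borel_measurable S \<Longrightarrow> T f \<in> borel_measurable S"
  unfolding T_def[abs_def]
  by (rule measurable_compose[OF residual_measurable nn_integral_measurable_subprob_algebra])

lemma N_measurable [measurable]: "f \<in> borel_measurable S \<Longrightarrow> N f \<in> borel_measurable S"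
  unfolding N_def[abs_def]
  by (rule measurable_compose[OF P_subprob nn_integral_measurable_subprob_algebra])

lemma Tn_measurable [measurable]: "f \<in> borel_measurable S \<Longrightarrow> (T ^^ n) f \<in> borel_measurable S"
  by (induction n) auto

lemma Nn_measurable [measurable]: "f \<in> borel_measurable S \<Longrightarrow> (N ^^ n) f \<in> borel_measurable S"
  by (induction n) auto

lemma N_eq_T:
  assumes x: "x \<in> space S" and f: "f \<in> borel_measurable S"
  shows "N f x = T f x + ennreal bt * indicator C x * (\<integral>\<^sup>+y. f y \<partial>\<nu>)"
proof -
  \<comment> \<open>A sum of two measures, padded with null measures from index 2 on so that
    \<open>nn_integral_sums_measure\<close> applies.\<close>
  define M where "M i = (if i = 0 then residual x else if i = 1 then
    scale_measure (ennreal bt * indicator C x) \<nu> else null_measure S)" for i :: nat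
  have "emeasure (P x) A = (\<Sum>i. emeasure (M i) A)" if "A \<in> sets S" for A
  proof -
    have "(\<Sum>i. emeasure (M i) A) = (\<Sum>i<2. emeasure (M i) A)"
      by (rule suminf_finite) (auto simp: M_def)
    then show ?thesis
      using emeasure_P_residual[OF x that] by (simp add: M_def numeral_2_eq_2)
  qed
  then have "(\<integral>\<^sup>+y. f y \<partial>P x) = (\<Sum>i. \<integral>\<^sup>+y. f y \<partial>M i)"
    using x f by (intro nn_integral_sums_measure)
      (auto simp: M_def sets_residual sets_P cong: measurable_cong_sets)
  also have "\<dots> = (\<Sum>i<2. \<integral>\<^sup>+y. f y \<partial>M i)"
    by (rule suminf_finite) (auto simp: M_def)
  finally show ?thesis
    using f by (simp add: N_def T_def M_def numeral_2_eq_2 nn_integral_scale_measure)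
qed

lemma T_cong: "x \<in> space S \<Longrightarrow> (\<And>y. y \<in> space S \<Longrightarrow> f y = g y) \<Longrightarrow> T f x = T g x"
  unfolding T_def by (rule nn_integral_cong) (simp add: space_residual)

lemma T_mono: "x \<in> space S \<Longrightarrow> (\<And>y. y \<in> space S \<Longrightarrow> f y \<le> g y) \<Longrightarrow> T f x \<le> T g x"
  unfolding T_def by (rule nn_integral_mono) (simp add: space_residual)

lemma T_add:
  assumes "x \<in> space S" "f \<in> borel_measurable S" "g \<in> borel_measurable S"
  shows "T (\<lambda>y. f y + g y) x = T f x + T g x"
  unfolding T_def using assms
  by (intro nn_integral_add) (auto simp: sets_residual cong: measurable_cong_sets)

lemma T_cmult:
  assumes "x \<in> space S" "f \<in> borel_measurable S"
  shows "T (\<lambda>y. c * f y) x = c * T f x"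
  unfolding T_def using assms
  by (intro nn_integral_cmult) (auto simp: sets_residual cong: measurable_cong_sets)

lemma T_sum:
  assumes "x \<in> space S" "\<And>i. i \<in> I \<Longrightarrow> f i \<in> borel_measurable S"
  shows "T (\<lambda>y. \<Sum>i\<in>I. f i y) x = (\<Sum>i\<in>I. T (f i) x)"
  unfolding T_def using assms
  by (intro nn_integral_sum) (auto simp: sets_residual cong: measurable_cong_sets)

lemma Tn_mono:
  "(\<And>y. y \<in> space S \<Longrightarrow> f y \<le> g y) \<Longrightarrow> x \<in> space S \<Longrightarrow> (T ^^ n) f x \<le> (T ^^ n) g x"
  by (induction n arbitrary: x) (auto intro: T_mono)

lemma Tn_cong:
  "(\<And>y. y \<in> space S \<Longrightarrow> f y = g y) \<Longrightarrow> x \<in> space S \<Longrightarrow> (T ^^ n) f x = (T ^^ n) g x"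
  by (induction n arbitrary: x) (auto intro: T_cong)

lemma Tn_add:
  assumes "f \<in> borel_measurable S" "g \<in> borel_measurable S" "x \<in> space S"
  shows "(T ^^ n) (\<lambda>y. f y + g y) x = (T ^^ n) f x + (T ^^ n) g x"
  using assms(3)
proof (induction n arbitrary: x)
  case (Suc n)
  have "(T ^^ Suc n) (\<lambda>y. f y + g y) x = T (\<lambda>y. (T ^^ n) f y + (T ^^ n) g y) x"
    using Suc by (auto intro!: T_cong)
  then show ?case using assms Suc.prems by (simp add: T_add)
qed simp

lemma Tn_cmult:
  assumes "f \<in> borel_measurable S" "x \<in> space S"
  shows "(T ^^ n) (\<lambda>y. c * f y) x = c * (T ^^ n) f x"
  using assms(2)
proof (induction n arbitrary: x)
  case (Suc n)
  have "(T ^^ Suc n) (\<lambda>y. c * f y) x = T (\<lambda>y. c * (T ^^ n) f y) x"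
    using Suc by (auto intro!: T_cong)
  then show ?case using assms Suc.prems by (simp add: T_cmult)
qed simp

lemma T_one:
  assumes x: "x \<in> space S"
  shows "T (\<lambda>_. 1) x + ennreal bt * indicator C x = 1"
proof -
  interpret P: prob_space "P x" by (rule P_prob) fact
  have "N (\<lambda>_. 1) x = 1" by (simp add: N_def P.emeasure_space_1)
  then show ?thesis using N_eq_T[OF x, of "\<lambda>_. 1"] nu.emeasure_space_1 by simp
qed

lemma T_one_in:
  assumes "x \<in> C" shows "T (\<lambda>_. 1) x = ennreal (1 - bt)"
proof -
  have "ennreal 1 = ennreal (1 - bt) + ennreal bt"
    using bt_pos bt_le_1 by (simp add: ennreal_plus[symmetric] del: ennreal_plus)
  then have "T (\<lambda>_. 1) x + ennreal bt = ennreal (1 - bt) + ennreal bt"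
    using T_one[OF C_subset[OF assms]] assms by simp
  then show ?thesis by (simp add: ennreal_add_left_cancel add.commute)
qed

lemma T_notin: "x \<notin> C \<Longrightarrow> T f x = N f x"
  by (simp add: T_def N_def residual_def)

text \<open>Each residual step loses exactly the mass \<open>bt\<close> on \<open>C\<close>
  (\<open>T_one\<close>). Telescoping this balance gives the law of the first regeneration
  (\<open>hit_sum\<close>), and summing it by parts gives the tail sums
  (\<open>tail_real\<close>).\<close>

lemma Tn_one_step:
  assumes x: "x \<in> space S"
  shows "(T ^^ n) (\<lambda>_. 1) x = (T ^^ Suc n) (\<lambda>_. 1) x + ennreal bt * (T ^^ n) (indicator C) x"
proof -
  have "(T ^^ n) (\<lambda>_. 1) x = (T ^^ n) (\<lambda>y. T (\<lambda>_. 1) y + ennreal bt * indicator C y) x"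
    using x by (intro Tn_cong) (auto simp: T_one)
  also have "\<dots> = (T ^^ n) (T (\<lambda>_. 1)) x + ennreal bt * (T ^^ n) (indicator C) x"
    using x by (simp add: Tn_add Tn_cmult)
  finally show ?thesis by (simp add: funpow_swap1)
qed

text \<open>Iterating \<open>f + r * T W \<le> W\<close> keeps all partial sums below
  \<open>W\<close>. The final term in \<open>g\<close> records the mass that has survived
  \<open>n\<close> steps and is not yet summed; with \<open>g = 1\<close> it later yields the tail
  sums.\<close>

lemma supersolution:
  fixes r :: ennreal
  assumes [measurable]: "f \<in> borel_measurable S" "g \<in> borel_measurable S" "W \<in> borel_measurable S"
    and W: "\<And>x. x \<in> space S \<Longrightarrow> f x + r * T W x \<le> W x"
    and g: "\<And>x. x \<in> space S \<Longrightarrow> g x \<le> W x"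
    and x: "x \<in> space S"
  shows "(\<Sum>k<n. r ^ k * (T ^^ k) f x) + r ^ n * (T ^^ n) g x \<le> W x"
  using x
proof (induction n arbitrary: x)
  case 0
  then show ?case using g by simp
next
  case (Suc n)
  let ?F = "\<lambda>n x. (\<Sum>k<n. r ^ k * (T ^^ k) f x) + r ^ n * (T ^^ n) g x"
  have "?F (Suc n) x = f x + r * T (?F n) x"
    using Suc.prems
    by (simp add: sum.lessThan_Suc_shift T_add T_sum T_cmult sum_distrib_left distrib_left mult_ac
        del: sum.lessThan_Suc)
  also have "\<dots> \<le> f x + r * T W x"
    using Suc by (intro add_left_mono mult_left_mono T_mono) auto
  finally show ?case using W[OF Suc.prems] by (rule order_trans)
qed

lemma supersolution_suminf:
  fixes r :: ennreal
  assumes [measurable]: "f \<in> borel_measurable S" "W \<in> borel_measurable S"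
    and "\<And>x. x \<in> space S \<Longrightarrow> f x + r * T W x \<le> W x"
    and "x \<in> space S"
  shows "(\<Sum>k. r ^ k * (T ^^ k) f x) \<le> W x"
proof (rule suminf_le_const)
  fix n
  show "(\<Sum>k<n. r ^ k * (T ^^ k) f x) \<le> W x"
    using supersolution[of f "\<lambda>_. 0" W r x n] assms by (auto intro: order_trans[rotated])
qed simp

section \<open>Powers of the kernel and their decompositions at regenerations\<close>

definition nuT :: "nat \<Rightarrow> ('a \<Rightarrow> ennreal) \<Rightarrow> ennreal" where
  "nuT n f = (\<integral>\<^sup>+y. (T ^^ n) f y \<partial>\<nu>)"

lemma Pn_kernel [measurable]: "kernel_pow S P n \<in> S \<rightarrow>\<^sub>M prob_algebra S"
proof (induction n)
  case 0
  then show ?case using measurable_return_prob_space by simp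
next
  case (Suc n)
  then show ?case using kernel by (auto intro: measurable_bind_prob_space)
qed

lemma nn_integral_Pn:
  assumes f [measurable]: "f \<in> borel_measurable S" and x: "x \<in> space S"
  shows "(\<integral>\<^sup>+y. f y \<partial>kernel_pow S P n x) = (N ^^ n) f x"
  using x
proof (induction n arbitrary: x)
  case 0
  then show ?case by (simp add: nn_integral_return)
next
  case (Suc n)
  have [measurable]: "kernel_pow S P n \<in> S \<rightarrow>\<^sub>M subprob_algebra S"
    by (rule measurable_prob_algebraD) (rule Pn_kernel)
  have "(\<integral>\<^sup>+y. f y \<partial>kernel_pow S P (Suc n) x) = (\<integral>\<^sup>+y. \<integral>\<^sup>+z. f z \<partial>kernel_pow S P n y \<partial>P x)"
    using sets_P[OF Suc.prems]
    by (simp add: nn_integral_bind[where B = S] cong: measurable_cong_sets)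
  also have "\<dots> = (\<integral>\<^sup>+y. (N ^^ n) f y \<partial>P x)"
    using Suc by (intro nn_integral_cong) (simp add: space_P)
  finally show ?case by (simp add: N_def[abs_def])
qed

lemma Nn_prob: "x \<in> space S \<Longrightarrow> prob_space (kernel_pow S P n x)"
  and sets_Pn: "x \<in> space S \<Longrightarrow> sets (kernel_pow S P n x) = sets S"
  using measurable_space[OF Pn_kernel] by (auto simp: space_prob_algebra)

lemma Nn_lin:
  assumes [measurable]: "f \<in> borel_measurable S" "g \<in> borel_measurable S" and x: "x \<in> space S"
  shows "(N ^^ n) (\<lambda>y. f y + g y * c) x = (N ^^ n) f x + (N ^^ n) g x * c"
  using x sets_Pn[OF x, of n]
  by (simp add: nn_integral_Pn[symmetric] nn_integral_add nn_integral_multc cong: measurable_cong_sets)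

lemma Nn_cong:
  "(\<And>y. y \<in> space S \<Longrightarrow> f y = g y) \<Longrightarrow> x \<in> space S \<Longrightarrow> (N ^^ n) f x = (N ^^ n) g x"
  by (induction n arbitrary: x) (auto simp: N_def space_P intro!: nn_integral_cong)

lemma nuT_Suc: "nuT (Suc n) f = nuT n (T f)"
  by (simp add: nuT_def funpow_swap1)

text \<open>In the expansion of \<open>(T + bt 1_C \<otimes> \<nu>) ^ n\<close>, \<open>k\<close> is
  the time at which the rank-one term is chosen last; \<open>n - 1 - k\<close> residual steps
  follow. The induction peels off the innermost step, so \<open>f\<close> varies.\<close>

lemma last_exit:
  assumes f: "f \<in> borel_measurable S" and x: "x \<in> space S"
  shows "(N ^^ n) f x = (T ^^ n) f x + (\<Sum>k<n. ennreal bt * (N ^^ k) (indicator C) x * nuT (n - 1 - k) f)"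
  using f
proof (induction n arbitrary: f)
  case (Suc n)
  note [measurable] = Suc.prems
  have "(N ^^ Suc n) f x = (N ^^ n) (N f) x" by (simp add: funpow_swap1)
  also have "\<dots> = (N ^^ n) (\<lambda>y. T f y + indicator C y * (ennreal bt * nuT 0 f)) x"
    using x by (intro Nn_cong) (auto simp: N_eq_T nuT_def mult_ac)
  also have "\<dots> = (N ^^ n) (T f) x + (N ^^ n) (indicator C) x * (ennreal bt * nuT 0 f)"
    using x by (subst Nn_lin) auto
  also have "(N ^^ n) (T f) x = (T ^^ n) (T f) x +
      (\<Sum>k<n. ennreal bt * (N ^^ k) (indicator C) x * nuT (n - 1 - k) (T f))"
    by (rule Suc.IH) measurable
  also have "(\<Sum>k<n. ennreal bt * (N ^^ k) (indicator C) x * nuT (n - 1 - k) (T f)) =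
      (\<Sum>k<n. ennreal bt * (N ^^ k) (indicator C) x * nuT (n - k) f)"
    by (intro sum.cong refl) (simp add: nuT_Suc[symmetric] Suc_diff_Suc)
  finally show ?case by (simp add: funpow_swap1 add_ac mult_ac)
qed simp

text \<open>The mirror image of \<open>last_exit\<close>: \<open>i\<close> is the time at which the
  rank-one term is chosen first. For \<open>f = indicator C\<close> it becomes the renewal
  equation.\<close>

lemma first_entrance:
  assumes f [measurable]: "f \<in> borel_measurable S" and x: "x \<in> space S"
  shows "(N ^^ n) f x = (T ^^ n) f x +
    (\<Sum>i<n. ennreal bt * (T ^^ i) (indicator C) x * (\<integral>\<^sup>+y. (N ^^ (n - 1 - i)) f y \<partial>\<nu>))"
  using x
proof (induction n arbitrary: x)
  case (Suc n)
  let ?c = "\<lambda>k. ennreal bt * (\<integral>\<^sup>+y. (N ^^ k) f y \<partial>\<nu>)"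
  have "(N ^^ Suc n) f x = T ((N ^^ n) f) x + indicator C x * ?c n"
    using Suc.prems by (simp add: N_eq_T mult_ac)
  also have "T ((N ^^ n) f) x = T (\<lambda>y. (T ^^ n) f y + (\<Sum>i<n. ?c (n - 1 - i) * (T ^^ i) (indicator C) y)) x"
    using Suc by (intro T_cong) (auto simp: mult_ac)
  also have "\<dots> = (T ^^ Suc n) f x + (\<Sum>i<n. ?c (n - 1 - i) * (T ^^ Suc i) (indicator C) x)"
    using Suc.prems by (simp add: T_add T_sum T_cmult)
  finally show ?case
    by (simp add: sum.lessThan_Suc_shift add_ac mult_ac del: sum.lessThan_Suc)
qed simp

lemma T_suminf:
  assumes "x \<in> space S" "\<And>i. f i \<in> borel_measurable S"
  shows "T (\<lambda>y. \<Sum>i. f i y) x = (\<Sum>i. T (f i) x)"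
  unfolding T_def using assms
  by (intro nn_integral_suminf) (auto simp: sets_residual cong: measurable_cong_sets)

lemma Tn_suminf:
  assumes [measurable]: "\<And>i. f i \<in> borel_measurable S" and x: "x \<in> space S"
  shows "(T ^^ n) (\<lambda>y. \<Sum>i. f i y) x = (\<Sum>i. (T ^^ n) (f i) x)"
  using x
proof (induction n arbitrary: x)
  case (Suc n)
  have "(T ^^ Suc n) (\<lambda>y. \<Sum>i. f i y) x = T (\<lambda>y. \<Sum>i. (T ^^ n) (f i) y) x"
    using Suc by (auto intro!: T_cong)
  then show ?case using Suc.prems by (simp add: T_suminf)
qed simp

lemma nuT_mono: "(\<And>y. y \<in> space S \<Longrightarrow> f y \<le> g y) \<Longrightarrow> nuT n f \<le> nuT n g"
  unfolding nuT_def by (intro nn_integral_mono) (auto intro: Tn_mono)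

lemma nuT_add:
  "f \<in> borel_measurable S \<Longrightarrow> g \<in> borel_measurable S \<Longrightarrow> nuT n (\<lambda>y. f y + g y) = nuT n f + nuT n g"
  unfolding nuT_def by (subst nn_integral_add[symmetric]) (auto intro!: nn_integral_cong simp: Tn_add)

lemma nuT_cmult: "f \<in> borel_measurable S \<Longrightarrow> nuT n (\<lambda>y. c * f y) = c * nuT n f"
  unfolding nuT_def by (subst nn_integral_cmult[symmetric]) (auto intro!: nn_integral_cong simp: Tn_cmult)

lemma nuT_suminf:
  "(\<And>i. f i \<in> borel_measurable S) \<Longrightarrow> nuT n (\<lambda>y. \<Sum>i. f i y) = (\<Sum>i. nuT n (f i))"
  unfolding nuT_def by (subst nn_integral_suminf[symmetric]) (auto intro!: nn_integral_cong simp: Tn_suminf)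

lemma nuT_plus: "nuT n ((T ^^ m) f) = nuT (m + n) f"
  unfolding nuT_def by (simp add: funpow_add add.commute[of m n])

lemma nuT_power_suminf:
  assumes [measurable]: "f \<in> borel_measurable S"
  shows "(\<Sum>k. r ^ k * nuT k f) = (\<integral>\<^sup>+x. (\<Sum>k. r ^ k * (T ^^ k) f x) \<partial>\<nu>)"
  unfolding nuT_def by (subst nn_integral_suminf) (auto simp: nn_integral_cmult)

text \<open>The measures behind the functionals \<open>nuT k\<close>; as measures they can be added
  up to the potential.\<close>

primrec nu_residual :: "nat \<Rightarrow> 'a measure" where
  "nu_residual 0 = \<nu>"
| "nu_residual (Suc k) = nu_residual k \<bind> residual"

lemma sets_nu_residual: "sets (nu_residual k) = sets S"
proof (induction k)
  case (Suc k)
  have "space (nu_residual k) \<noteq> {}"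
    using sets_eq_imp_space_eq[OF Suc] nu.not_empty by simp
  then have "sets (nu_residual k \<bind> residual) = sets S"
    using sets_eq_imp_space_eq[OF Suc] by (intro sets_bind) (simp_all add: sets_residual)
  then show ?case by simp
qed simp

lemma nn_integral_nu_residual: "f \<in> borel_measurable S \<Longrightarrow> (\<integral>\<^sup>+x. f x \<partial>nu_residual k) = nuT k f"
proof (induction k arbitrary: f)
  case 0
  then show ?case by (simp add: nuT_def)
next
  case (Suc k)
  have "(\<integral>\<^sup>+x. f x \<partial>nu_residual (Suc k)) = (\<integral>\<^sup>+x. T f x \<partial>nu_residual k)"
    using Suc.prems sets_nu_residual[of k]
    by (simp add: T_def nn_integral_bind[where B = S] cong: measurable_cong_sets)
  then show ?case using Suc by (simp add: nuT_Suc)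
qed

lemma exists_potential_measure:
  obtains M where "sets M = sets S" "\<And>f. f \<in> borel_measurable S \<Longrightarrow> (\<integral>\<^sup>+x. f x \<partial>M) = (\<Sum>k. nuT k f)"
proof -
  obtain M where M: "sets M = sets S" "\<And>A. A \<in> sets M \<Longrightarrow> emeasure M A = (\<Sum>i. emeasure (nu_residual i) A)"
    using exists_sums_measure[of nu_residual S, OF sets_nu_residual] by blast
  have "(\<integral>\<^sup>+x. f x \<partial>M) = (\<Sum>k. nuT k f)" if f: "f \<in> borel_measurable S" for f
  proof -
    have "(\<integral>\<^sup>+x. f x \<partial>M) = (\<Sum>k. \<integral>\<^sup>+x. f x \<partial>nu_residual k)"
      using f M by (intro nn_integral_sums_measure) (auto simp: sets_nu_residual cong: measurable_cong_sets)
    then show ?thesis using f by (simp add: nn_integral_nu_residual)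
  qed
  with M that show thesis by blast
qed

end

section \<open>Moment sequences and their generating functions\<close>

text \<open>Divided by \<open>fact k\<close>, the factor becomes \<open>(n + k) choose k\<close>,
  the weight in the Taylor coefficients used in \<open>pringsheim\<close>.\<close>

lemma fps_nth_higher_deriv:
  "fps_nth ((fps_deriv ^^ k) (A :: complex fps)) n = fact (n + k) / fact n * fps_nth A (n + k)"
proof (induction k arbitrary: n)
  case (Suc k)
  have "of_nat (Suc n) / fact (Suc n) = (1 / fact n :: complex)"
    by (simp only: fact_Suc) (simp del: of_nat_Suc)
  then have "of_nat (Suc n) * (fact (n + Suc k) / fact (Suc n) * c) = (fact (n + Suc k) / fact n * c :: complex)" for c
    by (metis (no_types, lifting) mult.commute mult.assoc times_divide_eq_left times_divide_eq_right mult_1)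
  then show ?case using Suc by (simp del: of_nat_Suc fact_Suc)
qed simp

lemma higher_deriv_eval_fps:
  fixes A :: "complex fps"
  assumes "norm z < fps_conv_radius A"
  shows "(deriv ^^ k) (eval_fps A) z = eval_fps ((fps_deriv ^^ k) A) z
    \<and> fps_conv_radius ((fps_deriv ^^ k) A) \<ge> fps_conv_radius A"
  using assms
proof (induction k arbitrary: z)
  case (Suc k)
  let ?D = "(fps_deriv ^^ k) A"
  have rad: "fps_conv_radius ?D \<ge> fps_conv_radius A" using Suc by blast
  have "eventually (\<lambda>w. w \<in> eball 0 (fps_conv_radius A)) (nhds z)"
    using Suc.prems by (intro eventually_nhds_in_open) auto
  then have "deriv ((deriv ^^ k) (eval_fps A)) z = deriv (eval_fps ?D) z"
    by (intro deriv_cong_ev refl, eventually_elim) (use Suc.IH in auto)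
  also have "\<dots> = eval_fps (fps_deriv ?D) z"
    using Suc.prems rad by (intro eval_fps_deriv[symmetric]) auto
  finally show ?case
    using rad fps_conv_radius_deriv[of ?D] by auto
qed simp

text \<open>If the radius of convergence \<open>\<xi>\<close> were below \<open>R\<close>, then expanding at a point slightly below
  \<open>\<xi>\<close> and rearranging the nonnegative double series would give convergence beyond \<open>\<xi>\<close>.\<close>
lemma pringsheim:
  fixes a :: "nat \<Rightarrow> real" and G :: "complex \<Rightarrow> complex"
  assumes a: "\<And>n. a n \<ge> 0"
    and om: "open \<Omega>" and G: "G holomorphic_on \<Omega>"
    and seg: "\<And>x. 0 \<le> x \<Longrightarrow> x < R \<Longrightarrow> complex_of_real x \<in> \<Omega>"
    and r0: "r0 > 0" "ball 0 r0 \<subseteq> \<Omega>"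
    and near: "\<And>z. norm z < r0 \<Longrightarrow> (\<lambda>n. of_real (a n) * z ^ n) sums G z"
    and x: "0 \<le> x" "x < R"
  shows "summable (\<lambda>n. a n * x ^ n)"
proof -
  define A where "A = Abs_fps (\<lambda>n. complex_of_real (a n))"
  have A_nth: "fps_nth A n = of_real (a n)" for n by (simp add: A_def)
  have "fps_conv_radius A \<ge> R"
  proof (rule ccontr)
    assume "\<not> ?thesis"
    then have lt: "fps_conv_radius A < ereal R" by simp
    have ge: "fps_conv_radius A \<ge> r0"
      unfolding fps_conv_radius_def
    proof (rule conv_radius_geI_ex)
      fix r assume "0 < r" "ereal r < ereal r0"
      then show "\<exists>z. norm z = r \<and> summable (\<lambda>n. fps_nth A n * z ^ n)"
        using near[of "of_real r"] by (intro exI[of _ "of_real r"]) (auto simp: A_nth summable_def)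
    qed
    obtain \<xi> where xi: "fps_conv_radius A = ereal \<xi>"
      using lt ge by (cases "fps_conv_radius A") auto
    have \<xi>: "r0 \<le> \<xi>" "\<xi> < R" using lt ge xi by auto
    \<comment> \<open>The identity theorem needs a connected domain, and
      \<open>\<Omega> \<inter> ball 0 \<xi>\<close> may be disconnected. The component of 0 still
      contains the real segment up to \<open>\<xi>\<close>.\<close>
    define U where "U = connected_component_set (\<Omega> \<inter> ball 0 \<xi>) 0"
    have U: "open U" "connected U"
      unfolding U_def using om by (auto intro!: open_connected_component)
    have Usub: "U \<subseteq> \<Omega> \<inter> ball 0 \<xi>"
      unfolding U_def by (rule connected_component_subset)
    have seg_U: "complex_of_real y \<in> U" if "0 \<le> y" "y < \<xi>" for y
    proof -
      have "complex_of_real ` {0..<\<xi>} \<subseteq> U" unfolding U_def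
      proof (rule connected_component_maximal)
        show "0 \<in> complex_of_real ` {0..<\<xi>}" using r0 \<xi> by force
        show "connected (complex_of_real ` {0..<\<xi>})"
          by (intro connected_continuous_image continuous_intros) simp
        show "complex_of_real ` {0..<\<xi>} \<subseteq> \<Omega> \<inter> ball 0 \<xi>" using seg \<xi> by auto
      qed
      then show ?thesis using that by auto
    qed
    have ball_U: "ball 0 r0 \<subseteq> U"
      unfolding U_def using r0 \<xi> by (intro connected_component_maximal) auto
    have eq: "eval_fps A z = G z" if "z \<in> U" for z
    proof (rule analytic_continuation_open[of "ball 0 r0" U "eval_fps A" G])
      show "eval_fps A holomorphic_on U"
        using Usub by (intro holomorphic_on_eval_fps) (auto simp: xi)
      show "G holomorphic_on U" using G Usub by (auto intro: holomorphic_on_subset)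
      show "eval_fps A z = G z" if "z \<in> ball 0 r0" for z
        using near[of z] that by (auto simp: eval_fps_def A_nth sums_iff)
    qed (use U r0 ball_U that in auto)
    obtain e where e: "e > 0" "ball (of_real \<xi>) e \<subseteq> \<Omega>"
      using om seg[of \<xi>] \<xi> r0 by (auto simp: open_contains_ball)
    \<comment> \<open>The centre \<open>c\<close> lies \<open>\<delta>\<close> below
      \<open>\<xi>\<close>. The disc of radius \<open>3 * \<delta>\<close> about \<open>c\<close>
      stays inside the disc of radius \<open>e \<ge> 4 * \<delta>\<close> about
      \<open>\<xi>\<close>, and the step \<open>h = 2 * \<delta>\<close>, which is within that
      radius, ends at \<open>\<xi> + \<delta>\<close>, beyond the supposed radius of
      convergence.\<close>
    define \<delta> where "\<delta> = min e \<xi> / 4"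
    define c where "c = \<xi> - \<delta>"
    have \<delta>: "\<delta> > 0" "4 * \<delta> \<le> e" "4 * \<delta> \<le> \<xi>" using e r0 \<xi> by (auto simp: \<delta>_def)
    have c: "0 < c" "c < \<xi>" using \<delta> by (auto simp: c_def)
    define F where "F = fps_expansion G (of_real c)"
    have "G holomorphic_on eball (of_real c) (ereal (3 * \<delta>))"
    proof (rule holomorphic_on_subset[OF G])
      have "dist (complex_of_real \<xi>) (of_real c) = \<delta>"
        using \<delta> by (simp add: dist_norm c_def)
      then have "ball (complex_of_real c) (3 * \<delta>) \<subseteq> ball (of_real \<xi>) e"
        using \<delta> by (simp add: ball_subset_ball_iff dist_commute)
      then show "eball (complex_of_real c) (ereal (3 * \<delta>)) \<subseteq> \<Omega>" using e by auto
    qed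
    then have radF: "fps_conv_radius F \<ge> ereal (3 * \<delta>)"
      unfolding F_def by (rule conv_radius_fps_expansion)
    define B where "B k = (\<Sum>n. real ((n + k) choose k) * a (n + k) * c ^ n)" for k
    have F_nth: "fps_nth F k = of_real (B k)"
      and B_sums: "summable (\<lambda>n. real ((n + k) choose k) * a (n + k) * c ^ n)" for k
    proof -
      have cU: "complex_of_real c \<in> U" using seg_U c by auto
      have "eventually (\<lambda>w. w \<in> U) (nhds (complex_of_real c))"
        using U cU by (intro eventually_nhds_in_open)
      then have "(deriv ^^ k) G (of_real c) = (deriv ^^ k) (eval_fps A) (of_real c)"
        by (intro higher_deriv_cong_ev refl, eventually_elim) (use eq in auto)
      also have "\<dots> = eval_fps ((fps_deriv ^^ k) A) (of_real c)"
        using higher_deriv_eval_fps[of "of_real c" A k] c by (simp add: xi)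
      finally have 1: "fps_nth F k = eval_fps ((fps_deriv ^^ k) A) (of_real c) / fact k"
        by (simp add: F_def fps_expansion_def)
      have "(\<lambda>n. fps_nth ((fps_deriv ^^ k) A) n * of_real c ^ n) sums
          eval_fps ((fps_deriv ^^ k) A) (of_real c)"
      proof (rule sums_eval_fps)
        have "ereal (norm (complex_of_real c)) < ereal \<xi>" using c by simp
        also have "\<dots> \<le> fps_conv_radius ((fps_deriv ^^ k) A)"
          using higher_deriv_eval_fps[of "of_real c" A k] c by (simp add: xi)
        finally show "ereal (norm (complex_of_real c)) < fps_conv_radius ((fps_deriv ^^ k) A)" .
      qed
      then have "(\<lambda>n. fps_nth ((fps_deriv ^^ k) A) n * of_real c ^ n / fact k) sums fps_nth F k"
        unfolding 1 by (rule sums_divide)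
      moreover have "fps_nth ((fps_deriv ^^ k) A) n * of_real c ^ n / fact k =
          of_real (real ((n + k) choose k) * a (n + k) * c ^ n)" for n
        by (simp add: fps_nth_higher_deriv A_nth binomial_fact field_simps)
      ultimately have 2: "(\<lambda>n. complex_of_real (real ((n + k) choose k) * a (n + k) * c ^ n)) sums fps_nth F k"
        by simp
      then show "summable (\<lambda>n. real ((n + k) choose k) * a (n + k) * c ^ n)"
        by (metis summable_def summable_of_real_iff)
      then have "(\<lambda>n. complex_of_real (real ((n + k) choose k) * a (n + k) * c ^ n)) sums of_real (B k)"
        unfolding B_def by (intro sums_of_real summable_sums)
      with 2 show "fps_nth F k = of_real (B k)" by (rule sums_unique2)
    qed
    have B_nonneg: "B k \<ge> 0" for k
      unfolding B_def using a c by (intro suminf_nonneg B_sums) auto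
    define h where "h = 2 * \<delta>"
    have "summable (\<lambda>k. fps_nth F k * of_real h ^ k)"
      using \<delta> by (intro summable_fps) (auto simp: h_def intro!: less_le_trans[OF _ radF])
    then have "summable (\<lambda>k. complex_of_real (B k * h ^ k))" by (simp add: F_nth)
    then have Bh: "summable (\<lambda>k. B k * h ^ k)" by (simp only: summable_of_real_iff)
    \<comment> \<open>Expand \<open>(c + h) ^ n\<close> and sum over \<open>n\<close> first. All
      terms are nonnegative, so each inner sum is at most the Taylor coefficient \<open>B k\<close>
      and the outer sum at most the Taylor series at distance \<open>h\<close>.\<close>
    have bound: "(\<Sum>n<M. a n * (c + h) ^ n) \<le> (\<Sum>k. B k * h ^ k)" for M
    proof -
      have "(\<Sum>n<M. a n * (c + h) ^ n) = (\<Sum>n<M. \<Sum>k\<le>n. real (n choose k) * a n * c ^ (n - k) * h ^ k)"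
        by (simp add: add.commute[of c h] binomial_ring sum_distrib_left mult_ac)
      also have "\<dots> = (\<Sum>n<M. \<Sum>k | k < M \<and> k \<le> n. real (n choose k) * a n * c ^ (n - k) * h ^ k)"
        by (intro sum.cong) auto
      also have "\<dots> = (\<Sum>k<M. \<Sum>n | n < M \<and> k \<le> n. real (n choose k) * a n * c ^ (n - k) * h ^ k)"
        using sum.swap_restrict[of "{..<M}" "{..<M}" "\<lambda>n k. real (n choose k) * a n * c ^ (n - k) * h ^ k" "\<lambda>n k. k \<le> n"]
        by simp
      also have "\<dots> \<le> (\<Sum>k<M. B k * h ^ k)"
      proof (rule sum_mono)
        fix k assume "k \<in> {..<M}"
        have "(\<Sum>n | n < M \<and> k \<le> n. real (n choose k) * a n * c ^ (n - k)) =
            (\<Sum>n<M - k. real ((n + k) choose k) * a (n + k) * c ^ n)"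
          by (rule sum.reindex_bij_witness[of _ "\<lambda>n. n + k" "\<lambda>n. n - k"]) auto
        also have "\<dots> \<le> B k"
          unfolding B_def using a c by (intro sum_le_suminf B_sums) auto
        finally show "(\<Sum>n | n < M \<and> k \<le> n. real (n choose k) * a n * c ^ (n - k) * h ^ k) \<le> B k * h ^ k"
          using \<delta> by (simp add: sum_distrib_right[symmetric] mult_right_mono h_def)
      qed
      also have "\<dots> \<le> (\<Sum>k. B k * h ^ k)"
        using B_nonneg \<delta> by (intro sum_le_suminf Bh) (auto simp: h_def)
      finally show ?thesis .
    qed
    have "summable (\<lambda>n. a n * (c + h) ^ n)"
      using a c \<delta> bound by (intro summableI_nonneg_bounded[of _ "\<Sum>k. B k * h ^ k"]) (auto simp: h_def)
    then have "summable (\<lambda>n. fps_nth A n * of_real (c + h) ^ n)"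
      unfolding A_nth of_real_power[symmetric] of_real_mult[symmetric] summable_of_real_iff .
    then have "fps_conv_radius A \<ge> norm (complex_of_real (c + h))"
      unfolding fps_conv_radius_def by (rule conv_radius_geI)
    then show False using \<delta> c by (simp add: xi c_def h_def del: of_real_add of_real_diff)
  qed
  then have "summable (\<lambda>n. fps_nth A n * of_real x ^ n)"
    using x by (intro summable_fps) (auto intro: less_le_trans[rotated])
  then show ?thesis
    unfolding A_nth of_real_power[symmetric] of_real_mult[symmetric] summable_of_real_iff .
qed

text \<open>Log-convexity makes the ratios of consecutive terms nondecreasing, so a single ratio
  above 1 would force geometric growth.\<close>

lemma log_convex_bounded_antimono:
  fixes y :: "nat \<Rightarrow> real"
  assumes nonneg: "\<And>n. y n \<ge> 0" and conv: "\<And>n. (y (Suc n))\<^sup>2 \<le> y n * y (Suc (Suc n))"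
    and bd: "\<And>n. y n \<le> B"
  shows "y (Suc n) \<le> y n"
proof (rule ccontr)
  assume gt: "\<not> ?thesis"
  have pos: "y n > 0"
  proof (rule ccontr)
    assume "\<not> y n > 0"
    then have "y n = 0" using nonneg[of n] by simp
    then show False using conv[of n] gt by simp
  qed
  define q where "q = y (Suc n) / y n"
  have q: "q > 1" using gt pos by (simp add: q_def)
  have step: "y (n + k) > 0 \<and> y (Suc (n + k)) \<ge> q * y (n + k)" for k
  proof (induction k)
    case 0
    then show ?case using pos by (simp add: q_def)
  next
    case (Suc k)
    let ?a = "y (n + k)" and ?b = "y (Suc (n + k))" and ?c = "y (Suc (Suc (n + k)))"
    have b: "?b > 0" using Suc q by (smt (verit) mult_pos_pos)
    have "q * ?a * ?b \<le> ?b\<^sup>2" using Suc b by (simp add: power2_eq_square)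
    also have "\<dots> \<le> ?a * ?c" by (rule conv)
    finally have "?a * (q * ?b) \<le> ?a * ?c" by (simp add: mult_ac)
    then show ?case using Suc b by simp
  qed
  have grow: "y (n + k) \<ge> q ^ k * y n" for k
  proof (induction k)
    case (Suc k)
    have "q ^ Suc k * y n \<le> q * y (n + k)" using Suc q by simp
    then show ?case using step[of k] by simp
  qed simp
  obtain k where "q ^ k > B / y n" using real_arch_pow[OF q] by blast
  then have "q ^ k * y n > B" using pos by (simp add: field_simps)
  then show False using grow[of k] bd[of "n + k"] by simp
qed

text \<open>The generating function of \<open>v\<close> is \<open>NN z / ((1 - z) TT z)\<close>, which has no singularity on the real
  interval \<open>(- R, R)\<close>.  Its even part has nonnegative coefficients, so Pringsheim's theorem applies,
  and log-convexity removes the subexponential factor.\<close>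
lemma moment_decay:
  fixes v \<tau> \<eta> :: "nat \<Rightarrow> real" and R :: real
  defines "FF \<equiv> Abs_fps (\<lambda>n. complex_of_real (v n))"
    and "TT \<equiv> Abs_fps (\<lambda>n. complex_of_real (\<tau> n))"
    and "NN \<equiv> Abs_fps (\<lambda>n. complex_of_real (\<eta> n))"
  assumes R: "R > 1"
    and even_nonneg: "\<And>n. v (2 * n) \<ge> 0"
    and log_convex: "\<And>n. (v (2 * Suc n))\<^sup>2 \<le> v (2 * n) * v (2 * Suc (Suc n))"
    and v_bd: "\<And>n. \<bar>v n\<bar> \<le> Bd"
    and radT: "fps_conv_radius TT \<ge> R" and radN: "fps_conv_radius NN \<ge> R"
    and identity: "(1 - fps_X) * TT * FF = NN"
    and N1: "eval_fps NN 1 = 0"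
    and T_nz: "\<And>x. \<bar>x\<bar> < R \<Longrightarrow> eval_fps TT (of_real x) \<noteq> 0"
  shows "v (2 * n) \<le> v 0 * (1 / R) ^ (2 * n)"
proof -
  have hT: "eval_fps TT holomorphic_on ball 0 R"
    by (intro holomorphic_on_eval_fps) (auto intro!: less_le_trans[OF _ radT])
  have hN: "eval_fps NN holomorphic_on ball 0 R"
    by (intro holomorphic_on_eval_fps) (auto intro!: less_le_trans[OF _ radN])
  \<comment> \<open>As \<open>NN\<close> vanishes at 1, this is \<open>NN z / (z - 1)\<close> with
    its singularity removed; \<open>G0\<close> then continues \<open>NN z / ((1 - z) * TT z)\<close>
    across 1.\<close>
  define Q where "Q z = (if z = 1 then deriv (eval_fps NN) 1 else (eval_fps NN z - eval_fps NN 1) / (z - 1))" for z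
  have hQ: "Q holomorphic_on ball 0 R"
    unfolding Q_def[abs_def] by (rule pole_lemma_open[OF hN]) simp
  define G0 where "G0 z = - Q z / eval_fps TT z" for z
  define \<Omega>0 where "\<Omega>0 = ball 0 R \<inter> eval_fps TT -` (- {0})"
  \<comment> \<open>The even part \<open>G\<close> needs both \<open>z\<close> and
    \<open>- z\<close> in the domain. Its coefficients \<open>v (2 * n)\<close> are nonnegative,
    whereas the odd ones have no known sign.\<close>
  define \<Omega> where "\<Omega> = \<Omega>0 \<inter> uminus -` \<Omega>0"
  define G where "G z = (G0 z + G0 (- z)) / 2" for z
  have o0: "open \<Omega>0"
    unfolding \<Omega>0_def using hT
    by (intro continuous_open_preimage holomorphic_on_imp_continuous_on) auto
  have o: "open \<Omega>"
    unfolding \<Omega>_def using o0 by (intro open_Int open_vimage continuous_intros) auto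
  have hG0: "G0 holomorphic_on \<Omega>0"
    unfolding G0_def[abs_def]
    by (intro holomorphic_on_divide holomorphic_on_minus holomorphic_on_subset[OF hQ]
        holomorphic_on_subset[OF hT]) (auto simp: \<Omega>0_def)
  have "(G0 \<circ> uminus) holomorphic_on \<Omega>"
    by (rule holomorphic_on_compose_gen[OF _ hG0]) (auto intro: holomorphic_intros simp: \<Omega>_def)
  then have hG: "G holomorphic_on \<Omega>"
    unfolding G_def[abs_def] using hG0
    by (intro holomorphic_intros) (auto simp: \<Omega>_def o_def intro: holomorphic_on_subset)
  have seg: "complex_of_real x \<in> \<Omega>" if "\<bar>x\<bar> < R" for x
    using T_nz[OF that] T_nz[of "- x"] that by (auto simp: \<Omega>_def \<Omega>0_def)
  obtain e where e: "e > 0" "ball 0 e \<subseteq> \<Omega>"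
    using o seg[of 0] R by (auto simp: open_contains_ball)
  define r0 where "r0 = min e 1"
  have r0: "r0 > 0" "ball 0 r0 \<subseteq> \<Omega>" "r0 \<le> 1" using e by (auto simp: r0_def)
  have radF: "fps_conv_radius FF \<ge> 1"
    unfolding fps_conv_radius_def one_ereal_def
  proof (rule conv_radius_geI_ex)
    fix r :: real assume r: "0 < r" "ereal r < ereal 1"
    have "summable (\<lambda>n. fps_nth FF n * of_real r ^ n)"
    proof (rule summable_comparison_test')
      show "summable (\<lambda>n. Bd * r ^ n)" using r by (intro summable_mult summable_geometric) auto
      show "norm (fps_nth FF n * of_real r ^ n) \<le> Bd * r ^ n" for n
        using v_bd[of n] r by (simp add: FF_def norm_mult norm_power mult_right_mono)
    qed
    then show "\<exists>z. norm z = r \<and> summable (\<lambda>n. fps_nth FF n * z ^ n)"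
      using r by (intro exI[of _ "of_real r"]) auto
  qed
  have F_eq: "eval_fps FF z = G0 z" if "z \<in> \<Omega>0" "norm z < 1" for z
  proof -
    have z1: "z \<noteq> 1" using that by auto
    have T: "ereal (norm z) < fps_conv_radius TT"
      using that R radT by (auto intro!: less_le_trans[OF _ radT])
    have F: "ereal (norm z) < fps_conv_radius FF"
      using that by (auto intro!: less_le_trans[OF _ radF] simp: one_ereal_def)
    have rad1X: "fps_conv_radius (1 - fps_X :: complex fps) = \<infinity>"
      using fps_conv_radius_diff[of "1 :: complex fps" fps_X] by simp
    have rad: "ereal (norm z) < fps_conv_radius ((1 - fps_X) * TT)"
      using fps_conv_radius_mult[of "1 - fps_X" TT] T rad1X by (auto intro: less_le_trans)
    have "eval_fps NN z = eval_fps ((1 - fps_X) * TT) z * eval_fps FF z"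
      using rad F by (simp add: identity[symmetric] eval_fps_mult)
    also have "eval_fps ((1 - fps_X) * TT) z = (1 - z) * eval_fps TT z"
      using T rad1X by (simp add: eval_fps_mult eval_fps_diff)
    finally show ?thesis
      using that z1 N1 by (simp add: G0_def Q_def \<Omega>0_def field_simps)
  qed
  define a where "a n = (if even n then v n else 0)" for n
  have near: "(\<lambda>n. complex_of_real (a n) * z ^ n) sums G z" if "norm z < r0" for z
  proof -
    have z: "z \<in> \<Omega>" "norm z < 1" using that r0 by auto
    have s: "(\<lambda>n. complex_of_real (v n) * w ^ n) sums eval_fps FF w" if "norm w < 1" for w
    proof -
      have "ereal (norm w) < fps_conv_radius FF"
        using that by (auto intro!: less_le_trans[OF _ radF] simp: one_ereal_def)
      from sums_eval_fps[OF this] show ?thesis by (simp add: FF_def)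
    qed
    have "(\<lambda>n. (complex_of_real (v n) * z ^ n + complex_of_real (v n) * (- z) ^ n) / 2) sums
        ((eval_fps FF z + eval_fps FF (- z)) / 2)"
      using z by (intro sums_divide sums_add s) auto
    moreover have "(complex_of_real (v n) * z ^ n + complex_of_real (v n) * (- z) ^ n) / 2 =
        complex_of_real (a n) * z ^ n" for n
      by (simp add: a_def power_minus')
    ultimately show ?thesis using z by (simp add: G_def F_eq \<Omega>_def)
  qed
  have a_nonneg: "a n \<ge> 0" for n
    using even_nonneg by (auto simp: a_def elim!: evenE)
  have main: "v (2 * n) * x ^ (2 * n) \<le> v 0" if x: "1 \<le> x" "x < R" for x
  proof -
    have "summable (\<lambda>n. a n * x ^ n)"
      using x by (intro pringsheim[OF a_nonneg o hG _ r0(1,2) near]) (auto intro: seg)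
    then have "(\<lambda>n. a n * x ^ n) \<longlonglongrightarrow> 0" by (rule summable_LIMSEQ_zero)
    then obtain B where B: "\<And>n. norm (a n * x ^ n) \<le> B"
      using convergent_imp_Bseq convergentI by (metis BseqE)
    \<comment> \<open>A geometric weight preserves log-convexity, and summability at
      \<open>x\<close> bounds \<open>y\<close>; a bounded log-convex sequence stays below its first
      term.\<close>
    define y where "y n = v (2 * n) * x ^ (2 * n)" for n
    have "y (Suc n) \<le> y n" for n
    proof (rule log_convex_bounded_antimono)
      show "y n \<ge> 0" for n using even_nonneg x by (simp add: y_def)
      show "y n \<le> B" for n using B[of "2 * n"] by (simp add: y_def a_def)
      show "(y (Suc n))\<^sup>2 \<le> y n * y (Suc (Suc n))" for n
      proof -
        have "(x ^ (2 * Suc n))\<^sup>2 = x ^ (2 * Suc n * 2)" by (rule power_mult[symmetric])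
        also have "2 * Suc n * 2 = 4 * n + 4" by simp
        finally have "(y (Suc n))\<^sup>2 = (v (2 * Suc n))\<^sup>2 * x ^ (4 * n + 4)"
          by (simp only: y_def power_mult_distrib)
        also have "\<dots> \<le> v (2 * n) * v (2 * Suc (Suc n)) * x ^ (4 * n + 4)"
          using log_convex x by (intro mult_right_mono) auto
        also have "\<dots> = y n * y (Suc (Suc n))"
        proof -
          have "x ^ (2 * n) * x ^ (2 * Suc (Suc n)) = x ^ (4 * n + 4)"
            unfolding power_add[symmetric] by (rule arg_cong[of _ _ "\<lambda>k. x ^ k"]) simp
          then show ?thesis unfolding y_def by (metis mult.assoc mult.left_commute)
        qed
        finally show ?thesis .
      qed
    qed
    then have "y n \<le> y 0" by (intro decseqD[of y]) (auto intro: decseq_SucI)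
    then show ?thesis by (simp add: y_def)
  qed
  \<comment> \<open>The bound \<open>v 0\<close> is the same for all \<open>x < R\<close>, so
    \<open>x\<close> may tend to \<open>R\<close>: the rate at the endpoint is reached with no loss
    in the constant.\<close>
  have "v (2 * n) * R ^ (2 * n) \<le> v 0"
  proof (rule tendsto_upperbound)
    show "((\<lambda>x. v (2 * n) * x ^ (2 * n)) \<longlongrightarrow> v (2 * n) * R ^ (2 * n)) (at_left R)"
      by (intro tendsto_intros)
    have "eventually (\<lambda>x. x \<in> {1<..<R}) (at_left R)"
      using R by (intro eventually_at_leftI[of 1]) auto
    then show "\<forall>\<^sub>F x in at_left R. v (2 * n) * x ^ (2 * n) \<le> v 0"
      by eventually_elim (use main in auto)
  qed simp
  then show ?thesis using R by (simp add: field_simps)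
qed

section \<open>Potential bounds from the drift condition\<close>

text \<open>The concave function \<open>t powr s\<close> lies below its tangent at \<open>a\<close>;
  in this form it is Young's inequality.\<close>

lemma powr_le_tangent:
  fixes t a s :: real
  assumes "t \<ge> 0" "a > 0" "0 \<le> s" "s \<le> 1"
  shows "t powr s \<le> a powr s * (s * t / a + (1 - s))"
proof (cases "t = 0")
  case True
  then show ?thesis using assms by simp
next
  case False
  have "(t / a) powr s * 1 powr (1 - s) \<le> s * (t / a) + (1 - s) * 1"
    using assms False by (intro Youngs_inequality_0) auto
  then show ?thesis
    using assms by (simp add: powr_divide field_simps)
qed

text \<open>Jensen's inequality for a measure of mass at most \<open>m\<close> and mean at most
  \<open>a\<close>. Upper bounds suffice because the tangent has nonnegative coefficients.\<close>

lemma nn_integral_powr_le: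
  fixes f :: "'a \<Rightarrow> real"
  assumes [measurable]: "f \<in> borel_measurable M" and f: "\<And>x. x \<in> space M \<Longrightarrow> f x \<ge> 0"
    and mass: "emeasure M (space M) \<le> ennreal m" and m: "m \<ge> 0"
    and int: "(\<integral>\<^sup>+x. ennreal (f x) \<partial>M) \<le> ennreal (m * a)" and a: "a > 0" and s: "0 \<le> s" "s \<le> 1"
  shows "(\<integral>\<^sup>+x. ennreal (f x powr s) \<partial>M) \<le> ennreal (m * a powr s)"
proof -
  have "(\<integral>\<^sup>+x. ennreal (f x powr s) \<partial>M) \<le>
      (\<integral>\<^sup>+x. ennreal (a powr s * (s / a)) * ennreal (f x) + ennreal (a powr s * (1 - s)) \<partial>M)"
  proof (rule nn_integral_mono)
    fix x assume x: "x \<in> space M"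
    have "f x powr s \<le> a powr s * (s / a) * f x + a powr s * (1 - s)"
      using powr_le_tangent[OF f[OF x] a s] by (simp add: algebra_simps)
    then have "ennreal (f x powr s) \<le> ennreal (a powr s * (s / a) * f x + a powr s * (1 - s))"
      by (rule ennreal_leI)
    also have "\<dots> = ennreal (a powr s * (s / a)) * ennreal (f x) + ennreal (a powr s * (1 - s))"
      using f[OF x] a s by (subst ennreal_plus) (auto simp: ennreal_mult[symmetric])
    finally show "ennreal (f x powr s) \<le> \<dots>" .
  qed
  also have "\<dots> = ennreal (a powr s * (s / a)) * (\<integral>\<^sup>+x. ennreal (f x) \<partial>M) +
      ennreal (a powr s * (1 - s)) * emeasure M (space M)"
    by (simp add: nn_integral_add nn_integral_cmult)
  also have "\<dots> \<le> ennreal (a powr s * (s / a)) * ennreal (m * a) + ennreal (a powr s * (1 - s)) * ennreal m"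
    by (intro add_mono mult_left_mono int mass) auto
  also have "\<dots> = ennreal (a powr s * (s / a) * (m * a) + a powr s * (1 - s) * m)"
  proof -
    have "ennreal A * ennreal (m * a) + ennreal B * ennreal m = ennreal (A * (m * a) + B * m)"
      if "A \<ge> 0" "B \<ge> 0" for A B
      using that a m by (simp add: ennreal_mult[symmetric])
    then show ?thesis using a s by simp
  qed
  also have "a powr s * (s / a) * (m * a) + a powr s * (1 - s) * m = m * a powr s"
    using a by (simp add: field_simps)
  finally show ?thesis .
qed

lemma nn_integral_zero_mass:
  assumes "emeasure M (space M) = 0"
  shows "(\<integral>\<^sup>+x. f x \<partial>M) = 0"
proof -
  have "AE x in M. f x = 0"
    by (rule AE_I[of _ _ "space M"]) (use assms in auto)
  then show ?thesis by (subst nn_integral_cong_AE[of f "\<lambda>_. 0"]) auto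
qed

text \<open>Slopes of chords from the point 1 increase, because \<open>t \<ge> 1\<close> makes the
  power convex.\<close>

lemma powr_minus_one_chord:
  fixes r L t :: real
  assumes "1 < r" "r \<le> L" "t \<ge> 1"
  shows "(r powr t - 1) / (r - 1) \<le> (L powr t - 1) / (L - 1)"
proof -
  define \<theta> where "\<theta> = (r - 1) / (L - 1)"
  have th: "0 \<le> \<theta>" "\<theta> \<le> 1" using assms by (auto simp: \<theta>_def)
  have "\<theta> * (L - 1) = r - 1" using assms by (simp add: \<theta>_def)
  then have r: "r = (1 - \<theta>) * 1 + \<theta> * L" by (simp add: algebra_simps)
  have "((1 - \<theta>) *\<^sub>R 1 + \<theta> *\<^sub>R L) powr t \<le> (1 - \<theta>) * 1 powr t + \<theta> * L powr t"
    using assms th by (intro convex_onD[OF powr_convex]) auto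
  moreover have "(1 - \<theta>) *\<^sub>R 1 + \<theta> *\<^sub>R L = r" using r by simp
  ultimately have "r powr t - 1 \<le> \<theta> * (L powr t - 1)"
    by (simp add: algebra_simps)
  then show ?thesis using assms by (simp add: \<theta>_def field_simps)
qed

text \<open>The parameter \<open>Kt\<close> covers every choice of \<alpha>_2 at once:
  \<open>K / bt\<close>, 1 or a given bound. For an atom it is \<open>K\<close>.\<close>

locale drift_kernel = minorized_kernel +
  fixes V :: "'a \<Rightarrow> real" and lam K Kt :: real
  assumes drift: "drift S P C V lam K"
    and nuC: "measure \<nu> C > 0"
    and Kt: "emeasure \<nu> C + (\<integral>\<^sup>+x\<in>space S - C. ennreal (V x) \<partial>\<nu>) \<le> ennreal Kt"
begin

lemma V_meas [measurable]: "V \<in> borel_measurable S"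
  and V_ge_1: "x \<in> space S \<Longrightarrow> V x \<ge> 1"
  and lam: "0 < lam" "lam < 1"
  and drift_out: "x \<in> space S \<Longrightarrow> x \<notin> C \<Longrightarrow> N (\<lambda>y. ennreal (V y)) x \<le> ennreal (lam * V x)"
  and drift_in: "x \<in> C \<Longrightarrow> N (\<lambda>y. ennreal (V y)) x \<le> ennreal K"
  using drift by (auto simp: drift_def N_def)

lemma C_nonempty: "C \<noteq> {}"
  using nuC by auto

text \<open>Moves the drift bounds from \<open>V\<close> to \<open>V - 1\<close>, the function in
  which all supersolutions are affine; the shift is exact since \<open>P x\<close> has mass
  1.\<close>

lemma N_V1:
  assumes x: "x \<in> space S"
  shows "N (\<lambda>y. ennreal (V y)) x = N (\<lambda>y. ennreal (V y - 1)) x + 1"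
proof -
  interpret P: prob_space "P x" by (rule P_prob) fact
  have "N (\<lambda>y. ennreal (V y)) x = N (\<lambda>y. ennreal (V y - 1) + 1) x"
    unfolding N_def using V_ge_1 space_P[OF x]
    by (intro nn_integral_cong) (auto simp: ennreal_plus[symmetric] ennreal_1[symmetric] simp del: ennreal_plus ennreal_1)
  also have "\<dots> = N (\<lambda>y. ennreal (V y - 1)) x + 1"
    unfolding N_def using sets_P[OF x]
    by (simp add: nn_integral_add P.emeasure_space_1 cong: measurable_cong_sets)
  finally show ?thesis .
qed

lemma ennreal_add_one_leD: "z + 1 \<le> ennreal b \<Longrightarrow> 1 \<le> b \<and> z \<le> ennreal (b - 1)" for b :: real and z :: ennreal
proof -
  assume z: "z + 1 \<le> ennreal b"
  have "1 \<le> z + 1" by simp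
  also note z
  finally have b: "1 \<le> b" by (simp add: ennreal_1[symmetric] ennreal_le_iff2 del: ennreal_1)
  have "ennreal b = ennreal (b - 1) + 1"
    using b by (simp add: ennreal_plus[symmetric] ennreal_1[symmetric] del: ennreal_plus ennreal_1)
  with z b show ?thesis by (simp add: add.commute[of _ 1])
qed

text \<open>Since \<open>V \<ge> 1\<close> forces \<open>PV \<ge> 1\<close>, the drift condition
  itself implies \<open>V \<ge> 1 / lam\<close> off \<open>C\<close>. This later makes the exponent
  in \<open>Phi_chord\<close> at least 1.\<close>

lemma lamV_ge_1: "x \<in> space S \<Longrightarrow> x \<notin> C \<Longrightarrow> 1 \<le> lam * V x"
  and N_V1_out: "x \<in> space S \<Longrightarrow> x \<notin> C \<Longrightarrow> N (\<lambda>y. ennreal (V y - 1)) x \<le> ennreal (lam * V x - 1)"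
  using ennreal_add_one_leD drift_out by (auto simp: N_V1)

lemma K_ge_1: "1 \<le> K" and N_V1_in: "x \<in> C \<Longrightarrow> N (\<lambda>y. ennreal (V y - 1)) x \<le> ennreal (K - 1)"
  using ennreal_add_one_leD drift_in C_nonempty C_subset by (auto simp: N_V1)

text \<open>If \<open>bt = 1\<close>, the residual kernel vanishes on \<open>C\<close>; this covers the case of an atom.\<close>

definition "v1 = enn2real (\<integral>\<^sup>+y. ennreal (V y - 1) \<partial>\<nu>)"

definition "k1 = (if bt = 1 then 0 else K - 1 - bt * v1)"

lemma v1_nonneg: "v1 \<ge> 0" by (simp add: v1_def)

lemma TV1_bound: "x \<in> C \<Longrightarrow> T (\<lambda>y. ennreal (V y - 1)) x + ennreal bt * (\<integral>\<^sup>+y. ennreal (V y - 1) \<partial>\<nu>) \<le> ennreal (K - 1)"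
  using N_V1_in[of x] C_subset[of x] N_eq_T[of x "\<lambda>y. ennreal (V y - 1)"] by simp

lemma nu_V1: "(\<integral>\<^sup>+y. ennreal (V y - 1) \<partial>\<nu>) = ennreal v1"
proof -
  obtain x where x: "x \<in> C" using C_nonempty by auto
  have "ennreal bt * (\<integral>\<^sup>+y. ennreal (V y - 1) \<partial>\<nu>) \<le> ennreal (K - 1)"
    using TV1_bound[OF x] by (auto intro: order_trans[rotated])
  then have "ennreal bt * (\<integral>\<^sup>+y. ennreal (V y - 1) \<partial>\<nu>) < top" by (rule le_less_trans) simp
  then have "(\<integral>\<^sup>+y. ennreal (V y - 1) \<partial>\<nu>) < top" using bt_pos by (auto simp: ennreal_mult_less_top)
  then show ?thesis by (simp add: v1_def)
qed

lemma v1_k1: "bt * v1 + k1 \<le> K - 1" and k1_nonneg: "k1 \<ge> 0"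
  and T_V1_in: "x \<in> C \<Longrightarrow> T (\<lambda>y. ennreal (V y - 1)) x \<le> ennreal k1"
proof -
  have 1: "bt * v1 \<le> K - 1"
  proof -
    obtain x where x: "x \<in> C" using C_nonempty by auto
    have "ennreal bt * (\<integral>\<^sup>+y. ennreal (V y - 1) \<partial>\<nu>) \<le> ennreal (K - 1)"
      using TV1_bound[OF x] by (auto intro: order_trans[rotated])
    then show ?thesis
      using v1_nonneg bt_pos K_ge_1 by (simp add: nu_V1 ennreal_mult[symmetric])
  qed
  then show "bt * v1 + k1 \<le> K - 1" "k1 \<ge> 0" by (auto simp: k1_def)
  assume x: "x \<in> C"
  show "T (\<lambda>y. ennreal (V y - 1)) x \<le> ennreal k1"
  proof (cases "bt = 1")
    case True
    then have "T (\<lambda>_. 1) x = 0" using T_one_in[OF x] by simp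
    then have "emeasure (residual x) (space (residual x)) = 0" by (simp add: T_def)
    then show ?thesis by (simp add: T_def nn_integral_zero_mass)
  next
    case False
    have "T (\<lambda>y. ennreal (V y - 1)) x + ennreal (bt * v1) \<le> ennreal (K - 1)"
      using TV1_bound[OF x] v1_nonneg bt_pos by (simp add: nu_V1 ennreal_mult[symmetric])
    also have "ennreal (K - 1) = ennreal k1 + ennreal (bt * v1)"
      using False 1 v1_nonneg bt_pos by (simp add: k1_def ennreal_plus[symmetric] del: ennreal_plus)
    finally show ?thesis by (simp add: add.commute[of _ "ennreal (bt * v1)"])
  qed
qed

text \<open>Write \<open>r = lam powr (- s)\<close> with \<open>0 \<le> s \<le> 1\<close>.  By Jensen \<open>r P (V powr s) \<le> V powr s\<close> off \<open>C\<close>,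
  so \<open>Phi r x\<close> dominates the expectation of \<open>r\<close> to the power of the hitting time of \<open>C\<close>.
  \<open>DD r\<close> is the paper's \<open>D\<close> at \<open>\<gamma> = 1 / r\<close>; it is \<open>1\<close> for \<open>bt = 1\<close>, whatever
  the junk value of \<open>alpha1\<close>.\<close>

definition "drift_exponent r = ln r / ln (1 / lam)"
definition "Phi r x = (if x \<in> C then 1 else V x powr drift_exponent r)"
definition "DD r = 1 - (1 - bt) * r powr alpha1 bt lam K"

lemma Phi_meas [measurable]: "Phi r \<in> borel_measurable S"
  unfolding Phi_def[abs_def] by measurable

lemma ln_lam: "ln (1 / lam) > 0" using lam by (simp add: ln_div)

lemma Phi_bounds:
  assumes "1 \<le> r" "r \<le> 1 / lam" "x \<in> space S"
  shows "1 \<le> Phi r x" "Phi r x \<le> V x"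
proof -
  have s: "0 \<le> drift_exponent r" "drift_exponent r \<le> 1" using assms lam ln_lam by (auto simp: drift_exponent_def)
  show "1 \<le> Phi r x" using V_ge_1[OF assms(3)] s by (auto simp: Phi_def ge_one_powr_ge_zero)
  have "V x powr drift_exponent r \<le> V x powr 1" using V_ge_1[OF assms(3)] s by (intro powr_mono) auto
  then show "Phi r x \<le> V x" using V_ge_1[OF assms(3)] by (auto simp: Phi_def)
qed

lemma drift_exponent_bounds: "1 \<le> r \<Longrightarrow> r \<le> 1 / lam \<Longrightarrow> 0 \<le> drift_exponent r \<and> drift_exponent r \<le> 1"
  using lam ln_lam by (auto simp: drift_exponent_def)

lemma lam_powr_drift_exponent: "r > 0 \<Longrightarrow> lam powr drift_exponent r = 1 / r"
  using lam by (simp add: powr_def drift_exponent_def ln_div exp_minus field_simps)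

lemma powr_drift_exponent: "r > 0 \<Longrightarrow> a > 0 \<Longrightarrow> a powr drift_exponent r = r powr (ln a / ln (1 / lam))"
  by (simp add: powr_def drift_exponent_def)

lemma T_one_le_1: "x \<in> space S \<Longrightarrow> T (\<lambda>_. 1) x \<le> 1"
  by (metis T_one le_iff_add)

lemma space_residual_mass: "emeasure (residual x) (space (residual x)) = T (\<lambda>_. 1) x"
  by (simp add: T_def)

lemma Phi_le_powr: "x \<in> space S \<Longrightarrow> 1 \<le> r \<Longrightarrow> r \<le> 1 / lam \<Longrightarrow> Phi r x \<le> V x powr drift_exponent r"
  using V_ge_1[of x] drift_exponent_bounds[of r] by (auto simp: Phi_def ge_one_powr_ge_zero)

lemma T_Phi_out:
  assumes r: "1 \<le> r" "r \<le> 1 / lam" and x: "x \<in> space S" "x \<notin> C"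
  shows "T (\<lambda>y. ennreal (Phi r y)) x \<le> ennreal (Phi r x / r)"
proof -
  note V0 = V_ge_1[OF x(1)]
  have "T (\<lambda>y. ennreal (Phi r y)) x \<le> T (\<lambda>y. ennreal (V y powr drift_exponent r)) x"
    using r x by (intro T_mono) (auto intro: ennreal_leI Phi_le_powr)
  also have "\<dots> \<le> ennreal (1 * (lam * V x) powr drift_exponent r)"
    unfolding T_def
  proof (rule nn_integral_powr_le)
    show "V \<in> borel_measurable (residual x)" using sets_residual[OF x(1)] by (simp cong: measurable_cong_sets)
    show "V y \<ge> 0" if "y \<in> space (residual x)" for y
      using V_ge_1[of y] that by (simp add: space_residual[OF x(1)])
    show "emeasure (residual x) (space (residual x)) \<le> ennreal 1"
      using T_one_le_1[OF x(1)] by (simp add: space_residual_mass)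
    show "(\<integral>\<^sup>+y. ennreal (V y) \<partial>residual x) \<le> ennreal (1 * (lam * V x))"
      using drift_out[OF x] T_notin[OF x(2)] by (simp add: T_def)
  qed (use V0 lam drift_exponent_bounds[OF r] in auto)
  also have "1 * (lam * V x) powr drift_exponent r = Phi r x / r"
    using V0 lam x r by (simp add: powr_mult lam_powr_drift_exponent Phi_def)
  finally show ?thesis .
qed

lemma T_Phi_in:
  assumes r: "1 \<le> r" "r \<le> 1 / lam" and x: "x \<in> C"
  shows "T (\<lambda>y. ennreal (Phi r y)) x \<le> ennreal ((1 - DD r) / r)"
proof (cases "bt = 1")
  case True
  then have "T (\<lambda>_. 1) x = 0" using T_one_in[OF x] by simp
  then have "emeasure (residual x) (space (residual x)) = 0" by (simp add: T_def)
  then show ?thesis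
    by (simp add: T_def nn_integral_zero_mass)
next
  case False
  note xS = C_subset[OF x]
  have bt: "bt < 1" using False bt_le_1 by simp
  \<comment> \<open>From a point of \<open>C\<close> the residual measure has mass
    \<open>1 - bt\<close>, and its integral of \<open>V\<close> is at most
    \<open>k1 + (1 - bt) \<le> K - bt\<close>. So \<open>a\<close> bounds the normalised mean, and
    Jensen's inequality turns it into the exponent \<open>alpha1\<close>.\<close>
  define a where "a = (K - bt) / (1 - bt)"
  have a: "a > 0" using bt K_ge_1 by (simp add: a_def)
  have "T (\<lambda>y. ennreal (Phi r y)) x \<le> T (\<lambda>y. ennreal (V y powr drift_exponent r)) x"
    using r xS by (intro T_mono) (auto intro: ennreal_leI Phi_le_powr)
  also have "\<dots> \<le> ennreal ((1 - bt) * a powr drift_exponent r)"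
    unfolding T_def
  proof (rule nn_integral_powr_le)
    show "V \<in> borel_measurable (residual x)" using sets_residual[OF xS] by (simp cong: measurable_cong_sets)
    show "V y \<ge> 0" if "y \<in> space (residual x)" for y
      using V_ge_1[of y] that by (simp add: space_residual[OF xS])
    show "emeasure (residual x) (space (residual x)) \<le> ennreal (1 - bt)"
      using T_one_in[OF x] by (simp add: space_residual_mass)
    have "T (\<lambda>y. ennreal (V y)) x = T (\<lambda>y. ennreal (V y - 1) + 1) x"
      using V_ge_1 xS
      by (intro T_cong) (auto simp: ennreal_plus[symmetric] ennreal_1[symmetric] simp del: ennreal_plus ennreal_1)
    also have "\<dots> \<le> ennreal k1 + ennreal (1 - bt)"
      using xS T_V1_in[OF x] by (simp add: T_add T_one_in[OF x] add_right_mono)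
    also have "\<dots> = ennreal (k1 + (1 - bt))" using k1_nonneg bt by simp
    also have "\<dots> \<le> ennreal ((1 - bt) * a)"
      using bt v1_k1 mult_nonneg_nonneg[of bt v1] v1_nonneg bt_pos
      by (intro ennreal_leI) (simp add: a_def, smt (verit) mult_nonneg_nonneg)
    finally show "(\<integral>\<^sup>+y. ennreal (V y) \<partial>residual x) \<le> ennreal ((1 - bt) * a)" by (simp add: T_def)
  qed (use a bt drift_exponent_bounds[OF r] in auto)
  also have "(1 - bt) * a powr drift_exponent r = (1 - DD r) / r"
    using r a by (simp add: DD_def alpha1_def a_def[symmetric] powr_drift_exponent powr_add)
  finally show ?thesis .
qed

text \<open>Jensen's inequality under \<nu> for the function equal to 1 on \<open>C\<close> and to
  \<open>V\<close> elsewhere, whose mean is at most \<open>Kt\<close>. The resulting exponent is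
  \<alpha>_2 - 1; the remaining factor \<open>r\<close> enters in \<open>pp\<close>.\<close>

lemma Kt_ge_1: "1 \<le> Kt"
  and nu_Phi: "1 \<le> r \<Longrightarrow> r \<le> 1 / lam \<Longrightarrow>
    (\<integral>\<^sup>+x. ennreal (Phi r x) \<partial>\<nu>) \<le> ennreal (r powr (ln Kt / ln (1 / lam)))"
proof -
  define W where "W x = (if x \<in> C then 1 else V x)" for x
  have [measurable]: "W \<in> borel_measurable S" unfolding W_def[abs_def] by measurable
  have W1: "W x \<ge> 1" if "x \<in> space S" for x using V_ge_1[OF that] by (simp add: W_def)
  have "(\<integral>\<^sup>+x. ennreal (W x) \<partial>\<nu>) = (\<integral>\<^sup>+x. indicator C x + ennreal (V x) * indicator (space S - C) x \<partial>\<nu>)"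
    by (intro nn_integral_cong) (auto simp: W_def indicator_def)
  also have "\<dots> \<le> ennreal Kt" using Kt by (subst nn_integral_add) auto
  finally have W: "(\<integral>\<^sup>+x. ennreal (W x) \<partial>\<nu>) \<le> ennreal Kt" .
  have "(\<integral>\<^sup>+x. 1 \<partial>\<nu>) \<le> (\<integral>\<^sup>+x. ennreal (W x) \<partial>\<nu>)"
    using W1 by (intro nn_integral_mono) (auto simp: ennreal_1[symmetric] simp del: ennreal_1 intro!: ennreal_leI)
  also note W
  finally have "emeasure \<nu> (space \<nu>) \<le> ennreal Kt" by simp
  then show Kt1: "1 \<le> Kt" unfolding nu.emeasure_space_1 by (simp add: ennreal_1[symmetric] ennreal_le_iff2 del: ennreal_1)
  assume r: "1 \<le> r" "r \<le> 1 / lam"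
  have "(\<integral>\<^sup>+x. ennreal (W x powr drift_exponent r) \<partial>\<nu>) \<le> ennreal (1 * Kt powr drift_exponent r)"
    using W Kt1 drift_exponent_bounds[OF r] nu.emeasure_space_1 W1
    by (intro nn_integral_powr_le) (auto intro: order_trans[of 0 1])
  also have "(\<lambda>x. W x powr drift_exponent r) = Phi r" by (auto simp: W_def Phi_def)
  finally show "(\<integral>\<^sup>+x. ennreal (Phi r x) \<partial>\<nu>) \<le> ennreal (r powr (ln Kt / ln (1 / lam)))"
    using r Kt1 by (simp add: powr_drift_exponent)
qed

lemma DD_le: "1 \<le> r \<Longrightarrow> DD r \<le> bt"
proof -
  assume r: "1 \<le> r"
  have "alpha1 bt lam K \<ge> 0"
  proof (cases "bt = 1")
    case True
    then show ?thesis by (simp add: alpha1_def)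
  next
    case False
    then have "(K - bt) / (1 - bt) \<ge> 1" using bt_le_1 K_ge_1 by simp
    then show ?thesis using ln_lam by (simp add: alpha1_def)
  qed
  then have "1 \<le> r powr alpha1 bt lam K" using r by (simp add: ge_one_powr_ge_zero)
  then have "(1 - bt) * 1 \<le> (1 - bt) * r powr alpha1 bt lam K"
    using bt_le_1 by (intro mult_left_mono) auto
  then show ?thesis by (simp add: DD_def)
qed

lemma DD_1: "DD 1 = bt" by (simp add: DD_def)

end

lemma ennreal_suminf_realD:
  fixes f :: "nat \<Rightarrow> ennreal"
  assumes le: "(\<Sum>n. f n) \<le> ennreal B" and B: "B \<ge> 0"
  shows "f n = ennreal (enn2real (f n))" "summable (\<lambda>n. enn2real (f n))"
    "(\<Sum>n. enn2real (f n)) \<le> B"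
    "(\<Sum>n. f n) = ennreal (\<Sum>n. enn2real (f n))"
proof -
  have fin: "(\<Sum>n. f n) < top" using le by (rule le_less_trans) simp
  have "f n \<le> (\<Sum>n. f n)" for n
    using sum_le_suminf[of f "{n}"] by simp
  then have "f n < top" for n using fin by (rule le_less_trans)
  then show eq: "f n = ennreal (enn2real (f n))" for n by simp
  show sm: "summable (\<lambda>n. enn2real (f n))"
    using fin eq by (intro summable_suminf_not_top) auto
  show "(\<Sum>n. f n) = ennreal (\<Sum>n. enn2real (f n))"
    using suminf_ennreal2[OF _ sm] eq by simp
  then show "(\<Sum>n. enn2real (f n)) \<le> B" using le B by simp
qed

context drift_kernel
begin

definition tn :: "nat \<Rightarrow> ('a \<Rightarrow> ennreal) \<Rightarrow> 'a \<Rightarrow> real" where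
  "tn n f x = enn2real ((T ^^ n) f x)"

definition cn :: "nat \<Rightarrow> ('a \<Rightarrow> ennreal) \<Rightarrow> real" where
  "cn n f = enn2real (nuT n f)"

abbreviation VV :: "'a \<Rightarrow> ennreal" where "VV \<equiv> (\<lambda>y. ennreal (V y))"

lemma T_affine_le:
  assumes x: "x \<in> space S" and abd: "a \<ge> 0" "b \<ge> 0" "d \<ge> 0" and ms: "m1 \<ge> 0" "m2 \<ge> 0" "m0 \<ge> 0"
    and T: "T (\<lambda>y. ennreal (V y - 1)) x \<le> ennreal m1"
      "T (\<lambda>y. ennreal (Phi r y)) x \<le> ennreal m2" "T (\<lambda>_. 1) x \<le> ennreal m0"
  shows "T (\<lambda>y. ennreal (a * (V y - 1) + b * Phi r y + d)) x \<le> ennreal (a * m1 + b * m2 + d * m0)"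
proof -
  have Phi0: "Phi r y \<ge> 0" for y by (simp add: Phi_def)
  have "T (\<lambda>y. ennreal (a * (V y - 1) + b * Phi r y + d)) x =
      T (\<lambda>y. ennreal a * ennreal (V y - 1) + ennreal b * ennreal (Phi r y) + ennreal d * 1) x"
    using V_ge_1 abd Phi0 x by (intro T_cong) (auto simp: ennreal_mult[symmetric])
  also have "\<dots> = ennreal a * T (\<lambda>y. ennreal (V y - 1)) x + ennreal b * T (\<lambda>y. ennreal (Phi r y)) x +
      ennreal d * T (\<lambda>_. 1) x"
  proof -
    have "T (\<lambda>y. ennreal a * ennreal (V y - 1) + ennreal b * ennreal (Phi r y) + ennreal d * 1) x =
        T (\<lambda>y. ennreal a * ennreal (V y - 1) + ennreal b * ennreal (Phi r y)) x + T (\<lambda>_. ennreal d * 1) x"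
      by (rule T_add[OF x]) measurable
    also have "T (\<lambda>y. ennreal a * ennreal (V y - 1) + ennreal b * ennreal (Phi r y)) x =
        T (\<lambda>y. ennreal a * ennreal (V y - 1)) x + T (\<lambda>y. ennreal b * ennreal (Phi r y)) x"
      by (rule T_add[OF x]) measurable
    also have "T (\<lambda>y. ennreal a * ennreal (V y - 1)) x = ennreal a * T (\<lambda>y. ennreal (V y - 1)) x"
      by (rule T_cmult[OF x]) measurable
    also have "T (\<lambda>y. ennreal b * ennreal (Phi r y)) x = ennreal b * T (\<lambda>y. ennreal (Phi r y)) x"
      by (rule T_cmult[OF x]) measurable
    also have "T (\<lambda>_. ennreal d * 1) x = ennreal d * T (\<lambda>_. 1) x"
      by (rule T_cmult[OF x]) measurable
    finally show ?thesis .
  qed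
  also have "\<dots> \<le> ennreal a * ennreal m1 + ennreal b * ennreal m2 + ennreal d * ennreal m0"
    using T by (intro add_mono mult_left_mono) auto
  also have "\<dots> = ennreal (a * m1 + b * m2 + d * m0)"
    using abd ms by (simp add: ennreal_mult[symmetric])
  finally show ?thesis .
qed

text \<open>The effect of \<open>T\<close> on \<open>V - 1\<close>, \<open>Phi r\<close> and 1 is
  bounded separately on \<open>C\<close> and off \<open>C\<close>. The supersolution condition for a
  nonnegative combination thus becomes two scalar inequalities, \<open>out\<close> and
  \<open>inn\<close>.\<close>

lemma affine_supersolution:
  assumes r: "1 \<le> r" "r \<le> 1 / lam" and D: "DD r \<le> 1" and abd: "a \<ge> 0" "b \<ge> 0" "d \<ge> 0"
    and [measurable]: "f \<in> borel_measurable S" and f: "\<And>x. x \<in> space S \<Longrightarrow> f x \<ge> 0"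
    and out: "\<And>x. x \<in> space S \<Longrightarrow> x \<notin> C \<Longrightarrow>
      f x + r * (a * (lam * V x - 1) + b * (Phi r x / r) + d) \<le> a * (V x - 1) + b * Phi r x + d"
    and inn: "\<And>x. x \<in> C \<Longrightarrow>
      f x + r * (a * k1 + b * ((1 - DD r) / r) + d * (1 - bt)) \<le> a * (V x - 1) + b * Phi r x + d"
    and x: "x \<in> space S"
  shows "ennreal (f x) + ennreal r * T (\<lambda>x. ennreal (a * (V x - 1) + b * Phi r x + d)) x
    \<le> ennreal (a * (V x - 1) + b * Phi r x + d)"
proof -
  have Phi0: "Phi r y \<ge> 0" for y by (simp add: Phi_def)
  show ?thesis
  proof (cases "x \<in> C")
    case True
    have "T (\<lambda>x. ennreal (a * (V x - 1) + b * Phi r x + d)) x \<le>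
        ennreal (a * k1 + b * ((1 - DD r) / r) + d * (1 - bt))"
      using True x abd r D bt_le_1 k1_nonneg T_V1_in T_Phi_in T_one_in by (intro T_affine_le) auto
    then have "ennreal (f x) + ennreal r * T (\<lambda>x. ennreal (a * (V x - 1) + b * Phi r x + d)) x \<le>
        ennreal (f x) + ennreal r * ennreal (a * k1 + b * ((1 - DD r) / r) + d * (1 - bt))"
      by (intro add_left_mono mult_left_mono) auto
    also have "\<dots> = ennreal (f x + r * (a * k1 + b * ((1 - DD r) / r) + d * (1 - bt)))"
    proof -
      have "0 \<le> a * k1 + b * ((1 - DD r) / r) + d * (1 - bt)"
        using r abd k1_nonneg D bt_le_1 by (intro add_nonneg_nonneg mult_nonneg_nonneg divide_nonneg_nonneg) auto
      then show ?thesis using r f[OF x] by (subst ennreal_plus) (auto simp: ennreal_mult)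
    qed
    finally show ?thesis using inn[OF True] by (auto intro: order_trans ennreal_leI)
  next
    case False
    have "T (\<lambda>x. ennreal (a * (V x - 1) + b * Phi r x + d)) x \<le>
        ennreal (a * (lam * V x - 1) + b * (Phi r x / r) + d * 1)"
      using x abd r lamV_ge_1[OF x False] T_Phi_out[OF r x False] T_one_le_1[OF x]
        N_V1_out[OF x False] T_notin[OF False, of "\<lambda>y. ennreal (V y - 1)"] Phi0[of x]
      by (intro T_affine_le) auto
    then have "ennreal (f x) + ennreal r * T (\<lambda>x. ennreal (a * (V x - 1) + b * Phi r x + d)) x \<le>
        ennreal (f x) + ennreal r * ennreal (a * (lam * V x - 1) + b * (Phi r x / r) + d)"
      by (intro add_left_mono mult_left_mono) auto
    also have "\<dots> = ennreal (f x + r * (a * (lam * V x - 1) + b * (Phi r x / r) + d))"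
    proof -
      have "0 \<le> a * (lam * V x - 1) + b * (Phi r x / r) + d"
        using r abd Phi0 lamV_ge_1[OF x False]
        by (intro add_nonneg_nonneg mult_nonneg_nonneg divide_nonneg_nonneg) auto
      then show ?thesis using r f[OF x] by (subst ennreal_plus) (auto simp: ennreal_mult)
    qed
    finally show ?thesis using out[OF x False] by (auto intro: order_trans ennreal_leI)
  qed
qed

lemma DD_le_1: "1 \<le> r \<Longrightarrow> DD r \<le> 1"
  using DD_le[of r] bt_le_1 by simp

text \<open>\<open>cc r * (V x - 1)\<close> bounds the expectation of the sum of \<open>r ^ n * V (X_n)\<close> over an excursion
  from \<open>x \<notin> C\<close> up to its return to \<open>C\<close>, and \<open>qq r\<close> the same sum for one residual step from \<open>C\<close>.\<close>

definition "cc r = r * lam / (1 - r * lam)"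
definition "qq r = r * ((1 - bt) + (1 + cc r) * k1)"

lemma cc_props:
  assumes "1 \<le> r" "r < 1 / lam"
  shows "r * lam < 1" "cc r \<ge> 0" "r * lam * (1 + cc r) = cc r" "qq r \<ge> 0"
proof -
  show rl: "r * lam < 1" using assms lam by (simp add: field_simps)
  then show c: "cc r \<ge> 0" using assms lam by (simp add: cc_def)
  show "r * lam * (1 + cc r) = cc r" using rl by (simp add: cc_def field_simps)
  show "qq r \<ge> 0" using assms c k1_nonneg bt_le_1 by (simp add: qq_def)
qed

text \<open>The coefficients are fixed points: off \<open>C\<close>,
  \<open>c = 1 + r * lam * c\<close> gives \<open>c = 1 + cc r\<close>; on \<open>C\<close>,
  \<open>b = qq r + b * (1 - DD r)\<close> gives \<open>b = qq r / DD r\<close>, the geometric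
  series over successive residual returns to \<open>C\<close>.\<close>

lemma V_potential:
  assumes r: "1 \<le> r" "r < 1 / lam" and D: "DD r > 0" and x: "x \<in> space S"
  shows "(\<Sum>k. ennreal r ^ k * (T ^^ k) VV x) \<le>
    ennreal ((1 + cc r) * (V x - 1) + qq r / DD r * Phi r x + 1)"
proof (rule supersolution_suminf[OF _ _ affine_supersolution x])
  note c = cc_props[OF r]
  show "V y \<ge> 0" if "y \<in> space S" for y using V_ge_1[OF that] by simp
  fix y assume y: "y \<in> space S" "y \<notin> C"
  have "(1 + cc r) * (V y - 1) + 1 - (V y + r * ((1 + cc r) * (lam * V y - 1) + 1))
      = (cc r - r * lam * (1 + cc r)) * V y + cc r * (r - 1)" by (simp add: algebra_simps)
  also have "\<dots> = cc r * (r - 1)" using c(3) by simp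
  also have "\<dots> \<ge> 0" using c r by simp
  finally show "V y + r * ((1 + cc r) * (lam * V y - 1) + qq r / DD r * (Phi r y / r) + 1)
    \<le> (1 + cc r) * (V y - 1) + qq r / DD r * Phi r y + 1"
    using r by (simp add: algebra_simps)
next
  note c = cc_props[OF r]
  fix y assume y: "y \<in> C"
  have V: "V y \<ge> 1" using V_ge_1 C_subset y by blast
  have "V y + r * ((1 + cc r) * k1 + qq r / DD r * ((1 - DD r) / r) + 1 * (1 - bt))
      = V y + qq r + qq r / DD r * (1 - DD r)"
  proof -
    have "V y + r * (m + E * ((1 - d) / r) + n) = V y + r * (n + m) + E * (1 - d)" for m n E d
      using r by (simp add: field_simps)
    then show ?thesis by (simp only: qq_def mult_1)
  qed
  also have "\<dots> = V y + qq r / DD r" using D by (simp add: field_simps)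
  also have "\<dots> \<le> V y + qq r / DD r + cc r * (V y - 1)" using c V by simp
  also have "\<dots> = (1 + cc r) * (V y - 1) + qq r / DD r * Phi r y + 1"
    using y by (simp add: Phi_def algebra_simps)
  finally show "V y + r * ((1 + cc r) * k1 + qq r / DD r * ((1 - DD r) / r) + 1 * (1 - bt))
      \<le> (1 + cc r) * (V y - 1) + qq r / DD r * Phi r y + 1" .
qed (use r D DD_le_1 cc_props[OF r] in auto)

text \<open>On \<open>C\<close>, \<open>bt / DD r\<close> solves
  \<open>b = bt + b * (1 - DD r)\<close>; off \<open>C\<close> there is no source and
  \<open>Phi r\<close> already satisfies \<open>r * T (Phi r) \<le> Phi r\<close>.\<close>

lemma hit_supersolution:
  assumes r: "1 \<le> r" "r \<le> 1 / lam" and D: "DD r > 0" and x: "x \<in> space S"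
  shows "ennreal (bt * indicator C x) + ennreal r * T (\<lambda>x. ennreal (0 * (V x - 1) + bt / DD r * Phi r x + 0)) x
    \<le> ennreal (0 * (V x - 1) + bt / DD r * Phi r x + 0)"
proof (rule affine_supersolution[OF _ _ _ _ _ _ _ _ _ _ x])
  fix y assume y: "y \<in> C"
  show "bt * indicator C y + r * (0 * k1 + bt / DD r * ((1 - DD r) / r) + 0 * (1 - bt))
    \<le> 0 * (V y - 1) + bt / DD r * Phi r y + 0"
    using y r D by (simp add: Phi_def field_simps)
qed (use r D DD_le_1 bt_pos in \<open>auto simp: field_simps\<close>)

text \<open>The surviving mass may be kept beside the partial sum because
  \<open>DD r \<le> bt\<close> and \<open>Phi r \<ge> 1\<close> put 1 below the supersolution. The
  summations by parts need both together.\<close>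

lemma hit_potential_partial:
  assumes r: "1 \<le> r" "r \<le> 1 / lam" and D: "DD r > 0" and x: "x \<in> space S"
  shows "(\<Sum>k<n. ennreal r ^ k * (ennreal bt * (T ^^ k) (indicator C) x)) + ennreal r ^ n * (T ^^ n) (\<lambda>_. 1) x
    \<le> ennreal (bt / DD r * Phi r x)"
proof -
  have "(\<Sum>k<n. ennreal r ^ k * (T ^^ k) (\<lambda>y. ennreal (bt * indicator C y)) x) + ennreal r ^ n * (T ^^ n) (\<lambda>_. 1) x
    \<le> ennreal (0 * (V x - 1) + bt / DD r * Phi r x + 0)"
  proof (rule supersolution[OF _ _ _ hit_supersolution[OF r D] _ x])
    fix y assume y: "y \<in> space S"
    have "DD r \<le> bt" using r by (intro DD_le) auto
    then have "1 \<le> bt / DD r" using D by simp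
    also have "\<dots> \<le> bt / DD r * Phi r y"
      using Phi_bounds[OF r y] bt_pos D mult_left_mono[of 1 "Phi r y" "bt / DD r"] by simp
    finally show "1 \<le> ennreal (0 * (V y - 1) + bt / DD r * Phi r y + 0)"
      by (simp add: ennreal_1[symmetric] ennreal_leI del: ennreal_1)
  qed auto
  moreover have "(T ^^ k) (\<lambda>y. ennreal (bt * indicator C y)) x = ennreal bt * (T ^^ k) (indicator C) x" for k
  proof -
    have "(\<lambda>y. ennreal (bt * indicator C y)) = (\<lambda>y. ennreal bt * indicator C y)"
      by (auto simp: indicator_def)
    then show ?thesis using x by (simp add: Tn_cmult)
  qed
  ultimately show ?thesis by simp
qed

lemma Tn_one_le: "x \<in> space S \<Longrightarrow> (T ^^ n) (\<lambda>_. 1) x \<le> 1"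
proof (induction n arbitrary: x)
  case (Suc n)
  have "(T ^^ Suc n) (\<lambda>_. 1) x \<le> T (\<lambda>_. 1) x" using Suc by (auto intro: T_mono)
  then show ?case using T_one_le_1[OF Suc.prems] by simp
qed simp

lemma Tn_ind_le: "x \<in> space S \<Longrightarrow> (T ^^ n) (indicator C) x \<le> 1"
  by (rule order_trans[OF Tn_mono[of "indicator C" "\<lambda>_. 1"] Tn_one_le]) (auto simp: indicator_def)

lemma tn_one: "x \<in> space S \<Longrightarrow> (T ^^ n) (\<lambda>_. 1) x = ennreal (tn n (\<lambda>_. 1) x)"
  using Tn_one_le[of x n] by (simp add: tn_def le_less_trans[of _ 1 top])

lemma tn_ind: "x \<in> space S \<Longrightarrow> (T ^^ n) (indicator C) x = ennreal (tn n (indicator C) x)"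
  using Tn_ind_le[of x n] by (simp add: tn_def le_less_trans[of _ 1 top])

lemma tn_nonneg [simp]: "tn n f x \<ge> 0" by (simp add: tn_def)
lemma cn_nonneg [simp]: "cn n f \<ge> 0" by (simp add: cn_def)

lemma tn_one_step:
  assumes x: "x \<in> space S"
  shows "tn n (\<lambda>_. 1) x = tn (Suc n) (\<lambda>_. 1) x + bt * tn n (indicator C) x"
proof -
  have "ennreal (tn n (\<lambda>_. 1) x) = ennreal (tn (Suc n) (\<lambda>_. 1) x) + ennreal bt * ennreal (tn n (indicator C) x)"
    using Tn_one_step[OF x, of n] by (simp only: tn_one[OF x] tn_ind[OF x])
  also have "\<dots> = ennreal (tn (Suc n) (\<lambda>_. 1) x + bt * tn n (indicator C) x)"
    using bt_pos by (simp add: ennreal_mult[symmetric])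
  finally show ?thesis using bt_pos by (subst (asm) ennreal_inj) auto
qed

lemma hit_real_partial:
  assumes r: "1 \<le> r" "r \<le> 1 / lam" and D: "DD r > 0" and x: "x \<in> space S"
  shows "(\<Sum>k<n. r ^ k * (bt * tn k (indicator C) x)) + r ^ n * tn n (\<lambda>_. 1) x \<le> bt / DD r * Phi r x"
proof -
  have "ennreal ((\<Sum>k<n. r ^ k * (bt * tn k (indicator C) x)) + r ^ n * tn n (\<lambda>_. 1) x) =
     (\<Sum>k<n. ennreal r ^ k * (ennreal bt * (T ^^ k) (indicator C) x)) + ennreal r ^ n * (T ^^ n) (\<lambda>_. 1) x"
    using r bt_pos
    by (simp add: tn_one[OF x] tn_ind[OF x] ennreal_mult ennreal_power sum_nonneg sum_ennreal[symmetric] del: sum_ennreal)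
  also have "\<dots> \<le> ennreal (bt / DD r * Phi r x)" by (rule hit_potential_partial) fact+
  finally show ?thesis
    using bt_pos D by (subst (asm) ennreal_le_iff) (auto simp: Phi_def)
qed

lemma hit_real:
  assumes r: "1 \<le> r" "r \<le> 1 / lam" and D: "DD r > 0" and x: "x \<in> space S"
  shows "summable (\<lambda>k. r ^ k * (bt * tn k (indicator C) x))"
    "(\<Sum>k. r ^ k * (bt * tn k (indicator C) x)) \<le> bt / DD r * Phi r x"
proof -
  have *: "(\<Sum>k<n. r ^ k * (bt * tn k (indicator C) x)) \<le> bt / DD r * Phi r x" for n
  proof -
    have "r ^ n * tn n (\<lambda>_. 1) x \<ge> 0" using r by simp
    then show ?thesis using hit_real_partial[OF assms, of n] by linarith
  qed
  show "summable (\<lambda>k. r ^ k * (bt * tn k (indicator C) x))"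
    using * bt_pos r by (intro summableI_nonneg_bounded[of _ "bt / DD r * Phi r x"]) auto
  then show "(\<Sum>k. r ^ k * (bt * tn k (indicator C) x)) \<le> bt / DD r * Phi r x"
    using * by (intro suminf_le_const)
qed

text \<open>Summation by parts of \<open>tn_one_step\<close>: \<open>r - 1\<close> times the tail
  sum, plus 1, equals the weighted hit sum plus the surviving mass, and
  \<open>hit_real_partial\<close> bounds exactly this.\<close>

lemma tail_real:
  assumes r: "1 < r" "r \<le> 1 / lam" and D: "DD r > 0" and x: "x \<in> space S"
  shows "summable (\<lambda>k. r ^ k * tn (Suc k) (\<lambda>_. 1) x)"
    "(\<Sum>k. r ^ k * tn (Suc k) (\<lambda>_. 1) x) \<le> (bt / DD r * Phi r x - 1) / (r - 1)"
proof -
  have id: "(r - 1) * (\<Sum>k<n. r ^ k * tn (Suc k) (\<lambda>_. 1) x) + 1 =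
      (\<Sum>k<n. r ^ k * (bt * tn k (indicator C) x)) + r ^ n * tn n (\<lambda>_. 1) x" for n
  proof (induction n)
    case 0
    then show ?case by (simp add: tn_def)
  next
    case (Suc n)
    have "(r - 1) * (\<Sum>k<Suc n. r ^ k * tn (Suc k) (\<lambda>_. 1) x) + 1 =
        (\<Sum>k<n. r ^ k * (bt * tn k (indicator C) x)) + r ^ n * tn n (\<lambda>_. 1) x + (r - 1) * (r ^ n * tn (Suc n) (\<lambda>_. 1) x)"
      using Suc by (simp add: algebra_simps)
    also have "\<dots> = (\<Sum>k<Suc n. r ^ k * (bt * tn k (indicator C) x)) + r ^ Suc n * tn (Suc n) (\<lambda>_. 1) x"
      using tn_one_step[OF x, of n] by (simp add: algebra_simps)
    finally show ?case .
  qed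
  have *: "(\<Sum>k<n. r ^ k * tn (Suc k) (\<lambda>_. 1) x) \<le> (bt / DD r * Phi r x - 1) / (r - 1)" for n
  proof -
    have "(r - 1) * (\<Sum>k<n. r ^ k * tn (Suc k) (\<lambda>_. 1) x) \<le> bt / DD r * Phi r x - 1"
      using hit_real_partial[of r x n] id[of n] assms by linarith
    then show ?thesis using r by (simp add: pos_le_divide_eq mult.commute)
  qed
  show "summable (\<lambda>k. r ^ k * tn (Suc k) (\<lambda>_. 1) x)"
    using * r by (intro summableI_nonneg_bounded[of _ "(bt / DD r * Phi r x - 1) / (r - 1)"]) auto
  then show "(\<Sum>k. r ^ k * tn (Suc k) (\<lambda>_. 1) x) \<le> (bt / DD r * Phi r x - 1) / (r - 1)"
    using * by (intro suminf_le_const)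
qed

text \<open>Off \<open>C\<close>, \<open>Phi r x\<close> is \<open>r powr t\<close> with
  \<open>t\<close> the logarithm of \<open>V x\<close> to base \<open>1 / lam\<close>, and
  \<open>t \<ge> 1\<close> by \<open>lamV_ge_1\<close>. The chord over \<open>[1, r]\<close> is
  compared with that over \<open>[1, 1 / lam]\<close>, where the power equals \<open>V x\<close>;
  the bound does not blow up as \<open>r\<close> tends to 1.\<close>

lemma Phi_chord:
  assumes r: "1 < r" "r \<le> 1 / lam" and x: "x \<in> space S"
  shows "(Phi r x - 1) / (r - 1) \<le> lam / (1 - lam) * V x"
proof (cases "x \<in> C")
  case True
  then show ?thesis using lam V_ge_1[OF x] by (simp add: Phi_def)
next
  case False
  define L where "L = 1 / lam"
  have L: "L > 1" using lam by (simp add: L_def)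
  have V: "V x \<ge> L" using lamV_ge_1[OF x False] lam by (simp add: L_def field_simps)
  define t where "t = ln (V x) / ln L"
  have t: "t \<ge> 1" using V L by (simp add: t_def)
  have Lt: "L powr t = V x" using V L by (simp add: t_def powr_def)
  have "r powr t = Phi r x"
    using False r V L by (simp add: Phi_def drift_exponent_def powr_def t_def L_def)
  then have "(Phi r x - 1) / (r - 1) \<le> (V x - 1) / (L - 1)"
    using powr_minus_one_chord[of r L t] r t Lt by (simp add: L_def)
  also have "\<dots> = lam / (1 - lam) * (V x - 1)" using lam by (simp add: L_def field_simps)
  also have "\<dots> \<le> lam / (1 - lam) * V x" using lam by (intro mult_left_mono) auto
  finally show ?thesis .
qed

lemma one_less_inv_lam: "1 < 1 / lam" using lam by simp

lemma D1: "DD 1 > 0" by (simp add: DD_1 bt_pos)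

lemma Phi_1 [simp]: "x \<in> space S \<Longrightarrow> Phi 1 x = 1"
  using V_ge_1[of x] by (simp add: Phi_def drift_exponent_def)

lemma V_real:
  assumes r: "1 \<le> r" "r < 1 / lam" and D: "DD r > 0" and x: "x \<in> space S"
  shows "(T ^^ n) VV x = ennreal (tn n VV x)"
    "summable (\<lambda>n. r ^ n * tn n VV x)"
    "(\<Sum>n. r ^ n * tn n VV x) \<le> (1 + cc r) * (V x - 1) + qq r / DD r * Phi r x + 1"
proof -
  have B: "(1 + cc r) * (V x - 1) + qq r / DD r * Phi r x + 1 \<ge> 0"
    using cc_props[OF r] V_ge_1[OF x] D by (auto simp: Phi_def)
  note * = ennreal_suminf_realD[OF V_potential[OF r D x] B]
  have eq: "enn2real (ennreal r ^ n * (T ^^ n) VV x) = r ^ n * tn n VV x" for n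
    using r by (simp add: enn2real_mult tn_def ennreal_power)
  show "summable (\<lambda>n. r ^ n * tn n VV x)"
    "(\<Sum>n. r ^ n * tn n VV x) \<le> (1 + cc r) * (V x - 1) + qq r / DD r * Phi r x + 1"
    using *(2,3) by (simp_all add: eq)
  have "ennreal r ^ n * (T ^^ n) VV x < top" using *(1)[of n] by (metis ennreal_less_top)
  then have "(T ^^ n) VV x < top"
    using r by (auto simp: ennreal_mult_less_top ennreal_power)
  then show "(T ^^ n) VV x = ennreal (tn n VV x)" by (simp add: tn_def)
qed

text \<open>\<open>pp r\<close> is \<open>r powr \<alpha>_2\<close>.\<close>

definition "mm r = r powr (ln Kt / ln (1 / lam))"
definition "pp r = r * mm r"

lemma nu_affine_le:
  assumes r: "1 \<le> r" "r \<le> 1 / lam" and abd: "a \<ge> 0" "b \<ge> 0" "d \<ge> 0"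
  shows "(\<integral>\<^sup>+x. ennreal (a * (V x - 1) + b * Phi r x + d) \<partial>\<nu>) \<le> ennreal (a * v1 + b * mm r + d)"
proof -
  have Phi0: "Phi r y \<ge> 0" for y by (simp add: Phi_def)
  have "(\<integral>\<^sup>+x. ennreal (a * (V x - 1) + b * Phi r x + d) \<partial>\<nu>) =
      (\<integral>\<^sup>+x. ennreal a * ennreal (V x - 1) + ennreal b * ennreal (Phi r x) + ennreal d \<partial>\<nu>)"
    using V_ge_1 abd Phi0 by (intro nn_integral_cong) (auto simp: ennreal_mult[symmetric])
  also have "\<dots> = ennreal a * ennreal v1 + ennreal b * (\<integral>\<^sup>+x. ennreal (Phi r x) \<partial>\<nu>) + ennreal d"
    using nu.emeasure_space_1 by (simp add: nn_integral_add nn_integral_cmult nu_V1)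
  also have "\<dots> \<le> ennreal a * ennreal v1 + ennreal b * ennreal (mm r) + ennreal d"
    using nu_Phi[OF r] by (intro add_mono mult_left_mono) (auto simp: mm_def)
  also have "\<dots> = ennreal (a * v1 + b * mm r + d)"
    using abd v1_nonneg by (simp add: ennreal_mult[symmetric] mm_def)
  finally show ?thesis .
qed

lemma cV_real:
  assumes r: "1 \<le> r" "r < 1 / lam" and D: "DD r > 0"
  shows "nuT n VV = ennreal (cn n VV)"
    "summable (\<lambda>n. r ^ n * cn n VV)"
    "(\<Sum>n. r ^ n * cn n VV) \<le> (1 + cc r) * v1 + qq r / DD r * mm r + 1"
proof -
  note c = cc_props[OF r]
  have B: "(1 + cc r) * v1 + qq r / DD r * mm r + 1 \<ge> 0"
    using c v1_nonneg D by (auto simp: mm_def)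
  have "(\<Sum>k. ennreal r ^ k * nuT k VV) \<le> (\<integral>\<^sup>+x. ennreal ((1 + cc r) * (V x - 1) + qq r / DD r * Phi r x + 1) \<partial>\<nu>)"
    using V_potential[OF r D] by (subst nuT_power_suminf) (auto intro!: nn_integral_mono)
  also have "\<dots> \<le> ennreal ((1 + cc r) * v1 + qq r / DD r * mm r + 1)"
    using r c D by (intro nu_affine_le) auto
  finally have le: "(\<Sum>k. ennreal r ^ k * nuT k VV) \<le> ennreal ((1 + cc r) * v1 + qq r / DD r * mm r + 1)" .
  note * = ennreal_suminf_realD[OF le B]
  have eq: "enn2real (ennreal r ^ n * nuT n VV) = r ^ n * cn n VV" for n
    using r by (simp add: enn2real_mult cn_def ennreal_power)
  show "summable (\<lambda>n. r ^ n * cn n VV)"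
    "(\<Sum>n. r ^ n * cn n VV) \<le> (1 + cc r) * v1 + qq r / DD r * mm r + 1"
    using *(2,3) by (simp_all add: eq)
  have "ennreal r ^ n * nuT n VV < top" using *(1)[of n] by (metis ennreal_less_top)
  then have "nuT n VV < top"
    using r by (auto simp: ennreal_mult_less_top ennreal_power)
  then show "nuT n VV = ennreal (cn n VV)" by (simp add: cn_def)
qed

lemma nuT_one_le: "nuT n (\<lambda>_. 1) \<le> 1"
proof -
  have "nuT n (\<lambda>_. 1) \<le> (\<integral>\<^sup>+x. 1 \<partial>\<nu>)"
    unfolding nuT_def by (intro nn_integral_mono) (simp add: Tn_one_le)
  then show ?thesis using nu.emeasure_space_1 by simp
qed

lemma cn_one: "nuT n (\<lambda>_. 1) = ennreal (cn n (\<lambda>_. 1))"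
  using nuT_one_le[of n] by (simp add: cn_def le_less_trans[of _ 1 top])

lemma cn_ind: "nuT n (indicator C) = ennreal (cn n (indicator C))"
proof -
  have "nuT n (indicator C) \<le> nuT n (\<lambda>_. 1)" by (rule nuT_mono) (auto simp: indicator_def)
  then show ?thesis using nuT_one_le[of n] by (simp add: cn_def le_less_trans[of _ 1 top] order_trans)
qed

lemma cn_one_step: "cn n (\<lambda>_. 1) = cn (Suc n) (\<lambda>_. 1) + bt * cn n (indicator C)"
proof -
  have "nuT n (\<lambda>_. 1) = nuT n (\<lambda>y. T (\<lambda>_. 1) y + ennreal bt * indicator C y)"
    unfolding nuT_def by (intro nn_integral_cong Tn_cong) (auto simp: T_one)
  also have "\<dots> = nuT (Suc n) (\<lambda>_. 1) + ennreal bt * nuT n (indicator C)"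
    by (simp add: nuT_add nuT_cmult nuT_Suc)
  finally have "ennreal (cn n (\<lambda>_. 1)) = ennreal (cn (Suc n) (\<lambda>_. 1) + bt * cn n (indicator C))"
    using bt_pos by (simp only: cn_one cn_ind) (simp add: ennreal_mult[symmetric])
  then show ?thesis using bt_pos by (subst (asm) ennreal_inj) auto
qed

lemma cn_0_one: "cn 0 (\<lambda>_. 1) = 1"
  using nu.emeasure_space_1 by (simp add: cn_def nuT_def)

lemma hit_mass_partial:
  assumes r: "1 \<le> r" "r \<le> 1 / lam" and D: "DD r > 0"
  shows "(\<Sum>k<n. r ^ k * (bt * cn k (indicator C))) + r ^ n * cn n (\<lambda>_. 1) \<le> bt / DD r * mm r"
proof -
  have "ennreal ((\<Sum>k<n. r ^ k * (bt * cn k (indicator C))) + r ^ n * cn n (\<lambda>_. 1)) =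
      (\<Sum>k<n. ennreal r ^ k * (ennreal bt * nuT k (indicator C))) + ennreal r ^ n * nuT n (\<lambda>_. 1)"
    using r bt_pos
    by (simp add: cn_one cn_ind ennreal_mult ennreal_power sum_nonneg sum_ennreal[symmetric] del: sum_ennreal)
  also have "\<dots> = (\<integral>\<^sup>+x. (\<Sum>k<n. ennreal r ^ k * (ennreal bt * (T ^^ k) (indicator C) x)) +
      ennreal r ^ n * (T ^^ n) (\<lambda>_. 1) x \<partial>\<nu>)"
    by (simp add: nuT_def nn_integral_add nn_integral_sum nn_integral_cmult)
  also have "\<dots> \<le> (\<integral>\<^sup>+x. ennreal (0 * (V x - 1) + bt / DD r * Phi r x + 0) \<partial>\<nu>)"
    using hit_potential_partial[OF r D] by (intro nn_integral_mono) simp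
  also have "\<dots> \<le> ennreal (0 * v1 + bt / DD r * mm r + 0)"
    using r D bt_pos by (intro nu_affine_le) auto
  finally show ?thesis using D bt_pos by (simp add: mm_def)
qed

lemma hit_mass:
  assumes r: "1 \<le> r" "r \<le> 1 / lam" and D: "DD r > 0"
  shows "summable (\<lambda>k. r ^ k * (bt * cn k (indicator C)))"
    "(\<Sum>k. r ^ k * (bt * cn k (indicator C))) \<le> bt / DD r * mm r"
proof -
  have *: "(\<Sum>k<n. r ^ k * (bt * cn k (indicator C))) \<le> bt / DD r * mm r" for n
  proof -
    have "r ^ n * cn n (\<lambda>_. 1) \<ge> 0" using r by simp
    then show ?thesis using hit_mass_partial[OF assms, of n] by linarith
  qed
  show "summable (\<lambda>k. r ^ k * (bt * cn k (indicator C)))"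
    using * bt_pos r by (intro summableI_nonneg_bounded[of _ "bt / DD r * mm r"]) auto
  then show "(\<Sum>k. r ^ k * (bt * cn k (indicator C))) \<le> bt / DD r * mm r"
    using * by (intro suminf_le_const)
qed

text \<open>As in \<open>tail_real\<close>, but the sum starts with the full mass at
  \<open>k = 0\<close>; this costs the factor \<open>r\<close> that turns \<open>mm\<close> into
  \<open>pp\<close>.\<close>

lemma mass_tail:
  assumes r: "1 < r" "r \<le> 1 / lam" and D: "DD r > 0"
  shows "summable (\<lambda>k. r ^ k * cn k (\<lambda>_. 1))"
    "(\<Sum>k. r ^ k * cn k (\<lambda>_. 1)) \<le> (bt / DD r * pp r - 1) / (r - 1)"
proof -
  have id: "(r - 1) * (\<Sum>k<n. r ^ k * cn k (\<lambda>_. 1)) + 1 =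
      r ^ n * cn n (\<lambda>_. 1) + r * (\<Sum>k<n. r ^ k * (bt * cn k (indicator C)))" for n
  proof (induction n)
    case 0
    then show ?case by (simp add: cn_0_one)
  next
    case (Suc n)
    have "(r - 1) * (\<Sum>k<Suc n. r ^ k * cn k (\<lambda>_. 1)) + 1 =
        r ^ n * cn n (\<lambda>_. 1) + r * (\<Sum>k<n. r ^ k * (bt * cn k (indicator C))) + (r - 1) * (r ^ n * cn n (\<lambda>_. 1))"
      using Suc by (simp add: algebra_simps)
    also have "\<dots> = r * r ^ n * cn n (\<lambda>_. 1) + r * (\<Sum>k<n. r ^ k * (bt * cn k (indicator C)))"
      by (simp add: algebra_simps)
    also have "\<dots> = r ^ Suc n * cn (Suc n) (\<lambda>_. 1) + r * (\<Sum>k<Suc n. r ^ k * (bt * cn k (indicator C)))"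
      unfolding cn_one_step[of n] by (simp add: algebra_simps)
    finally show ?case .
  qed
  have *: "(\<Sum>k<n. r ^ k * cn k (\<lambda>_. 1)) \<le> (bt / DD r * pp r - 1) / (r - 1)" for n
  proof -
    have "r ^ n * cn n (\<lambda>_. 1) \<le> r * (r ^ n * cn n (\<lambda>_. 1))"
      using r mult_right_mono[of 1 r "r ^ n * cn n (\<lambda>_. 1)"] by simp
    then have "(r - 1) * (\<Sum>k<n. r ^ k * cn k (\<lambda>_. 1)) + 1 \<le>
        r * ((\<Sum>k<n. r ^ k * (bt * cn k (indicator C))) + r ^ n * cn n (\<lambda>_. 1))"
      unfolding id by (simp add: distrib_left)
    also have "\<dots> \<le> r * (bt / DD r * mm r)"
      using r D by (intro mult_left_mono hit_mass_partial) auto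
    also have "\<dots> = bt / DD r * pp r" by (simp add: pp_def)
    finally show ?thesis using r by (simp add: pos_le_divide_eq mult.commute)
  qed
  show "summable (\<lambda>k. r ^ k * cn k (\<lambda>_. 1))"
    using * r by (intro summableI_nonneg_bounded[of _ "(bt / DD r * pp r - 1) / (r - 1)"]) auto
  then show "(\<Sum>k. r ^ k * cn k (\<lambda>_. 1)) \<le> (bt / DD r * pp r - 1) / (r - 1)"
    using * by (intro suminf_le_const)
qed

section \<open>Weighted tails of the potential of \<open>V\<close> under \<nu>\<close>

definition "dd r = cc 1 / (1 - r * lam)"

definition W1 :: "'a \<Rightarrow> ennreal" where "W1 x = (\<Sum>k. (T ^^ k) VV x)"

lemma W1_meas [measurable]: "W1 \<in> borel_measurable S"
  unfolding W1_def[abs_def] by measurable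

lemma W1_le:
  assumes x: "x \<in> space S"
  shows "W1 x \<le> ennreal ((1 + cc 1) * (V x - 1) + qq 1 / bt * 1 + 1)"
  using V_potential[OF order_refl one_less_inv_lam D1 x] x by (simp add: W1_def DD_1)

lemma W1_eq:
  assumes x: "x \<in> space S"
  shows "W1 x = VV x + T W1 x"
proof -
  have "W1 x = (\<Sum>k. (T ^^ (k + 1)) VV x) + (\<Sum>k<1. (T ^^ k) VV x)"
    unfolding W1_def by (rule suminf_offset) simp
  also have "(\<Sum>k. (T ^^ (k + 1)) VV x) = T W1 x"
    unfolding W1_def[abs_def] using x by (subst T_suminf) auto
  finally show ?thesis by (simp add: add.commute)
qed

text \<open>Off \<open>C\<close> the bound for \<open>W1\<close> is reduced by \<open>V\<close>,
  using \<open>W1 = V + T W1\<close>. On \<open>C\<close> this would leave a multiple of the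
  uncontrolled value \<open>V x\<close>; there \<open>T\<close> is applied to the bound itself, and
  the drift from \<open>C\<close> gives exactly \<open>qq 1 / bt\<close>.\<close>

lemma T_W1_le:
  assumes x: "x \<in> space S"
  shows "T W1 x \<le> ennreal (cc 1 * (V x - 1) * indicator (- C) x + qq 1 / bt)"
proof (cases "x \<in> C")
  case True
  note c = cc_props[OF order_refl one_less_inv_lam]
  have "T W1 x \<le> T (\<lambda>x. ennreal ((1 + cc 1) * (V x - 1) + 0 * Phi 1 x + (qq 1 / bt + 1))) x"
    using x W1_le by (intro T_mono) (auto simp: add.assoc)
  also have "\<dots> \<le> ennreal ((1 + cc 1) * k1 + 0 * 1 + (qq 1 / bt + 1) * (1 - bt))"
    using c k1_nonneg bt_pos bt_le_1 T_V1_in[OF True] T_one_in[OF True] T_Phi_in[of 1 x] True lam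
    by (intro T_affine_le[OF x]) (auto simp: DD_1 intro: order_trans)
  also have "(1 + cc 1) * k1 + 0 * 1 + (qq 1 / bt + 1) * (1 - bt) = qq 1 / bt"
    using bt_pos by (simp add: qq_def field_simps)
  finally show ?thesis using True by simp
next
  case False
  note c = cc_props[OF order_refl one_less_inv_lam]
  have "ennreal (V x) + T W1 x \<le> ennreal ((1 + cc 1) * (V x - 1) + qq 1 / bt * 1 + 1)"
    using W1_le[OF x] W1_eq[OF x] by simp
  also have "(1 + cc 1) * (V x - 1) + qq 1 / bt * 1 + 1 = V x + (cc 1 * (V x - 1) + qq 1 / bt)"
    by (simp add: algebra_simps)
  also have "ennreal \<dots> = ennreal (V x) + ennreal (cc 1 * (V x - 1) + qq 1 / bt)"
    using V_ge_1[OF x] c bt_pos by (intro ennreal_plus) auto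
  finally show ?thesis using False by simp
qed

text \<open>Again fixed points: \<open>d = cc 1 + r * lam * d\<close> off \<open>C\<close> gives
  \<open>dd r\<close>, and \<open>e = r * dd r * k1 + e * (1 - DD r)\<close> on \<open>C\<close>
  gives the weight of \<open>Phi r\<close>.\<close>

lemma outer_potential:
  assumes r: "1 \<le> r" "r < 1 / lam" and D: "DD r > 0"
  shows "(\<Sum>k. ennreal r ^ k * nuT k (\<lambda>x. ennreal (cc 1 * (V x - 1) * indicator (- C) x))) \<le>
    ennreal (dd r * v1 + r * dd r * k1 / DD r * mm r)"
proof -
  have [measurable]: "- C \<inter> space S \<in> sets S"
    using sets.compl_sets[OF C_sets] by (simp add: Diff_eq Int_commute)
  have mf [measurable]: "(\<lambda>x. cc 1 * (V x - 1) * indicator (- C) x) \<in> borel_measurable S"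
    by measurable
  note c = cc_props[OF r] and c1 = cc_props[OF order_refl one_less_inv_lam]
  have d: "dd r \<ge> 0" using c c1 by (simp add: dd_def)
  have d_eq: "cc 1 = dd r * (1 - r * lam)" using c by (simp add: dd_def)
  define e where "e = r * dd r * k1 / DD r"
  have e: "e \<ge> 0" using d r D k1_nonneg by (simp add: e_def)
  have eD: "r * (dd r * k1) = e * DD r" using D by (simp add: e_def)
  have "(\<Sum>k. ennreal r ^ k * (T ^^ k) (\<lambda>x. ennreal (cc 1 * (V x - 1) * indicator (- C) x)) x) \<le>
      ennreal (dd r * (V x - 1) + e * Phi r x + 0)" if x: "x \<in> space S" for x
  proof (rule supersolution_suminf[OF _ _ affine_supersolution x])
    show "cc 1 * (V y - 1) * indicator (- C) y \<ge> 0" if "y \<in> space S" for y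
      using c1 V_ge_1[OF that] by simp
    fix y assume y: "y \<in> space S" "y \<notin> C"
    have V: "V y \<ge> 1" using V_ge_1 y by blast
    have "cc 1 * (V y - 1) + r * (dd r * (lam * V y - 1)) = dd r * (V y - 1) - dd r * (r - r * lam)"
      by (simp add: d_eq algebra_simps)
    also have "\<dots> \<le> dd r * (V y - 1)" using d r lam mult_left_mono[of lam 1 r] by simp
    finally show "cc 1 * (V y - 1) * indicator (- C) y + r * (dd r * (lam * V y - 1) + e * (Phi r y / r) + 0)
        \<le> dd r * (V y - 1) + e * Phi r y + 0"
      using y r by (simp add: distrib_left)
  next
    fix y assume y: "y \<in> C"
    have V: "V y \<ge> 1" using V_ge_1 C_subset y by blast
    have "r * (dd r * k1 + e * ((1 - DD r) / r) + 0) = e * DD r + e * (1 - DD r)"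
      using r by (simp add: distrib_left eD)
    also have "\<dots> = e" by (simp add: algebra_simps)
    also have "\<dots> \<le> dd r * (V y - 1) + e" using d V by simp
    finally show "cc 1 * (V y - 1) * indicator (- C) y + r * (dd r * k1 + e * ((1 - DD r) / r) + 0 * (1 - bt))
        \<le> dd r * (V y - 1) + e * Phi r y + 0"
      using y by (simp add: Phi_def)
  qed (use r D DD_le_1 d e in auto)
  then have "(\<Sum>k. ennreal r ^ k * nuT k (\<lambda>x. ennreal (cc 1 * (V x - 1) * indicator (- C) x))) \<le>
      (\<integral>\<^sup>+x. ennreal (dd r * (V x - 1) + e * Phi r x + 0) \<partial>\<nu>)"
    by (subst nuT_power_suminf) (auto intro!: nn_integral_mono)
  also have "\<dots> \<le> ennreal (dd r * v1 + e * mm r + 0)"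
    using r d e by (intro nu_affine_le) auto
  finally show ?thesis by (simp add: e_def)
qed

text \<open>The tail from \<open>Suc j\<close> on is \<open>nuT j (T W1)\<close>. By
  \<open>T_W1_le\<close> it splits into a part carried by the complement of \<open>C\<close> and a
  multiple of the mass \<open>cn j\<close>; each is a single term of a weighted series already
  bounded by \<open>outer_potential\<close> or \<open>mass_tail\<close>.\<close>

lemma tail_V_bound:
  assumes r: "1 < r" "r < 1 / lam" and D: "DD r > 0"
  shows "r ^ Suc j * (\<Sum>m. cn (m + Suc j) VV) \<le>
    r * dd r * v1 + pp r * (r * dd r * k1) / DD r + qq 1 / bt * (r / (r - 1)) * (bt / DD r * pp r - 1)"
proof -
  have [measurable]: "- C \<inter> space S \<in> sets S"
    using sets.compl_sets[OF C_sets] by (simp add: Diff_eq Int_commute)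
  have mf [measurable]: "(\<lambda>x. cc 1 * (V x - 1) * indicator (- C) x) \<in> borel_measurable S"
    by measurable
  note c1 = cc_props[OF order_refl one_less_inv_lam]
  let ?f = "\<lambda>x. ennreal (cc 1 * (V x - 1) * indicator (- C) x)"
  define A where "A = dd r * v1 + r * dd r * k1 / DD r * mm r"
  have r1: "1 \<le> r" using r by simp
  have A0: "A \<ge> 0"
    using cc_props[OF r1 r(2)] c1 D r v1_nonneg k1_nonneg by (simp add: A_def dd_def mm_def)
  have f_le: "ennreal r ^ j * nuT j ?f \<le> ennreal A"
  proof -
    have "ennreal r ^ j * nuT j ?f \<le> (\<Sum>k. ennreal r ^ k * nuT k ?f)"
      using sum_le_suminf[of "\<lambda>k. ennreal r ^ k * nuT k ?f" "{j}"] by simp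
    also have "\<dots> \<le> ennreal A" unfolding A_def using r D by (intro outer_potential) auto
    finally show ?thesis .
  qed
  have one_le: "r ^ j * cn j (\<lambda>_. 1) \<le> (bt / DD r * pp r - 1) / (r - 1)"
  proof -
    have "r ^ j * cn j (\<lambda>_. 1) \<le> (\<Sum>k. r ^ k * cn k (\<lambda>_. 1))"
      using sum_le_suminf[OF mass_tail(1)[of r], of "{j}"] r D by simp
    also have "\<dots> \<le> (bt / DD r * pp r - 1) / (r - 1)"
      using r D by (intro mass_tail) auto
    finally show ?thesis .
  qed
  define B where "B = qq 1 / bt * ((bt / DD r * pp r - 1) / (r - 1))"
  have "0 \<le> (bt / DD r * pp r - 1) / (r - 1)"
    by (rule order_trans[OF _ one_le]) (use r in simp)
  then have B0: "B \<ge> 0" unfolding B_def using c1 bt_pos by (intro mult_nonneg_nonneg) auto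
  note cV = cV_real[OF order_refl one_less_inv_lam D1]
  have sm: "summable (\<lambda>n. cn n VV)" using cV(2) by simp
  have "ennreal (r ^ j * (\<Sum>m. cn (m + Suc j) VV)) = ennreal r ^ j * (\<Sum>m. nuT (m + Suc j) VV)"
  proof -
    have "(\<Sum>m. nuT (m + Suc j) VV) = ennreal (\<Sum>m. cn (m + Suc j) VV)"
      unfolding cV(1) using summable_ignore_initial_segment[OF sm, of "Suc j"]
      by (intro suminf_ennreal2) auto
    then show ?thesis using r by (simp add: ennreal_mult' ennreal_power)
  qed
  also have "(\<Sum>m. nuT (m + Suc j) VV) = nuT (Suc j) W1"
    unfolding W1_def[abs_def] by (subst nuT_suminf) (simp_all only: nuT_plus, measurable)
  also have "\<dots> = nuT j (T W1)" by (rule nuT_Suc)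
  also have "nuT j (T W1) \<le> nuT j (\<lambda>x. ?f x + ennreal (qq 1 / bt) * 1)"
  proof (rule nuT_mono)
    fix y assume y: "y \<in> space S"
    have "T W1 y \<le> ennreal (cc 1 * (V y - 1) * indicator (- C) y + qq 1 / bt)"
      by (rule T_W1_le) fact
    also have "\<dots> = ?f y + ennreal (qq 1 / bt)"
      using c1 V_ge_1[OF y] bt_pos by (intro ennreal_plus) auto
    finally show "T W1 y \<le> ?f y + ennreal (qq 1 / bt) * 1" by simp
  qed
  also have "\<dots> = nuT j ?f + ennreal (qq 1 / bt) * nuT j (\<lambda>_. 1)"
    using nuT_cmult[of "\<lambda>_. 1" j "ennreal (qq 1 / bt)"] by (subst nuT_add) simp_all
  finally have "ennreal (r ^ j * (\<Sum>m. cn (m + Suc j) VV)) \<le>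
      ennreal r ^ j * (nuT j ?f + ennreal (qq 1 / bt) * nuT j (\<lambda>_. 1))"
    by (simp add: mult_left_mono)
  also have "\<dots> = ennreal r ^ j * nuT j ?f + ennreal (qq 1 / bt * (r ^ j * cn j (\<lambda>_. 1)))"
  proof -
    have "ennreal r ^ j * (X + ennreal q * ennreal c) = ennreal r ^ j * X + ennreal (q * (r ^ j * c))"
      if "q \<ge> 0" "c \<ge> 0" for q c X
      using r that by (simp add: ennreal_mult ennreal_power distrib_left mult_ac)
    then show ?thesis using c1 bt_pos by (simp only: cn_one) simp
  qed
  also have "\<dots> \<le> ennreal A + ennreal B"
    unfolding B_def using f_le one_le c1 bt_pos by (intro add_mono ennreal_leI mult_left_mono) auto
  also have "\<dots> = ennreal (A + B)" using A0 B0 by simp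
  finally have "r ^ j * (\<Sum>m. cn (m + Suc j) VV) \<le> A + B"
    by (rule ennreal_le_iff[THEN iffD1, rotated]) (use A0 B0 in simp)
  then have "r * (r ^ j * (\<Sum>m. cn (m + Suc j) VV)) \<le> r * (A + B)"
    using r by (intro mult_left_mono) auto
  also have "\<dots> = r * dd r * v1 + pp r * (r * dd r * k1) / DD r + qq 1 / bt * (r / (r - 1)) * (bt / DD r * pp r - 1)"
  proof -
    have "r * (p + q * (z / y)) = r * p + q * (r / y) * z" for p q y z :: real
      by (simp add: distrib_left)
    then have "r * (A + B) = r * A + qq 1 / bt * (r / (r - 1)) * (bt / DD r * pp r - 1)"
      by (simp only: B_def)
    moreover have "r * A = r * dd r * v1 + pp r * (r * dd r * k1) / DD r"
      by (simp add: A_def pp_def algebra_simps)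
    ultimately show ?thesis by simp
  qed
  finally show ?thesis by (simp add: mult_ac)
qed

section \<open>The stationary measure\<close>

lemma tn_one_tendsto: "x \<in> space S \<Longrightarrow> (\<lambda>n. tn n (\<lambda>_. 1) x) \<longlonglongrightarrow> 0"
proof -
  assume x: "x \<in> space S"
  note V = V_real[OF order_refl one_less_inv_lam D1 x]
  show ?thesis
  proof (rule tendsto_sandwich[of "\<lambda>_. 0"])
    show "(\<lambda>n. tn n VV x) \<longlonglongrightarrow> 0" using V(2) by (simp add: summable_LIMSEQ_zero)
    have "(T ^^ n) (\<lambda>_. 1) x \<le> (T ^^ n) VV x" for n
      using V_ge_1 x by (intro Tn_mono) (auto simp: ennreal_1[symmetric] simp del: ennreal_1 intro!: ennreal_leI)
    then show "\<forall>\<^sub>F n in sequentially. tn n (\<lambda>_. 1) x \<le> tn n VV x"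
      unfolding V(1) tn_one[OF x] by simp
  qed auto
qed

lemma hit_sum: "x \<in> space S \<Longrightarrow> (\<Sum>i<n. bt * tn i (indicator C) x) = 1 - tn n (\<lambda>_. 1) x"
proof (induction n)
  case 0
  then show ?case by (simp add: tn_def)
next
  case (Suc n)
  then show ?case using tn_one_step[of x n] by simp
qed

lemma cn_one_tendsto: "(\<lambda>n. cn n (\<lambda>_. 1)) \<longlonglongrightarrow> 0"
proof -
  note V = cV_real[OF order_refl one_less_inv_lam D1]
  show ?thesis
  proof (rule tendsto_sandwich[of "\<lambda>_. 0"])
    show "(\<lambda>n. cn n VV) \<longlonglongrightarrow> 0" using V(2) by (simp add: summable_LIMSEQ_zero)
    have "nuT n (\<lambda>_. 1) \<le> nuT n VV" for n
      using V_ge_1 by (intro nuT_mono) (auto simp: ennreal_1[symmetric] simp del: ennreal_1 intro!: ennreal_leI)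
    then show "\<forall>\<^sub>F n in sequentially. cn n (\<lambda>_. 1) \<le> cn n VV"
      unfolding V(1) cn_one by simp
  qed auto
qed

lemma cn_one_summable: "summable (\<lambda>n. cn n (\<lambda>_. 1))"
proof (rule summable_comparison_test')
  note V = cV_real[OF order_refl one_less_inv_lam D1]
  show "summable (\<lambda>n. cn n VV)" using V(2) by simp
  fix n
  have "nuT n (\<lambda>_. 1) \<le> nuT n VV"
    using V_ge_1 by (intro nuT_mono) (auto simp: ennreal_1[symmetric] simp del: ennreal_1 intro!: ennreal_leI)
  then show "norm (cn n (\<lambda>_. 1)) \<le> cn n VV"
    unfolding V(1) cn_one by simp
qed

lemma hit_mass_sum: "(\<Sum>i<n. bt * cn i (indicator C)) = 1 - cn n (\<lambda>_. 1)"
proof (induction n)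
  case (Suc n)
  then show ?case using cn_one_step[of n] by simp
qed (simp add: cn_0_one)

lemma hit_mass_sums: "(\<lambda>i. bt * cn i (indicator C)) sums 1"
  unfolding sums_def using tendsto_diff[OF tendsto_const[of 1] cn_one_tendsto] by (simp add: hit_mass_sum)

text \<open>The total mass of the potential, that is, the mean time between regenerations; its
  inverse is the limit of \<open>un\<close>.\<close>

definition "mass = (\<Sum>n. cn n (\<lambda>_. 1))"

lemma mass_ge_1: "mass \<ge> 1"
  using sum_le_suminf[OF cn_one_summable, of "{0}"] by (simp add: mass_def cn_0_one)

lemma nuT_one_suminf: "(\<Sum>n. nuT n (\<lambda>_. 1)) = ennreal mass"
  unfolding cn_one mass_def by (rule suminf_ennreal2[OF _ cn_one_summable]) simp

lemma
  assumes st: "stationary S P \<pi>"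
  shows stationary_prob: "prob_space \<pi>" and sets_stationary: "sets \<pi> = sets S"
    and stationary_N: "f \<in> borel_measurable S \<Longrightarrow> (\<integral>\<^sup>+x. f x \<partial>\<pi>) = (\<integral>\<^sup>+x. N f x \<partial>\<pi>)"
proof -
  show 1: "prob_space \<pi>" and 2: "sets \<pi> = sets S"
    using st by (auto simp: stationary_def space_prob_algebra)
  assume f: "f \<in> borel_measurable S"
  have eq: "\<pi> \<bind> P = \<pi>" using st by (simp add: stationary_def)
  have "(\<integral>\<^sup>+x. f x \<partial>(\<pi> \<bind> P)) = (\<integral>\<^sup>+x. \<integral>\<^sup>+y. f y \<partial>P x \<partial>\<pi>)"
    using f by (rule nn_integral_bind) (simp add: 2 cong: measurable_cong_sets)
  then show "(\<integral>\<^sup>+x. f x \<partial>\<pi>) = (\<integral>\<^sup>+x. N f x \<partial>\<pi>)" by (simp add: eq N_def)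
qed

text \<open>Substitutes the splitting of \<open>N\<close> into the invariance of \<pi>, once for
  each step.\<close>

lemma stationary_iterate:
  assumes st: "stationary S P \<pi>" and f [measurable]: "f \<in> borel_measurable S"
  shows "(\<integral>\<^sup>+x. f x \<partial>\<pi>) = (\<integral>\<^sup>+x. (T ^^ n) f x \<partial>\<pi>) + ennreal bt * emeasure \<pi> C * (\<Sum>k<n. nuT k f)"
proof (induction n)
  case (Suc n)
  note [measurable_cong] = sets_stationary[OF st]
  note sp = sets_eq_imp_space_eq[OF sets_stationary[OF st]]
  have "(\<integral>\<^sup>+x. (T ^^ n) f x \<partial>\<pi>) = (\<integral>\<^sup>+x. N ((T ^^ n) f) x \<partial>\<pi>)"
    by (rule stationary_N[OF st]) measurable
  also have "\<dots> = (\<integral>\<^sup>+x. (T ^^ Suc n) f x + ennreal bt * nuT n f * indicator C x \<partial>\<pi>)"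
    by (intro nn_integral_cong) (simp add: N_eq_T sp nuT_def mult_ac)
  also have "\<dots> = (\<integral>\<^sup>+x. (T ^^ Suc n) f x \<partial>\<pi>) + ennreal bt * nuT n f * emeasure \<pi> C"
    by (subst nn_integral_add) (auto simp: nn_integral_cmult simp del: funpow.simps)
  finally show ?case using Suc by (simp add: algebra_simps)
qed simp

text \<open>The residual term in \<open>stationary_iterate\<close> tends to 0 by dominated
  convergence, since \<open>(T ^^ n) 1\<close> decays pointwise and is at most 1. The domination
  needs bounded functions, hence the restriction to sets; equality of measures extends the formula
  in \<open>stationary_potential\<close>.\<close>

lemma stationary_potential_emeasure:
  assumes st: "stationary S P \<pi>" and A: "A \<in> sets S"
  shows "emeasure \<pi> A = ennreal bt * emeasure \<pi> C * (\<Sum>k. nuT k (indicator A))"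
proof -
  note [measurable_cong] = sets_stationary[OF st]
  note sp = sets_eq_imp_space_eq[OF sets_stationary[OF st]]
  interpret pi: prob_space \<pi> by (rule stationary_prob[OF st])
  have [measurable]: "A \<in> sets S" by fact
  have lim1: "(\<lambda>n. \<integral>\<^sup>+x. (T ^^ n) (\<lambda>_. 1) x \<partial>\<pi>) \<longlonglongrightarrow> (\<integral>\<^sup>+x. 0 \<partial>\<pi>)"
  proof (rule nn_integral_dominated_convergence[where w = "\<lambda>_. 1"])
    show "AE x in \<pi>. (\<lambda>n. (T ^^ n) (\<lambda>_. 1) x) \<longlonglongrightarrow> 0"
      using tendsto_ennrealI[OF tn_one_tendsto] by (intro AE_I2) (simp add: tn_one sp)
    show "AE x in \<pi>. (T ^^ n) (\<lambda>_. 1) x \<le> 1" for n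
      by (intro AE_I2) (simp add: Tn_one_le sp)
  qed (auto simp: pi.emeasure_space_1)
  have lim2: "(\<lambda>n. \<integral>\<^sup>+x. (T ^^ n) (indicator A) x \<partial>\<pi>) \<longlonglongrightarrow> 0"
  proof (rule tendsto_sandwich[of "\<lambda>_. 0"])
    show "\<forall>\<^sub>F n in sequentially. (\<integral>\<^sup>+x. (T ^^ n) (indicator A) x \<partial>\<pi>) \<le> (\<integral>\<^sup>+x. (T ^^ n) (\<lambda>_. 1) x \<partial>\<pi>)"
      by (intro always_eventually allI nn_integral_mono Tn_mono) (auto simp: sp indicator_def)
  qed (use lim1 in auto)
  have "(\<lambda>n. \<Sum>k<n. nuT k (indicator A)) \<longlonglongrightarrow> (\<Sum>k. nuT k (indicator A))"
    by (intro summable_LIMSEQ) simp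
  then have "(\<lambda>n. ennreal bt * emeasure \<pi> C * (\<Sum>k<n. nuT k (indicator A))) \<longlonglongrightarrow>
      ennreal bt * emeasure \<pi> C * (\<Sum>k. nuT k (indicator A))"
    by (intro ennreal_tendsto_cmult) (auto simp: ennreal_mult_less_top pi.emeasure_eq_measure)
  with lim2 have "(\<lambda>n. (\<integral>\<^sup>+x. (T ^^ n) (indicator A) x \<partial>\<pi>) + ennreal bt * emeasure \<pi> C * (\<Sum>k<n. nuT k (indicator A)))
      \<longlonglongrightarrow> 0 + ennreal bt * emeasure \<pi> C * (\<Sum>k. nuT k (indicator A))"
    by (rule tendsto_add)
  moreover have "(\<integral>\<^sup>+x. (T ^^ n) (indicator A) x \<partial>\<pi>) + ennreal bt * emeasure \<pi> C * (\<Sum>k<n. nuT k (indicator A))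
      = emeasure \<pi> A" for n
    using stationary_iterate[OF st, of "indicator A" n] A sets_stationary[OF st] by simp
  ultimately have "(\<lambda>n. emeasure \<pi> A) \<longlonglongrightarrow> ennreal bt * emeasure \<pi> C * (\<Sum>k. nuT k (indicator A))"
    by simp
  then show ?thesis by (simp add: LIMSEQ_const_iff)
qed

text \<open>Kac's formula for regenerations: the potential representation evaluated on the whole
  space, where \<pi> has mass 1.\<close>

lemma stationary_mass:
  assumes st: "stationary S P \<pi>"
  shows "bt * measure \<pi> C = 1 / mass"
proof -
  interpret pi: prob_space \<pi> by (rule stationary_prob[OF st])
  note sp = sets_eq_imp_space_eq[OF sets_stationary[OF st]]
  have "nuT k (indicator (space S)) = nuT k (\<lambda>_. 1)" for k
    unfolding nuT_def by (intro nn_integral_cong Tn_cong) auto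
  then have "ennreal 1 = ennreal (bt * measure \<pi> C * mass)"
    using stationary_potential_emeasure[OF st sets.top] pi.emeasure_space_1 bt_pos mass_ge_1
    by (simp add: sp nuT_one_suminf pi.emeasure_eq_measure ennreal_mult[symmetric])
  then have "bt * measure \<pi> C * mass = 1"
    using bt_pos mass_ge_1 by (subst (asm) ennreal_inj) auto
  then show ?thesis using mass_ge_1 by (simp add: field_simps)
qed

lemma stationary_emeasure:
  assumes st: "stationary S P \<pi>" and A: "A \<in> sets S"
  shows "emeasure \<pi> A = ennreal (1 / mass) * (\<Sum>k. nuT k (indicator A))"
proof -
  interpret pi: prob_space \<pi> by (rule stationary_prob[OF st])
  show ?thesis
    using stationary_potential_emeasure[OF st A] stationary_mass[OF st, symmetric] bt_pos
    by (simp add: pi.emeasure_eq_measure ennreal_mult)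
qed

lemma stationary_potential:
  assumes st: "stationary S P \<pi>" and f: "f \<in> borel_measurable S"
  shows "(\<integral>\<^sup>+x. f x \<partial>\<pi>) = ennreal (1 / mass) * (\<Sum>k. nuT k f)"
proof -
  obtain M where M: "sets M = sets S" "\<And>f. f \<in> borel_measurable S \<Longrightarrow> (\<integral>\<^sup>+x. f x \<partial>M) = (\<Sum>k. nuT k f)"
    by (rule exists_potential_measure) blast
  have "\<pi> = scale_measure (ennreal (1 / mass)) M"
  proof (rule measure_eqI)
    fix A assume "A \<in> sets \<pi>"
    then have A: "A \<in> sets S" by (simp add: sets_stationary[OF st])
    have "emeasure M A = (\<Sum>k. nuT k (indicator A))"
      using M(2)[of "indicator A"] A M(1) by simp
    then show "emeasure \<pi> A = emeasure (scale_measure (ennreal (1 / mass)) M) A"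
      using stationary_emeasure[OF st A] by simp
  qed (simp add: M sets_stationary[OF st])
  then show ?thesis
    using f M by (simp add: nn_integral_scale_measure cong: measurable_cong_sets)
qed

lemma stationary_unique: "stationary S P \<pi> \<Longrightarrow> stationary S P \<pi>' \<Longrightarrow> \<pi> = \<pi>'"
  by (rule measure_eqI) (auto simp: sets_stationary stationary_emeasure)

lemma stationary_exists: "\<exists>\<pi>. stationary S P \<pi>"
proof -
  obtain M where M: "sets M = sets S" "\<And>f. f \<in> borel_measurable S \<Longrightarrow> (\<integral>\<^sup>+x. f x \<partial>M) = (\<Sum>k. nuT k f)"
    by (rule exists_potential_measure) blast
  define \<pi> where "\<pi> = scale_measure (ennreal (1 / mass)) M"
  have sets: "sets \<pi> = sets S" by (simp add: \<pi>_def M)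
  note sp = sets_eq_imp_space_eq[OF sets]
  have int: "(\<integral>\<^sup>+x. f x \<partial>\<pi>) = ennreal (1 / mass) * (\<Sum>k. nuT k f)" if "f \<in> borel_measurable S" for f
    using that M by (simp add: \<pi>_def nn_integral_scale_measure cong: measurable_cong_sets)
  have "prob_space \<pi>"
  proof (rule prob_spaceI)
    have "emeasure \<pi> (space \<pi>) = (\<integral>\<^sup>+x. 1 \<partial>\<pi>)" by simp
    also have "\<dots> = ennreal (1 / mass) * ennreal mass" by (subst int) (simp_all only: nuT_one_suminf, simp)
    also have "\<dots> = 1" using mass_ge_1 by (simp add: ennreal_mult[symmetric])
    finally show "emeasure \<pi> (space \<pi>) = 1" .
  qed
  moreover have "\<pi> \<bind> P = \<pi>"
  proof (rule measure_eqI)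
    have ne: "space \<pi> \<noteq> {}" using nu.not_empty by (simp add: sp)
    have Pm: "P \<in> \<pi> \<rightarrow>\<^sub>M subprob_algebra S" using sets by (simp cong: measurable_cong_sets)
    show sb: "sets (\<pi> \<bind> P) = sets \<pi>"
      using sets ne by (subst sets_bind[of _ _ S]) (auto simp: sets_P sp)
    fix A assume "A \<in> sets (\<pi> \<bind> P)"
    then have A [measurable]: "A \<in> sets S" by (simp add: sb sets)
    \<comment> \<open>Regeneration is certain. Applying \<open>P\<close> shifts the potential series
      by one index, and this total restores the lost term \<open>k = 0\<close>.\<close>
    have hit1: "(\<Sum>k. ennreal bt * nuT k (indicator C)) = 1"
    proof -
      have "(\<Sum>k. ennreal (bt * cn k (indicator C))) = ennreal 1"
        using hit_mass_sums bt_pos by (intro suminf_ennreal_eq) auto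
      then show ?thesis using bt_pos by (simp add: cn_ind ennreal_mult)
    qed
    have "emeasure (\<pi> \<bind> P) A = (\<integral>\<^sup>+x. N (indicator A) x \<partial>\<pi>)"
      using emeasure_bind[OF ne Pm A] by (auto simp: N_def sets_P sp intro!: nn_integral_cong)
    also have "\<dots> = (\<integral>\<^sup>+x. T (indicator A) x + nuT 0 (indicator A) * (ennreal bt * indicator C x) \<partial>\<pi>)"
      by (intro nn_integral_cong) (simp add: N_eq_T sp nuT_def mult_ac)
    also have "\<dots> = ennreal (1 / mass) * (\<Sum>k. nuT k (\<lambda>x. T (indicator A) x + nuT 0 (indicator A) * (ennreal bt * indicator C x)))"
      by (rule int) measurable
    also have "(\<Sum>k. nuT k (\<lambda>x. T (indicator A) x + nuT 0 (indicator A) * (ennreal bt * indicator C x))) =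
        (\<Sum>k. nuT (Suc k) (indicator A)) + nuT 0 (indicator A) * (\<Sum>k. ennreal bt * nuT k (indicator C))"
      by (simp add: nuT_add nuT_cmult nuT_Suc suminf_add[symmetric])
    also have "\<dots> = (\<Sum>k. nuT k (indicator A))"
      unfolding hit1 using suminf_offset[of "\<lambda>k. nuT k (indicator A)" 1] by simp
    also have "ennreal (1 / mass) * (\<Sum>k. nuT k (indicator A)) = emeasure \<pi> A"
      using int[of "indicator A"] sets by simp
    finally show "emeasure (\<pi> \<bind> P) A = emeasure \<pi> A" .
  qed
  ultimately show ?thesis using sets by (auto simp: stationary_def space_prob_algebra)
qed

text \<open>Finiteness comes from the potential series. It then permits solving the inequality
  obtained by integrating \<open>PV \<le> lam * V + (K - lam)\<close>, which holds everywhere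
  because \<open>V \<ge> 1\<close>.\<close>

lemma stationary_V:
  assumes st: "stationary S P \<pi>"
  shows "(\<integral>\<^sup>+x. ennreal (V x) \<partial>\<pi>) = ennreal (1 / mass * (\<Sum>m. cn m VV))"
    "1 / mass * (\<Sum>m. cn m VV) \<le> (K - lam) / (1 - lam)"
proof -
  note cV = cV_real[OF order_refl one_less_inv_lam D1]
  have sm: "summable (\<lambda>m. cn m VV)" using cV(2) by simp
  have "(\<Sum>k. nuT k VV) = ennreal (\<Sum>m. cn m VV)"
    unfolding cV(1) by (rule suminf_ennreal2[OF _ sm]) simp
  then show eq: "(\<integral>\<^sup>+x. ennreal (V x) \<partial>\<pi>) = ennreal (1 / mass * (\<Sum>m. cn m VV))"
    using mass_ge_1 sm by (subst stationary_potential[OF st]) (auto simp: ennreal_mult[symmetric] suminf_nonneg)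
  define m where "m = 1 / mass * (\<Sum>m. cn m VV)"
  have m0: "m \<ge> 0" using mass_ge_1 sm by (simp add: m_def suminf_nonneg)
  interpret pi: prob_space \<pi> by (rule stationary_prob[OF st])
  note [measurable_cong] = sets_stationary[OF st]
  note sp = sets_eq_imp_space_eq[OF sets_stationary[OF st]]
  have K: "K \<ge> lam" using K_ge_1 lam by simp
  have "ennreal m = (\<integral>\<^sup>+x. N VV x \<partial>\<pi>)"
    using stationary_N[OF st, of VV] eq by (simp add: m_def)
  also have "\<dots> \<le> (\<integral>\<^sup>+x. ennreal lam * ennreal (V x) + ennreal (K - lam) \<partial>\<pi>)"
  proof (rule nn_integral_mono)
    fix x assume "x \<in> space \<pi>"
    then have x: "x \<in> space S" by (simp add: sp)
    note Vx = V_ge_1[OF x]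
    have "N VV x \<le> ennreal (lam * V x + (K - lam))"
    proof (cases "x \<in> C")
      case True
      have "K \<le> lam * V x + (K - lam)" using Vx lam by simp
      then show ?thesis by (intro order_trans[OF drift_in[OF True]] ennreal_leI)
    next
      case False
      have "lam * V x \<le> lam * V x + (K - lam)" using K by simp
      then show ?thesis using drift_out[OF x False] by (meson order_trans ennreal_leI)
    qed
    also have "\<dots> = ennreal lam * ennreal (V x) + ennreal (K - lam)"
      using Vx lam K by (simp add: ennreal_mult)
    finally show "N VV x \<le> ennreal lam * ennreal (V x) + ennreal (K - lam)" .
  qed
  also have "\<dots> = ennreal (lam * m + (K - lam))"
    using pi.emeasure_space_1 eq[folded m_def] m0 lam K
    by (simp add: nn_integral_add nn_integral_cmult ennreal_mult[symmetric])
  finally have "m \<le> lam * m + (K - lam)" using m0 lam K by (subst (asm) ennreal_le_iff) auto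
  then show "1 / mass * (\<Sum>m. cn m VV) \<le> (K - lam) / (1 - lam)"
    using lam unfolding m_def[symmetric] by (simp add: pos_le_divide_eq algebra_simps)
qed

section \<open>From renewal rates to geometric ergodicity\<close>

definition pn :: "nat \<Rightarrow> 'a \<Rightarrow> real" where
  "pn n x = enn2real ((N ^^ n) (indicator C) x)"

text \<open>\<open>un\<close> is the renewal sequence of the regenerations, with increments
  \<open>b (k + 1) = bt * cn k (indicator C)\<close> and generating function of the increments \<open>bgen\<close>.\<close>

definition un :: "nat \<Rightarrow> real" where
  "un n = (case n of 0 \<Rightarrow> 1 | Suc j \<Rightarrow> bt * enn2real (\<integral>\<^sup>+y. (N ^^ j) (indicator C) y \<partial>\<nu>))"

lemma Nn_ind_le: "x \<in> space S \<Longrightarrow> (N ^^ n) (indicator C) x \<le> 1"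
proof -
  assume x: "x \<in> space S"
  interpret Pn: prob_space "kernel_pow S P n x" by (rule Nn_prob) fact
  have "(N ^^ n) (indicator C) x = emeasure (kernel_pow S P n x) C"
    using x by (simp add: nn_integral_Pn[symmetric] sets_Pn)
  also have "\<dots> \<le> 1" by (rule Pn.emeasure_le_1)
  finally show ?thesis .
qed

lemma pn_eq: "x \<in> space S \<Longrightarrow> (N ^^ n) (indicator C) x = ennreal (pn n x)"
  using Nn_ind_le[of x n] by (simp add: pn_def le_less_trans[of _ 1 top])

lemma pn_bounds: "x \<in> space S \<Longrightarrow> 0 \<le> pn n x \<and> pn n x \<le> 1"
proof -
  assume x: "x \<in> space S"
  have "ennreal (pn n x) \<le> ennreal 1" using Nn_ind_le[OF x, of n] unfolding pn_eq[OF x] by simp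
  then show ?thesis by (subst (asm) ennreal_le_iff) (auto simp: pn_def)
qed

lemma nu_pn: "(\<integral>\<^sup>+y. (N ^^ j) (indicator C) y \<partial>\<nu>) = ennreal (enn2real (\<integral>\<^sup>+y. (N ^^ j) (indicator C) y \<partial>\<nu>))"
proof -
  have "(\<integral>\<^sup>+y. (N ^^ j) (indicator C) y \<partial>\<nu>) \<le> (\<integral>\<^sup>+y. 1 \<partial>\<nu>)"
    by (intro nn_integral_mono) (simp add: Nn_ind_le)
  then show ?thesis using nu.emeasure_space_1 by (simp add: le_less_trans[of _ 1 top])
qed

lemma un_nonneg: "un n \<ge> 0"
  using bt_pos by (auto simp: un_def split: nat.split)

text \<open>First-regeneration decomposition of the probability of being in \<open>C\<close>; the
  convention \<open>un 0 = 1\<close> absorbs the term \<open>i = n\<close>.\<close>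

lemma renewal_hit:
  assumes x: "x \<in> space S"
  shows "bt * pn n x = (\<Sum>i\<le>n. bt * tn i (indicator C) x * un (n - i))"
proof -
  let ?v = "\<lambda>j. enn2real (\<integral>\<^sup>+y. (N ^^ j) (indicator C) y \<partial>\<nu>)"
  have "ennreal (pn n x) = ennreal (tn n (indicator C) x) +
      (\<Sum>i<n. ennreal bt * ennreal (tn i (indicator C) x) * ennreal (?v (n - 1 - i)))"
    using first_entrance[of "indicator C" x n] x nu_pn by (simp add: pn_eq tn_ind)
  also have "\<dots> = ennreal (tn n (indicator C) x + (\<Sum>i<n. bt * tn i (indicator C) x * ?v (n - 1 - i)))"
    using bt_pos by (simp add: ennreal_mult[symmetric] sum_nonneg)
  finally have "pn n x = tn n (indicator C) x + (\<Sum>i<n. bt * tn i (indicator C) x * ?v (n - 1 - i))"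
    using bt_pos pn_bounds[OF x, of n] by (subst (asm) ennreal_inj) (auto intro!: add_nonneg_nonneg sum_nonneg)
  then have "bt * pn n x = bt * tn n (indicator C) x + (\<Sum>i<n. bt * tn i (indicator C) x * (bt * ?v (n - 1 - i)))"
    by (simp add: distrib_left sum_distrib_left mult_ac)
  also have "(\<Sum>i<n. bt * tn i (indicator C) x * (bt * ?v (n - 1 - i))) = (\<Sum>i<n. bt * tn i (indicator C) x * un (n - i))"
  proof (intro sum.cong refl)
    fix i assume "i \<in> {..<n}"
    then have "n - i = Suc (n - 1 - i)" by simp
    then have "un (n - i) = un (Suc (n - 1 - i))" by (rule arg_cong)
    then have "un (n - i) = bt * ?v (n - 1 - i)" by (simp only: un_def nat.case)
    then show "bt * tn i (indicator C) x * (bt * ?v (n - 1 - i)) = bt * tn i (indicator C) x * un (n - i)"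
      by simp
  qed
  finally show ?thesis
    by (simp add: lessThan_Suc_atMost[symmetric] un_def)
qed

lemma renewal_un: "un (Suc n) = (\<Sum>i\<le>n. bt * cn i (indicator C) * un (n - i))"
proof -
  have "ennreal (un (Suc n)) = (\<integral>\<^sup>+y. ennreal bt * (N ^^ n) (indicator C) y \<partial>\<nu>)"
    using bt_pos nu_pn[of n] by (simp add: un_def nn_integral_cmult ennreal_mult)
  also have "\<dots> = (\<integral>\<^sup>+y. (\<Sum>i\<le>n. ennreal (un (n - i)) * (ennreal bt * (T ^^ i) (indicator C) y)) \<partial>\<nu>)"
  proof (rule nn_integral_cong)
    fix y assume "y \<in> space \<nu>"
    then have y: "y \<in> space S" by simp
    have "ennreal bt * (N ^^ n) (indicator C) y = ennreal (bt * pn n y)"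
      using bt_pos pn_bounds[OF y] by (simp add: pn_eq[OF y] ennreal_mult)
    also have "\<dots> = (\<Sum>i\<le>n. ennreal (bt * tn i (indicator C) y * un (n - i)))"
      unfolding renewal_hit[OF y] using bt_pos un_nonneg by (intro sum_ennreal[symmetric]) auto
    also have "\<dots> = (\<Sum>i\<le>n. ennreal (un (n - i)) * (ennreal bt * (T ^^ i) (indicator C) y))"
      using bt_pos un_nonneg by (simp add: tn_ind[OF y] ennreal_mult mult_ac)
    finally show "ennreal bt * (N ^^ n) (indicator C) y = \<dots>" .
  qed
  also have "\<dots> = (\<Sum>i\<le>n. ennreal (un (n - i)) * (ennreal bt * nuT i (indicator C)))"
    by (simp add: nn_integral_sum nn_integral_cmult nuT_def)
  also have "\<dots> = ennreal (\<Sum>i\<le>n. bt * cn i (indicator C) * un (n - i))"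
    using bt_pos un_nonneg by (simp add: cn_ind ennreal_mult mult_ac sum_nonneg sum_ennreal[symmetric] del: sum_ennreal)
  finally show ?thesis
    using bt_pos un_nonneg by (subst (asm) ennreal_inj) (auto intro!: sum_nonneg)
qed

text \<open>Write \<open>u\<close> as \<open>u\<close> times the first-regeneration probabilities up
  to \<open>k\<close> plus \<open>u\<close> times the tail. The first part leaves a convolution with
  \<open>un - u\<close>, summed as a Cauchy product; the second is summed by
  \<open>tail_real\<close>.\<close>

lemma hit_error:
  assumes r: "1 < r" "r < 1 / lam" and D: "DD r > 0" and x: "x \<in> space S"
    and u: "0 \<le> u" "u \<le> 1"
    and ksum: "summable (\<lambda>j. r ^ j * \<bar>un j - u\<bar>)" and kap: "(\<Sum>j. r ^ j * \<bar>un j - u\<bar>) \<le> \<kappa>"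
  shows "summable (\<lambda>k. r ^ k * \<bar>bt * pn k x - u\<bar>)"
    "(\<Sum>k. r ^ k * \<bar>bt * pn k x - u\<bar>) \<le>
      (bt / DD r * \<kappa> + (bt * lam / (1 - lam) + (bt - DD r) / (r - 1)) / DD r) * V x"
proof -
  define h where "h i = bt * tn i (indicator C) x" for i
  have h0: "h i \<ge> 0" for i using bt_pos by (simp add: h_def)
  note hr = hit_real[of r x, OF _ _ D x]
  have hs: "summable (\<lambda>k. r ^ k * h k)" and hS: "(\<Sum>k. r ^ k * h k) \<le> bt / DD r * Phi r x"
    unfolding h_def using hr r by auto
  note tl = tail_real[OF r(1) _ D x]
  define cp where "cp k = (\<Sum>i\<le>k. (r ^ i * h i) * (r ^ (k - i) * \<bar>un (k - i) - u\<bar>))" for k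
  have cps: "cp sums ((\<Sum>k. r ^ k * h k) * (\<Sum>j. r ^ j * \<bar>un j - u\<bar>))"
    unfolding cp_def[abs_def] using hs ksum h0 r by (intro Cauchy_product_sums) auto
  have le: "r ^ k * \<bar>bt * pn k x - u\<bar> \<le> cp k + u * (r ^ k * tn (Suc k) (\<lambda>_. 1) x)" for k
  proof -
    have "(\<Sum>i\<le>k. h i) = 1 - tn (Suc k) (\<lambda>_. 1) x"
      using hit_sum[OF x, of "Suc k"] by (simp add: h_def lessThan_Suc_atMost)
    then have "u * (\<Sum>i\<le>k. h i) = u - u * tn (Suc k) (\<lambda>_. 1) x"
      by (simp add: right_diff_distrib)
    then have "bt * pn k x - u = (\<Sum>i\<le>k. h i * un (k - i)) - u * (\<Sum>i\<le>k. h i) - u * tn (Suc k) (\<lambda>_. 1) x"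
      using renewal_hit[OF x, of k] by (simp add: h_def)
    also have "(\<Sum>i\<le>k. h i * un (k - i)) - u * (\<Sum>i\<le>k. h i) = (\<Sum>i\<le>k. h i * (un (k - i) - u))"
      by (simp add: sum_distrib_left sum_subtractf algebra_simps)
    finally have "\<bar>bt * pn k x - u\<bar> \<le> \<bar>\<Sum>i\<le>k. h i * (un (k - i) - u)\<bar> + u * tn (Suc k) (\<lambda>_. 1) x"
      using u tn_nonneg[of "Suc k" "\<lambda>_. 1" x] by (smt (verit) mult_nonneg_nonneg)
    also have "\<bar>\<Sum>i\<le>k. h i * (un (k - i) - u)\<bar> \<le> (\<Sum>i\<le>k. h i * \<bar>un (k - i) - u\<bar>)"
      using h0 by (intro order_trans[OF sum_abs] sum_mono) (simp add: abs_mult)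
    finally have "r ^ k * \<bar>bt * pn k x - u\<bar> \<le> r ^ k * ((\<Sum>i\<le>k. h i * \<bar>un (k - i) - u\<bar>) + u * tn (Suc k) (\<lambda>_. 1) x)"
      using r by (intro mult_left_mono) auto
    moreover have "r ^ k * (\<Sum>i\<le>k. h i * \<bar>un (k - i) - u\<bar>) = cp k"
      unfolding cp_def sum_distrib_left
      by (intro sum.cong refl) (simp add: power_add[symmetric] mult_ac)
    ultimately show ?thesis by (simp add: distrib_left mult.left_commute)
  qed
  have sm2: "summable (\<lambda>k. cp k + u * (r ^ k * tn (Suc k) (\<lambda>_. 1) x))"
    using cps tl(1) r by (intro summable_add summable_mult) (auto simp: sums_iff)
  show sm: "summable (\<lambda>k. r ^ k * \<bar>bt * pn k x - u\<bar>)"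
    by (rule summable_comparison_test'[OF sm2]) (use le r in auto)
  have Ph: "1 \<le> Phi r x" "Phi r x \<le> V x" using Phi_bounds[of r x] r x by auto
  have k0: "0 \<le> (\<Sum>j. r ^ j * \<bar>un j - u\<bar>)" using ksum r by (intro suminf_nonneg) auto
  have "(\<Sum>k. r ^ k * \<bar>bt * pn k x - u\<bar>) \<le> (\<Sum>k. cp k + u * (r ^ k * tn (Suc k) (\<lambda>_. 1) x))"
    using le by (intro suminf_le sm sm2)
  also have "\<dots> = (\<Sum>k. cp k) + u * (\<Sum>k. r ^ k * tn (Suc k) (\<lambda>_. 1) x)"
    using cps tl(1) r by (subst suminf_add[symmetric]) (auto simp: sums_iff suminf_mult summable_mult)
  also have "(\<Sum>k. cp k) = (\<Sum>k. r ^ k * h k) * (\<Sum>j. r ^ j * \<bar>un j - u\<bar>)"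
    using cps by (simp add: sums_iff)
  finally have main: "(\<Sum>k. r ^ k * \<bar>bt * pn k x - u\<bar>) \<le>
    (\<Sum>k. r ^ k * h k) * (\<Sum>j. r ^ j * \<bar>un j - u\<bar>) + u * (\<Sum>k. r ^ k * tn (Suc k) (\<lambda>_. 1) x)" .
  have "(\<Sum>k. r ^ k * h k) * (\<Sum>j. r ^ j * \<bar>un j - u\<bar>) \<le> (bt / DD r * V x) * \<kappa>"
  proof (rule mult_mono)
    show "(\<Sum>k. r ^ k * h k) \<le> bt / DD r * V x"
      using Ph bt_pos D by (intro order_trans[OF hS] mult_left_mono) auto
  qed (use kap k0 bt_pos D Ph in auto)
  moreover have "u * (\<Sum>k. r ^ k * tn (Suc k) (\<lambda>_. 1) x) \<le>
      (bt * lam / (1 - lam) + (bt - DD r) / (r - 1)) / DD r * V x"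
  proof -
    have "u * (\<Sum>k. r ^ k * tn (Suc k) (\<lambda>_. 1) x) \<le> 1 * ((bt / DD r * Phi r x - 1) / (r - 1))"
      using u tl r by (intro mult_mono) (auto intro!: suminf_nonneg)
    \<comment> \<open>Splitting off \<open>Phi r x - 1\<close> allows \<open>Phi_chord\<close> to
      absorb the division by \<open>r - 1\<close>; the remainder \<open>bt - DD r\<close> vanishes
      at \<open>r = 1\<close> as well.\<close>
    also have "1 * ((bt / DD r * Phi r x - 1) / (r - 1)) =
        bt / DD r * ((Phi r x - 1) / (r - 1)) + ((bt - DD r) / (r - 1)) / DD r"
    proof -
      have "bt / DD r * Phi r x - 1 = bt / DD r * (Phi r x - 1) + (bt - DD r) / DD r"
        using D by (simp add: field_simps)
      then show ?thesis by (simp add: add_divide_distrib)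
    qed
    also have "\<dots> \<le> bt / DD r * (lam / (1 - lam) * V x) + ((bt - DD r) / (r - 1)) / DD r * V x"
    proof (intro add_mono mult_left_mono)
      show "(Phi r x - 1) / (r - 1) \<le> lam / (1 - lam) * V x" using r x by (intro Phi_chord) auto
      have "0 \<le> ((bt - DD r) / (r - 1)) / DD r" using DD_le[of r] D r by auto
      then show "((bt - DD r) / (r - 1)) / DD r \<le> ((bt - DD r) / (r - 1)) / DD r * V x"
        using Ph mult_left_mono[of 1 "V x"] by fastforce
    qed (use bt_pos D in auto)
    also have "\<dots> = (bt * lam / (1 - lam) + (bt - DD r) / (r - 1)) / DD r * V x"
      by (simp add: add_divide_distrib distrib_left mult.commute mult.left_commute)
    finally show ?thesis .
  qed
  moreover have "(bt / DD r * \<kappa> + (bt * lam / (1 - lam) + (bt - DD r) / (r - 1)) / DD r) * V x =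
      (bt / DD r * V x) * \<kappa> + (bt * lam / (1 - lam) + (bt - DD r) / (r - 1)) / DD r * V x"
    by (simp only: distrib_right) (simp add: mult_ac)
  ultimately show "(\<Sum>k. r ^ k * \<bar>bt * pn k x - u\<bar>) \<le>
      (bt / DD r * \<kappa> + (bt * lam / (1 - lam) + (bt - DD r) / (r - 1)) / DD r) * V x"
    using main by linarith
qed

lemma
  assumes f [measurable]: "f \<in> borel_measurable S" and fV: "\<And>y. y \<in> space S \<Longrightarrow> f y \<le> VV y"
  shows tn_real: "x \<in> space S \<Longrightarrow> (T ^^ n) f x = ennreal (tn n f x)"
    and tn_le: "x \<in> space S \<Longrightarrow> tn n f x \<le> tn n VV x"
    and cn_real: "nuT n f = ennreal (cn n f)"
    and cn_le: "cn n f \<le> cn n VV"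
    and cn_summable: "summable (\<lambda>n. cn n f)"
    and Nn_real: "x \<in> space S \<Longrightarrow> (\<integral>\<^sup>+y. f y \<partial>kernel_pow S P n x) =
        ennreal (tn n f x + (\<Sum>k<n. bt * pn k x * cn (n - 1 - k) f))"
    and pi_real: "stationary S P \<pi> \<Longrightarrow> (\<integral>\<^sup>+y. f y \<partial>\<pi>) = ennreal (1 / mass * (\<Sum>k. cn k f))"
proof -
  note cV = cV_real[OF order_refl one_less_inv_lam D1]
  have t: "(T ^^ n) f x = ennreal (tn n f x) \<and> tn n f x \<le> tn n VV x" if x: "x \<in> space S" for n x
  proof -
    have "(T ^^ n) f x \<le> (T ^^ n) VV x" using fV x by (rule Tn_mono)
    then have le: "(T ^^ n) f x \<le> ennreal (tn n VV x)"
      using V_real(1)[OF order_refl one_less_inv_lam D1 x] by simp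
    then have "(T ^^ n) f x < top" by (rule le_less_trans) simp
    then have "(T ^^ n) f x = ennreal (tn n f x)" by (simp add: tn_def)
    then show ?thesis using le by simp
  qed
  have c: "nuT n f = ennreal (cn n f) \<and> cn n f \<le> cn n VV" for n
  proof -
    have "nuT n f \<le> nuT n VV" using fV by (rule nuT_mono)
    then have le: "nuT n f \<le> ennreal (cn n VV)" using cV(1) by simp
    then have "nuT n f < top" by (rule le_less_trans) simp
    then have "nuT n f = ennreal (cn n f)" by (simp add: cn_def)
    then show ?thesis using le by simp
  qed
  show "x \<in> space S \<Longrightarrow> (T ^^ n) f x = ennreal (tn n f x)" "x \<in> space S \<Longrightarrow> tn n f x \<le> tn n VV x"
    "nuT n f = ennreal (cn n f)" "cn n f \<le> cn n VV" using t c by auto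
  show sm: "summable (\<lambda>n. cn n f)"
  proof (rule summable_comparison_test')
    show "summable (\<lambda>n. cn n VV)" using cV(2) by simp
    show "norm (cn n f) \<le> cn n VV" for n using c by simp
  qed
  show "(\<integral>\<^sup>+y. f y \<partial>kernel_pow S P n x) = ennreal (tn n f x + (\<Sum>k<n. bt * pn k x * cn (n - 1 - k) f))"
    if x: "x \<in> space S"
  proof -
    have "(N ^^ n) f x = ennreal (tn n f x) +
        (\<Sum>k<n. ennreal bt * ennreal (pn k x) * ennreal (cn (n - 1 - k) f))"
      using last_exit[OF f x, of n] t[OF x] c by (simp add: pn_eq[OF x])
    also have "\<dots> = ennreal (tn n f x + (\<Sum>k<n. bt * pn k x * cn (n - 1 - k) f))"
      using bt_pos pn_bounds[OF x] by (simp add: ennreal_mult[symmetric] sum_nonneg)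
    finally show ?thesis using x by (simp add: nn_integral_Pn)
  qed
  show "(\<integral>\<^sup>+y. f y \<partial>\<pi>) = ennreal (1 / mass * (\<Sum>k. cn k f))" if st: "stationary S P \<pi>"
  proof -
    have "(\<Sum>k. nuT k f) = ennreal (\<Sum>k. cn k f)"
      using c sm by (simp add: suminf_ennreal2)
    then show ?thesis
      using mass_ge_1 sm by (subst stationary_potential[OF st f]) (auto simp: ennreal_mult[symmetric] suminf_nonneg)
  qed
qed

lemma integrable_dominated:
  assumes sets: "sets M = sets S" and g: "g \<in> borel_measurable S"
    and gV: "\<And>y. y \<in> space S \<Longrightarrow> \<bar>g y\<bar> \<le> c * V y" and fin: "(\<integral>\<^sup>+y. ennreal (V y) \<partial>M) < \<infinity>"
  shows "integrable M g"
proof -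
  note [measurable_cong] = sets
  have [measurable]: "g \<in> borel_measurable S" by fact
  have "integrable M V"
  proof (rule integrableI_bounded)
    have "(\<integral>\<^sup>+y. ennreal (norm (V y)) \<partial>M) = (\<integral>\<^sup>+y. ennreal (V y) \<partial>M)"
    proof (rule nn_integral_cong)
      fix y assume "y \<in> space M"
      then have "V y \<ge> 1" using V_ge_1 sets_eq_imp_space_eq[OF sets] by auto
      then show "ennreal (norm (V y)) = ennreal (V y)" by simp
    qed
    then show "(\<integral>\<^sup>+y. ennreal (norm (V y)) \<partial>M) < \<infinity>" using fin by simp
  qed measurable
  then have "integrable M (\<lambda>y. c * V y)" by simp
  then show ?thesis
    by (rule Bochner_Integration.integrable_bound)
       (use gV sets_eq_imp_space_eq[OF sets] in \<open>auto intro!: AE_I2 intro: order_trans[OF _ abs_ge_self]\<close>)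
qed

text \<open>Bounds \<open>r\<close> times the weighted series of \<open>cn m VV\<close>. The extra
  \<open>r\<close> arises because the times \<open>k\<close> and \<open>n - 1 - k\<close> in the
  last exit decomposition add up to \<open>n - 1\<close>.\<close>

definition "B3 r = r * ((1 + cc r) * v1 + qq r / DD r * mm r + 1)"

text \<open>Its three groups bound the three terms of \<open>signed_expansion\<close>. It still
  contains \<open>v1\<close> and \<open>k1\<close>, which \<open>MM_le_MN\<close> and
  \<open>MM_le_MA\<close> remove.\<close>

definition "MM r \<kappa> = cc r + qq r / DD r +
  (bt / DD r * \<kappa> + (bt * lam / (1 - lam) + (bt - DD r) / (r - 1)) / DD r) * B3 r +
  (r * dd r * v1 + pp r * (r * dd r * k1) / DD r + qq 1 / bt * (r / (r - 1)) * (bt / DD r * pp r - 1))"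

lemma kernel_pow_V_finite: "x \<in> space S \<Longrightarrow> (\<integral>\<^sup>+y. ennreal (V y) \<partial>kernel_pow S P n x) < \<infinity>"
  by (simp add: Nn_real)

lemma stationary_V_finite: "stationary S P \<pi> \<Longrightarrow> (\<integral>\<^sup>+y. ennreal (V y) \<partial>\<pi>) < \<infinity>"
  by (simp add: stationary_V)

text \<open>Subtracting the expansion of \<open>\<integral>g d\<pi>\<close> from the last exit decomposition at \<open>C\<close> leaves the
  error \<open>bt * pn k x - 1 / mass\<close> of the renewal theorem.\<close>
lemma signed_expansion:
  assumes st: "stationary S P \<pi>" and x: "x \<in> space S"
    and g [measurable]: "g \<in> borel_measurable S" and gV: "\<And>y. y \<in> space S \<Longrightarrow> \<bar>g y\<bar> \<le> V y"
  obtains a c where "\<And>n. \<bar>a n\<bar> \<le> tn n VV x" "\<And>m. \<bar>c m\<bar> \<le> cn m VV"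
    "\<And>n. kernel_op (kernel_pow S P n) g x - (\<integral>y. g y \<partial>\<pi>) =
      a n + (\<Sum>k<n. (bt * pn k x - 1 / mass) * c (n - 1 - k)) - 1 / mass * (\<Sum>m. c (m + n))"
proof -
  define gp where "gp y = ennreal (g y)" for y
  define gm where "gm y = ennreal (- g y)" for y
  have [measurable]: "gp \<in> borel_measurable S" "gm \<in> borel_measurable S"
    unfolding gp_def[abs_def] gm_def[abs_def] by measurable
  have gpV: "gp y \<le> VV y" and gmV: "gm y \<le> VV y" if "y \<in> space S" for y
    using gV[OF that] by (auto simp: gp_def gm_def intro!: ennreal_leI)
  note p = tn_le[of gp, OF _ gpV] cn_le[of gp, OF _ gpV] cn_summable[of gp, OF _ gpV]
    Nn_real[of gp, OF _ gpV] pi_real[of gp, OF _ gpV]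
  note m = tn_le[of gm, OF _ gmV] cn_le[of gm, OF _ gmV] cn_summable[of gm, OF _ gmV]
    Nn_real[of gm, OF _ gmV] pi_real[of gm, OF _ gmV]
  define a where "a n = tn n gp x - tn n gm x" for n
  define c where "c n = cn n gp - cn n gm" for n
  show thesis
  proof (rule that[of a c])
    show "\<bar>a n\<bar> \<le> tn n VV x" for n
      using p(1)[of x n] m(1)[of x n] x tn_nonneg[of n gp x] tn_nonneg[of n gm x]
      unfolding a_def by (auto simp: abs_le_iff simp del: tn_nonneg)
    show "\<bar>c n\<bar> \<le> cn n VV" for n
      using p(2)[of n] m(2)[of n] cn_nonneg[of n gp] cn_nonneg[of n gm]
      unfolding c_def by (auto simp: abs_le_iff simp del: cn_nonneg)
    fix n
    have sc: "summable c" unfolding c_def[abs_def] using p(3) m(3) by (intro summable_diff) auto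
    have ip: "integrable (kernel_pow S P n x) g"
      by (rule integrable_dominated[where c = 1]) (use x gV sets_Pn kernel_pow_V_finite in auto)
    have ipi: "integrable \<pi> g"
      by (rule integrable_dominated[where c = 1]) (use gV sets_stationary[OF st] stationary_V_finite[OF st] in auto)
    have "kernel_op (kernel_pow S P n) g x =
        (tn n gp x + (\<Sum>k<n. bt * pn k x * cn (n - 1 - k) gp)) -
        (tn n gm x + (\<Sum>k<n. bt * pn k x * cn (n - 1 - k) gm))"
    proof -
      have nn: "0 \<le> tn n f x + (\<Sum>k<n. bt * pn k x * cn (n - 1 - k) f)" for f
        using bt_pos pn_bounds[OF x] by (auto intro!: add_nonneg_nonneg sum_nonneg)
      show ?thesis
        unfolding kernel_op_def real_lebesgue_integral_def[OF ip] gp_def[symmetric] gm_def[symmetric]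
        using p(4)[of x n] m(4)[of x n] x nn[of gp] nn[of gm] by simp
    qed
    also have "\<dots> = a n + (\<Sum>k<n. bt * pn k x * c (n - 1 - k))"
      by (simp add: a_def c_def right_diff_distrib sum_subtractf)
    finally have 1: "kernel_op (kernel_pow S P n) g x = a n + (\<Sum>k<n. bt * pn k x * c (n - 1 - k))" .
    have "(\<integral>y. g y \<partial>\<pi>) = 1 / mass * (\<Sum>k. cn k gp) - 1 / mass * (\<Sum>k. cn k gm)"
    proof -
      have nn: "0 \<le> 1 / mass * (\<Sum>k. cn k f)" if "summable (\<lambda>k. cn k f)" for f
        using mass_ge_1 suminf_nonneg[OF that] by simp
      show ?thesis
        unfolding real_lebesgue_integral_def[OF ipi] gp_def[symmetric] gm_def[symmetric]
        using p(5)[OF _ _ st] m(5)[OF _ _ st] nn[OF p(3)] nn[OF m(3)] by simp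
    qed
    also have "\<dots> = 1 / mass * (\<Sum>k. c k)"
      unfolding c_def[abs_def] using p(3) m(3)
      by (subst suminf_diff[symmetric]) (auto simp: right_diff_distrib diff_divide_distrib)
    also have "(\<Sum>k. c k) = (\<Sum>m. c (m + n)) + (\<Sum>k<n. c (n - 1 - k))"
      using suminf_split_initial_segment[OF sc, of n] sum.nat_diff_reindex[of c n] by simp
    finally show "kernel_op (kernel_pow S P n) g x - (\<integral>y. g y \<partial>\<pi>) =
        a n + (\<Sum>k<n. (bt * pn k x - 1 / mass) * c (n - 1 - k)) - 1 / mass * (\<Sum>m. c (m + n))"
      unfolding 1 by (simp add: left_diff_distrib sum_subtractf sum_distrib_left distrib_left)
  qed
qed

lemma geometric_bound:
  assumes r: "1 < r" "r < 1 / lam" and D: "DD r > 0" and st: "stationary S P \<pi>" and x: "x \<in> space S"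
    and ksum: "summable (\<lambda>j. r ^ j * \<bar>un j - 1 / mass\<bar>)" and kap: "(\<Sum>j. r ^ j * \<bar>un j - 1 / mass\<bar>) \<le> \<kappa>"
    and g [measurable]: "g \<in> borel_measurable S" and gV: "\<And>y. y \<in> space S \<Longrightarrow> \<bar>g y\<bar> \<le> V y"
  shows "r ^ Suc j * \<bar>kernel_op (kernel_pow S P (Suc j)) g x - (\<integral>y. g y \<partial>\<pi>)\<bar> \<le> MM r \<kappa> * V x"
proof -
  define n where "n = Suc j"
  obtain a c where a: "\<And>n. \<bar>a n\<bar> \<le> tn n VV x" and c: "\<And>m. \<bar>c m\<bar> \<le> cn m VV"
    and exp: "\<And>n. kernel_op (kernel_pow S P n) g x - (\<integral>y. g y \<partial>\<pi>) =
      a n + (\<Sum>k<n. (bt * pn k x - 1 / mass) * c (n - 1 - k)) - 1 / mass * (\<Sum>m. c (m + n))"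
    by (rule signed_expansion[OF st x g], erule gV, rule that)
  define e where "e k = bt * pn k x - 1 / mass" for k
  have r1: "1 \<le> r" "r \<le> 1 / lam" using r by auto
  note Vr = V_real[OF r1(1) r(2) D x] and cV = cV_real[OF r1(1) r(2) D]
  have u: "0 \<le> 1 / mass" "1 / mass \<le> 1" using mass_ge_1 by auto
  note Vx = V_ge_1[OF x]
  have es: "summable (\<lambda>k. r ^ k * \<bar>e k\<bar>)"
    and eS: "(\<Sum>k. r ^ k * \<bar>e k\<bar>) \<le>
      (bt / DD r * \<kappa> + (bt * lam / (1 - lam) + (bt - DD r) / (r - 1)) / DD r) * V x"
    unfolding e_def using hit_error[OF r D x u ksum kap] by auto
  have sV1: "summable (\<lambda>n. cn n VV)" using cV_real(2)[OF order_refl one_less_inv_lam D1] by simp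
  have t1: "r ^ n * \<bar>a n\<bar> \<le> (cc r + qq r / DD r) * V x"
  proof -
    \<comment> \<open>Here \<open>n \<ge> 1\<close>, so the summand \<open>V x\<close> at index 0 is
      distinct from the one at \<open>n\<close> and lowers the leading factor
      \<open>1 + cc r\<close> of the bound to \<open>cc r\<close>.\<close>
    have "V x + r ^ n * tn n VV x = (\<Sum>k\<in>{0, n}. r ^ k * tn k VV x)"
      using Vx by (simp add: n_def tn_def)
    also have "\<dots> \<le> (\<Sum>k. r ^ k * tn k VV x)"
      using r by (intro sum_le_suminf Vr(2)) auto
    also note Vr(3)
    finally have "r ^ n * tn n VV x \<le> cc r * (V x - 1) + qq r / DD r * Phi r x"
      by (simp add: algebra_simps)
    also have "\<dots> \<le> cc r * V x + qq r / DD r * V x"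
      using cc_props[OF r1(1) r(2)] Phi_bounds[OF r1 x] D Vx by (intro add_mono mult_left_mono) auto
    finally have "r ^ n * tn n VV x \<le> (cc r + qq r / DD r) * V x" by (simp add: algebra_simps)
    moreover have "r ^ n * \<bar>a n\<bar> \<le> r ^ n * tn n VV x"
      using a r by (intro mult_left_mono) auto
    ultimately show ?thesis by simp
  qed
  have t2: "r ^ n * \<bar>\<Sum>k<n. e k * c (n - 1 - k)\<bar> \<le>
      (bt / DD r * \<kappa> + (bt * lam / (1 - lam) + (bt - DD r) / (r - 1)) / DD r) * B3 r * V x"
  proof -
    have "r ^ n * \<bar>\<Sum>k<n. e k * c (n - 1 - k)\<bar> \<le> r ^ n * (\<Sum>k<n. \<bar>e k\<bar> * cn (n - 1 - k) VV)"
      using r c by (intro mult_left_mono order_trans[OF sum_abs] sum_mono) (auto simp: abs_mult intro!: mult_left_mono)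
    also have "\<dots> = r * (\<Sum>k\<le>j. (r ^ k * \<bar>e k\<bar>) * (r ^ (j - k) * cn (j - k) VV))"
      unfolding n_def lessThan_Suc_atMost sum_distrib_left
      by (intro sum.cong refl) (simp add: power_add[symmetric] mult_ac)
    also have "(\<Sum>k\<le>j. (r ^ k * \<bar>e k\<bar>) * (r ^ (j - k) * cn (j - k) VV)) \<le>
        (\<Sum>k. r ^ k * \<bar>e k\<bar>) * (\<Sum>m. r ^ m * cn m VV)"
    proof -
      define cp where "cp j = (\<Sum>k\<le>j. (r ^ k * \<bar>e k\<bar>) * (r ^ (j - k) * cn (j - k) VV))" for j
      have cp: "cp sums ((\<Sum>k. r ^ k * \<bar>e k\<bar>) * (\<Sum>m. r ^ m * cn m VV))"
        unfolding cp_def[abs_def] using es cV(2) r by (intro Cauchy_product_sums) auto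
      have cp0: "cp i \<ge> 0" for i using r by (auto simp: cp_def intro!: sum_nonneg)
      have "sum cp {j} \<le> (\<Sum>j. cp j)"
        using cp cp0 by (intro sum_le_suminf) (auto simp: sums_iff)
      then have "cp j \<le> (\<Sum>k. r ^ k * \<bar>e k\<bar>) * (\<Sum>m. r ^ m * cn m VV)"
        using cp by (simp add: sums_iff)
      then show ?thesis by (simp only: cp_def)
    qed
    also have "\<dots> \<le> (bt / DD r * \<kappa> + (bt * lam / (1 - lam) + (bt - DD r) / (r - 1)) / DD r) * V x *
        ((1 + cc r) * v1 + qq r / DD r * mm r + 1)"
    proof (rule mult_mono[OF eS cV(3)])
      show "0 \<le> (bt / DD r * \<kappa> + (bt * lam / (1 - lam) + (bt - DD r) / (r - 1)) / DD r) * V x"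
        by (rule order_trans[OF suminf_nonneg[OF es] eS]) (use r in simp)
      show "0 \<le> (\<Sum>m. r ^ m * cn m VV)" using r by (intro suminf_nonneg cV(2)) simp
    qed
    finally show ?thesis using r by (simp add: B3_def mult_ac)
  qed
  have t3: "r ^ n * \<bar>1 / mass * (\<Sum>m. c (m + n))\<bar> \<le>
      (r * dd r * v1 + pp r * (r * dd r * k1) / DD r + qq 1 / bt * (r / (r - 1)) * (bt / DD r * pp r - 1)) * V x"
  proof -
    have sV: "summable (\<lambda>m. cn (m + n) VV)" using sV1 by (rule summable_ignore_initial_segment)
    have sc: "summable (\<lambda>m. \<bar>c (m + n)\<bar>)"
      by (rule summable_comparison_test'[OF sV]) (use c in auto)
    have "\<bar>\<Sum>m. c (m + n)\<bar> \<le> (\<Sum>m. \<bar>c (m + n)\<bar>)" by (rule summable_rabs[OF sc])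
    also have "\<dots> \<le> (\<Sum>m. cn (m + n) VV)" using c by (intro suminf_le sc sV) auto
    finally have le: "\<bar>\<Sum>m. c (m + n)\<bar> \<le> (\<Sum>m. cn (m + n) VV)" .
    have "\<bar>1 / mass * (\<Sum>m. c (m + n))\<bar> = 1 / mass * \<bar>\<Sum>m. c (m + n)\<bar>"
      using u(1) by (simp only: abs_mult abs_of_nonneg)
    also have "\<dots> \<le> 1 * (\<Sum>m. cn (m + n) VV)"
      using le u by (intro mult_mono) auto
    finally have "r ^ n * \<bar>1 / mass * (\<Sum>m. c (m + n))\<bar> \<le> r ^ n * (\<Sum>m. cn (m + n) VV)"
      using r by (intro mult_left_mono) auto
    also have tb: "\<dots> \<le> r * dd r * v1 + pp r * (r * dd r * k1) / DD r + qq 1 / bt * (r / (r - 1)) * (bt / DD r * pp r - 1)"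
      unfolding n_def by (rule tail_V_bound[OF r D])
    also have "\<dots> \<le> \<dots> * V x"
    proof -
      have "0 \<le> r ^ n * (\<Sum>m. cn (m + n) VV)" using r sV by (auto intro!: mult_nonneg_nonneg suminf_nonneg)
      then have "0 \<le> r * dd r * v1 + pp r * (r * dd r * k1) / DD r + qq 1 / bt * (r / (r - 1)) * (bt / DD r * pp r - 1)"
        using tb by linarith
      from mult_left_mono[OF Vx this] show ?thesis by simp
    qed
    finally show ?thesis .
  qed
  have "\<bar>kernel_op (kernel_pow S P n) g x - (\<integral>y. g y \<partial>\<pi>)\<bar> \<le>
      \<bar>a n\<bar> + \<bar>\<Sum>k<n. e k * c (n - 1 - k)\<bar> + \<bar>1 / mass * (\<Sum>m. c (m + n))\<bar>"
    unfolding exp[of n] e_def by linarith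
  then have "r ^ n * \<bar>kernel_op (kernel_pow S P n) g x - (\<integral>y. g y \<partial>\<pi>)\<bar> \<le>
      r ^ n * (\<bar>a n\<bar> + \<bar>\<Sum>k<n. e k * c (n - 1 - k)\<bar> + \<bar>1 / mass * (\<Sum>m. c (m + n))\<bar>)"
    using r by (intro mult_left_mono) auto
  also have "\<dots> \<le> MM r \<kappa> * V x"
    using t1 t2 t3 unfolding MM_def by (simp only: distrib_left distrib_right)
  finally show ?thesis by (simp only: n_def)
qed

lemma initial_bound:
  assumes st: "stationary S P \<pi>" and x: "x \<in> space S"
    and g [measurable]: "g \<in> borel_measurable S" and gV: "\<And>y. y \<in> space S \<Longrightarrow> \<bar>g y\<bar> \<le> V y"
  shows "\<bar>kernel_op (kernel_pow S P 0) g x - (\<integral>y. g y \<partial>\<pi>)\<bar> \<le> (1 + (K - lam) / (1 - lam)) * V x"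
proof -
  obtain a c where a: "\<And>n. \<bar>a n\<bar> \<le> tn n VV x" and c: "\<And>m. \<bar>c m\<bar> \<le> cn m VV"
    and exp: "\<And>n. kernel_op (kernel_pow S P n) g x - (\<integral>y. g y \<partial>\<pi>) =
      a n + (\<Sum>k<n. (bt * pn k x - 1 / mass) * c (n - 1 - k)) - 1 / mass * (\<Sum>m. c (m + n))"
    by (rule signed_expansion[OF st x g], erule gV, rule that)
  note Vx = V_ge_1[OF x]
  have u: "0 \<le> 1 / mass" using mass_ge_1 by auto
  have sV: "summable (\<lambda>n. cn n VV)" using cV_real(2)[OF order_refl one_less_inv_lam D1] by simp
  have sc: "summable (\<lambda>m. \<bar>c m\<bar>)" by (rule summable_comparison_test'[OF sV]) (use c in auto)
  have "\<bar>\<Sum>m. c m\<bar> \<le> (\<Sum>m. cn m VV)"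
    using c by (intro order_trans[OF summable_rabs[OF sc]] suminf_le sc sV) auto
  then have "1 / mass * \<bar>\<Sum>m. c m\<bar> \<le> 1 / mass * (\<Sum>m. cn m VV)" using u by (intro mult_left_mono)
  also have "\<dots> \<le> (K - lam) / (1 - lam)" by (rule stationary_V(2)[OF st])
  finally have 1: "\<bar>1 / mass * (\<Sum>m. c m)\<bar> \<le> (K - lam) / (1 - lam)"
    using u by (simp only: abs_mult abs_of_nonneg)
  have Kl: "0 \<le> (K - lam) / (1 - lam)" using K_ge_1 lam by simp
  have "\<bar>a 0\<bar> \<le> V x" using a[of 0] Vx by (simp add: tn_def)
  then have "\<bar>kernel_op (kernel_pow S P 0) g x - (\<integral>y. g y \<partial>\<pi>)\<bar> \<le> V x + (K - lam) / (1 - lam)"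
    using 1 unfolding exp[of 0] by (simp only: lessThan_0 sum.empty add_0_right)
  also have "\<dots> \<le> (1 + (K - lam) / (1 - lam)) * V x"
    using mult_left_mono[OF Vx Kl] by (simp add: algebra_simps)
  finally show ?thesis .
qed

end

section \<open>Renewal rates for reversible chains\<close>

lemma Cauchy_Schwarz_integral:
  fixes f g :: "'a \<Rightarrow> real"
  assumes ff: "integrable M (\<lambda>x. f x * f x)" and gg: "integrable M (\<lambda>x. g x * g x)"
    and fg: "integrable M (\<lambda>x. f x * g x)"
  shows "(\<integral>x. f x * g x \<partial>M)\<^sup>2 \<le> (\<integral>x. f x * f x \<partial>M) * (\<integral>x. g x * g x \<partial>M)"
proof -
  define a b c where "a = (\<integral>x. f x * f x \<partial>M)" and "b = (\<integral>x. f x * g x \<partial>M)" and "c = (\<integral>x. g x * g x \<partial>M)"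
  have c0: "c \<ge> 0" unfolding c_def by (rule integral_nonneg_AE) simp
  have quad: "0 \<le> a - 2 * t * b + t\<^sup>2 * c" for t
  proof -
    have "0 \<le> (\<integral>x. (f x - t * g x)\<^sup>2 \<partial>M)" by (rule integral_nonneg_AE) simp
    also have "\<dots> = (\<integral>x. f x * f x - 2 * t * (f x * g x) + t\<^sup>2 * (g x * g x) \<partial>M)"
      by (intro Bochner_Integration.integral_cong refl) (simp add: power2_eq_square algebra_simps)
    also have "\<dots> = a - 2 * t * b + t\<^sup>2 * c"
      using ff gg fg by (simp add: a_def b_def c_def)
    finally show ?thesis .
  qed
  have "b\<^sup>2 \<le> a * c"
  proof (cases "c = 0")
    case True
    have "b = 0"
    proof (rule ccontr)
      assume "b \<noteq> 0"
      \<comment> \<open>For \<open>c = 0\<close> the quadratic is affine in \<open>t\<close>, and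
        this \<open>t\<close> gives it the value -1.\<close>
      then show False using quad[of "(a + 1) / (2 * b)"] True by (simp add: field_simps)
    qed
    then show ?thesis using True by simp
  next
    case False
    then have "c > 0" using c0 by simp
    then show ?thesis using quad[of "b / c"] by (simp add: field_simps power2_eq_square)
  qed
  then show ?thesis by (simp add: a_def b_def c_def)
qed

lemma summable_powser_conv_radius:
  fixes c :: "nat \<Rightarrow> real"
  assumes R: "R > 1" and sm: "\<And>r. 1 < r \<Longrightarrow> r < R \<Longrightarrow> summable (\<lambda>n. r ^ n * c n)"
  shows "fps_conv_radius (Abs_fps (\<lambda>n. complex_of_real (c n))) \<ge> ereal R"
proof (rule ccontr)
  let ?F = "Abs_fps (\<lambda>n. complex_of_real (c n))"
  assume "\<not> ?thesis"
  then have "max 1 (fps_conv_radius ?F) < ereal R" using R by (auto simp: one_ereal_def)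
  then obtain r where r: "max 1 (fps_conv_radius ?F) < ereal r" "ereal r < ereal R"
    using ereal_dense2 by blast
  then have r1: "1 < r" "r < R" by (auto simp: one_ereal_def)
  have "summable (\<lambda>n. complex_of_real (r ^ n * c n))"
    using sm[OF r1] by (simp only: summable_of_real_iff)
  then have "summable (\<lambda>n. fps_nth ?F n * of_real r ^ n)" by (simp add: mult.commute)
  then have "fps_conv_radius ?F \<ge> norm (complex_of_real r)"
    unfolding fps_conv_radius_def by (rule conv_radius_geI)
  then show False using r r1 by simp
qed

context drift_kernel
begin

definition "bgen r = (\<Sum>k. r ^ k * (bt * cn k (indicator C))) * r"

lemma pn_meas [measurable]: "pn n \<in> borel_measurable S"
  unfolding pn_def[abs_def] by measurable

lemma N_pn: "x \<in> space S \<Longrightarrow> N (\<lambda>y. ennreal (pn n y)) x = ennreal (pn (Suc n) x)"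
proof -
  assume x: "x \<in> space S"
  have "N (\<lambda>y. ennreal (pn n y)) x = N ((N ^^ n) (indicator C)) x"
    unfolding N_def[of "\<lambda>y. ennreal (pn n y)" x] N_def[of "(N ^^ n) (indicator C)" x]
    using x by (intro nn_integral_cong) (simp add: pn_eq space_P)
  also have "\<dots> = ennreal (pn (Suc n) x)" using pn_eq[OF x, of "Suc n"] by simp
  finally show ?thesis .
qed

end

section \<open>Autocovariances of the indicator of \<open>C\<close> under \<pi>\<close>

locale reversible_drift = drift_kernel +
  fixes \<pi> :: "'a measure" and \<beta> :: real
  assumes st: "stationary S P \<pi>" and rev: "reversible P \<pi>"
    and aper: "bt * measure \<nu> C \<ge> \<beta>" and beta_pos: "\<beta> > 0"
begin

lemma sets_pi [simp, measurable_cong]: "sets \<pi> = sets S"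
  by (rule sets_stationary[OF st])

lemma space_pi [simp]: "space \<pi> = space S"
  by (rule sets_eq_imp_space_eq) simp

sublocale pi: prob_space \<pi> by (rule stationary_prob[OF st])

definition "q = measure \<pi> C"

lemma q_bt: "bt * q = 1 / mass"
  unfolding q_def by (rule stationary_mass[OF st])

lemma q_bounds: "0 < q" "q \<le> 1"
proof -
  have "bt * q > 0" using mass_ge_1 by (simp add: q_bt)
  then show "0 < q" using bt_pos by (simp add: zero_less_mult_iff)
  show "q \<le> 1" by (simp add: q_def)
qed

text \<open>This is \<open>P ^ n\<close> applied to \<open>1_C - q\<close> (see
  \<open>kernel_op_pc\<close>); being bounded, it is square integrable, as reversibility
  requires.\<close>

definition "pc n x = pn n x - q"

lemma pc_meas [measurable]: "pc n \<in> borel_measurable S"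
  unfolding pc_def[abs_def] by measurable

lemma pc_bd: "x \<in> space S \<Longrightarrow> \<bar>pc n x\<bar> \<le> 1"
  using pn_bounds[of x n] q_bounds by (auto simp: pc_def)

lemma pc_prod_bd: "x \<in> space S \<Longrightarrow> \<bar>pc n x * pc m x\<bar> \<le> 1"
  using mult_mono[OF pc_bd[of x n] pc_bd[of x m]] by (simp add: abs_mult)

lemma integrable_bounded [simp]:
  fixes f :: "'a \<Rightarrow> real"
  assumes "f \<in> borel_measurable S" "\<And>x. x \<in> space S \<Longrightarrow> \<bar>f x\<bar> \<le> B"
  shows "integrable \<pi> f"
  by (rule pi.integrable_const_bound[of _ B]) (use assms in \<open>auto intro!: AE_I2\<close>)

lemma pc_prod_int: "integrable \<pi> (\<lambda>x. pc n x * pc m x)"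
  by (rule integrable_bounded[where B = 1]) (auto simp: pc_prod_bd)

lemma kernel_op_pc:
  assumes x: "x \<in> space S"
  shows "kernel_op P (pc n) x = pc (Suc n) x"
proof -
  interpret Px: prob_space "P x" by (rule P_prob) fact
  note [measurable_cong] = sets_P[OF x]
  have [measurable]: "pn n \<in> borel_measurable (P x)"
    using pn_meas[of n] sets_P[OF x] by (simp cong: measurable_cong_sets)
  have int: "integrable (P x) (pn n)"
    by (rule Px.integrable_const_bound[of _ 1])
      (use pn_bounds space_P[OF x] in \<open>auto intro!: AE_I2\<close>)
  have "(\<integral>y. pn n y \<partial>P x) = enn2real (\<integral>\<^sup>+y. ennreal (pn n y) \<partial>P x)"
  proof (rule integral_eq_nn_integral)
    show "AE y in P x. 0 \<le> pn n y" by (simp add: pn_def)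
  qed measurable
  also have "\<dots> = pn (Suc n) x" using N_pn[OF x, of n] pn_bounds[OF x] by (simp add: N_def)
  finally show ?thesis
    unfolding kernel_op_def pc_def using int Px.prob_space by simp
qed

definition "v n = (\<integral>x. pc n x * pc 0 x \<partial>\<pi>)"

text \<open>The step that uses reversibility: one application of \<open>P\<close> moves from one
  factor to the other. Iterated, it shows that the inner products depend on \<open>n + m\<close>
  only (\<open>pc_prod\<close>).\<close>

lemma pc_shift: "(\<integral>x. pc (Suc n) x * pc m x \<partial>\<pi>) = (\<integral>x. pc n x * pc (Suc m) x \<partial>\<pi>)"
proof -
  have sq: "square_integrable \<pi> (pc k)" for k
    unfolding square_integrable_def using pc_prod_int[of k k] by (simp add: power2_eq_square)
  have "(\<integral>x. pc (Suc n) x * pc m x \<partial>\<pi>) = (\<integral>x. kernel_op P (pc n) x * pc m x \<partial>\<pi>)"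
    by (intro Bochner_Integration.integral_cong refl) (simp add: kernel_op_pc)
  also have "\<dots> = (\<integral>x. pc n x * kernel_op P (pc m) x \<partial>\<pi>)"
    using rev sq unfolding reversible_def by blast
  also have "\<dots> = (\<integral>x. pc n x * pc (Suc m) x \<partial>\<pi>)"
    by (intro Bochner_Integration.integral_cong refl) (simp add: kernel_op_pc)
  finally show ?thesis .
qed

lemma pc_prod: "(\<integral>x. pc n x * pc m x \<partial>\<pi>) = v (n + m)"
proof (induction m arbitrary: n)
  case (Suc m)
  show ?case using Suc[of "Suc n"] pc_shift[of n m] by simp
qed (simp add: v_def)

lemma v_even_nonneg: "v (2 * n) \<ge> 0"
  using pc_prod[of n n] integral_nonneg_AE[of "\<lambda>x. pc n x * pc n x" \<pi>] by (simp add: mult_2)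

text \<open>Cauchy-Schwarz for \<open>pc n\<close> and \<open>pc (n + 2)\<close>.\<close>

lemma v_log_convex: "(v (2 * Suc n))\<^sup>2 \<le> v (2 * n) * v (2 * Suc (Suc n))"
proof -
  have "(v (n + Suc (Suc n)))\<^sup>2 \<le> v (n + n) * v (Suc (Suc n) + Suc (Suc n))"
    using Cauchy_Schwarz_integral[OF pc_prod_int[of n n] pc_prod_int[of "Suc (Suc n)" "Suc (Suc n)"] pc_prod_int[of n "Suc (Suc n)"]]
    by (simp only: pc_prod)
  moreover have "n + Suc (Suc n) = 2 * Suc n" "n + n = 2 * n" "Suc (Suc n) + Suc (Suc n) = 2 * Suc (Suc n)" by auto
  ultimately show ?thesis by metis
qed

lemma v_bd: "\<bar>v n\<bar> \<le> 1"
proof -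
  have "\<bar>v n\<bar> \<le> (\<integral>x. \<bar>pc n x * pc 0 x\<bar> \<partial>\<pi>)"
    unfolding v_def by (rule integral_abs_bound)
  also have "\<dots> \<le> (\<integral>x. 1 \<partial>\<pi>)"
    by (rule integral_mono) (auto intro!: pc_prod_bd integrable_abs pc_prod_int)
  finally show ?thesis using pi.prob_space by simp
qed

lemma pn_0: "x \<in> space S \<Longrightarrow> pn 0 x = indicator C x"
  by (simp add: pn_def indicator_def)

lemma int_pn: "(\<integral>x. pn n x \<partial>\<pi>) = q"
proof -
  have "(\<integral>\<^sup>+x. ennreal (pn n x) \<partial>\<pi>) = ennreal q"
  proof (induction n)
    case 0
    have "(\<integral>\<^sup>+x. ennreal (pn 0 x) \<partial>\<pi>) = (\<integral>\<^sup>+x. indicator C x \<partial>\<pi>)"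
      by (intro nn_integral_cong) (auto simp: pn_0 indicator_def)
    then show ?case by (simp add: q_def pi.emeasure_eq_measure)
  next
    case (Suc n)
    have "(\<integral>\<^sup>+x. ennreal (pn n x) \<partial>\<pi>) = (\<integral>\<^sup>+x. N (\<lambda>y. ennreal (pn n y)) x \<partial>\<pi>)"
      by (rule stationary_N[OF st]) measurable
    also have "\<dots> = (\<integral>\<^sup>+x. ennreal (pn (Suc n) x) \<partial>\<pi>)"
      by (intro nn_integral_cong) (simp add: N_pn)
    finally show ?case using Suc by simp
  qed
  then show ?thesis
    using q_bounds by (subst integral_eq_nn_integral) (auto simp: pn_def[abs_def])
qed

lemma pn_int: "integrable \<pi> (pn n)"
  by (rule integrable_bounded[where B = 1]) (use pn_bounds in auto)

lemma ind_bounded_int: "(f :: 'a \<Rightarrow> real) \<in> borel_measurable S \<Longrightarrow> (\<And>x. x \<in> space S \<Longrightarrow> \<bar>f x\<bar> \<le> 1) \<Longrightarrow>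
    integrable \<pi> (\<lambda>x. f x * indicator C x)"
  by (rule integrable_bounded[where B = 1]) (auto simp: indicator_def)

lemma v_eq: "v n = (\<integral>x. pn n x * indicator C x \<partial>\<pi>) - q\<^sup>2"
proof -
  have i1: "integrable \<pi> (\<lambda>x. pn n x * indicator C x)"
    by (rule ind_bounded_int) (use pn_bounds in auto)
  have i2: "integrable \<pi> (\<lambda>x. indicator C x :: real)"
    by (rule integrable_bounded[where B = 1]) (auto simp: indicator_def)
  have "v n = (\<integral>x. pn n x * indicator C x - q * pn n x - q * indicator C x + q\<^sup>2 \<partial>\<pi>)"
    unfolding v_def
    by (intro Bochner_Integration.integral_cong refl) (simp add: pc_def pn_0 power2_eq_square algebra_simps)
  also have "\<dots> = (\<integral>x. pn n x * indicator C x \<partial>\<pi>) - q * (\<integral>x. pn n x \<partial>\<pi>) - q * q + q\<^sup>2"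
    using i1 i2 pn_int[of n] pi.prob_space by (simp add: q_def)
  finally show ?thesis by (simp add: int_pn power2_eq_square)
qed

text \<open>\<open>v 0\<close> is the variance \<open>q - q\<^sup>2\<close>. The bound
  \<open>q\<close> is what later cancels the factor \<open>q\<close> in
  \<open>bt * q * \<nu> \<le> \<pi>\<close>.\<close>

lemma v_0_le: "v 0 \<le> q"
proof -
  have "(\<integral>x. pn 0 x * indicator C x \<partial>\<pi>) \<le> (\<integral>x. pn 0 x \<partial>\<pi>)"
    by (rule integral_mono[OF ind_bounded_int pn_int]) (use pn_bounds in \<open>auto simp: indicator_def\<close>)
  then show ?thesis unfolding v_eq int_pn by (smt (verit) zero_le_power2)
qed

text \<open>The coefficients left when \<open>renewal_hit\<close> is integrated over
  \<open>C\<close>: first-regeneration probabilities for the chain started from \<pi> restricted to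
  \<open>C\<close>.\<close>

definition "et n = (\<integral>x. bt * tn n (indicator C) x * indicator C x \<partial>\<pi>)"

lemma tn_meas [measurable]: "f \<in> borel_measurable S \<Longrightarrow> tn n f \<in> borel_measurable S"
  unfolding tn_def[abs_def] by measurable

lemma h_bound: "x \<in> space S \<Longrightarrow> \<bar>bt * tn n (indicator C) x\<bar> \<le> 1"
proof -
  assume x: "x \<in> space S"
  have "tn (Suc n) (\<lambda>_. 1) x \<ge> 0" by simp
  moreover have "ennreal (tn n (\<lambda>_. 1) x) \<le> ennreal 1" using Tn_one_le[OF x, of n] by (simp add: tn_one[OF x])
  then have "tn n (\<lambda>_. 1) x \<le> 1" by (subst (asm) ennreal_le_iff) auto
  ultimately have "bt * tn n (indicator C) x \<le> 1" using tn_one_step[OF x, of n] by linarith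
  then show ?thesis using bt_pos by simp
qed

lemma h_int: "integrable \<pi> (\<lambda>x. bt * tn n (indicator C) x * indicator C x)"
  by (rule ind_bounded_int) (auto simp: h_bound)

lemma et_nonneg: "et n \<ge> 0"
  unfolding et_def using bt_pos by (intro integral_nonneg_AE) auto

lemma bt_v: "bt * v n = (\<Sum>i\<le>n. et i * un (n - i)) - bt * q\<^sup>2"
proof -
  have i: "integrable \<pi> (\<lambda>x. pn n x * indicator C x)"
    by (rule ind_bounded_int) (use pn_bounds in auto)
  have "bt * (\<integral>x. pn n x * indicator C x \<partial>\<pi>) = (\<integral>x. bt * pn n x * indicator C x \<partial>\<pi>)"
    by (simp add: mult.assoc)
  also have "\<dots> = (\<integral>x. (\<Sum>i\<le>n. un (n - i) * (bt * tn i (indicator C) x * indicator C x)) \<partial>\<pi>)"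
    by (intro Bochner_Integration.integral_cong refl)
      (simp add: renewal_hit sum_distrib_left sum_distrib_right mult_ac)
  also have "\<dots> = (\<Sum>i\<le>n. un (n - i) * et i)"
    unfolding et_def using h_int by (subst Bochner_Integration.integral_sum) auto
  finally show ?thesis by (simp add: v_eq right_diff_distrib mult_ac)
qed

text \<open>\<open>hit_sum\<close> integrated over \<open>C\<close>, the surviving mass vanishing by
  dominated convergence. The total \<open>q\<close> makes the numerator of the generating function
  vanish at 1.\<close>

lemma et_sums: "et sums q"
proof -
  have "(\<lambda>n. \<integral>x. tn n (\<lambda>_. 1) x * indicator C x \<partial>\<pi>) \<longlonglongrightarrow> (\<integral>x. 0 \<partial>\<pi>)"
  proof (rule integral_dominated_convergence[where w = "\<lambda>_. 1"])
    show "AE x in \<pi>. (\<lambda>n. tn n (\<lambda>_. 1) x * indicator C x) \<longlonglongrightarrow> 0"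
      by (intro AE_I2 tendsto_mult_left_zero tn_one_tendsto) simp
    show "AE x in \<pi>. norm (tn n (\<lambda>_. 1) x * indicator C x) \<le> 1" for n
    proof (intro AE_I2)
      fix x assume "x \<in> space \<pi>"
      then have x: "x \<in> space S" by simp
      have "ennreal (tn n (\<lambda>_. 1) x) \<le> ennreal 1" using Tn_one_le[OF x, of n] by (simp add: tn_one[OF x])
      then show "norm (tn n (\<lambda>_. 1) x * indicator C x) \<le> 1"
        by (subst (asm) ennreal_le_iff) (auto simp: indicator_def)
    qed
  qed auto
  then have lim: "(\<lambda>n. \<integral>x. tn n (\<lambda>_. 1) x * indicator C x \<partial>\<pi>) \<longlonglongrightarrow> 0" by simp
  have "(\<Sum>i<n. et i) = q - (\<integral>x. tn n (\<lambda>_. 1) x * indicator C x \<partial>\<pi>)" for n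
  proof -
    have i1: "integrable \<pi> (\<lambda>x. tn n (\<lambda>_. 1) x * indicator C x)"
    proof (rule ind_bounded_int)
      fix x assume x: "x \<in> space S"
      have "ennreal (tn n (\<lambda>_. 1) x) \<le> ennreal 1" using Tn_one_le[OF x, of n] by (simp add: tn_one[OF x])
      then show "\<bar>tn n (\<lambda>_. 1) x\<bar> \<le> 1" by (subst (asm) ennreal_le_iff) auto
    qed auto
    have i2: "integrable \<pi> (\<lambda>x. indicator C x :: real)"
      by (rule integrable_bounded[where B = 1]) (auto simp: indicator_def)
    have "(\<Sum>i<n. et i) = (\<integral>x. (\<Sum>i<n. bt * tn i (indicator C) x * indicator C x) \<partial>\<pi>)"
      unfolding et_def using h_int by (subst Bochner_Integration.integral_sum) auto
    also have "\<dots> = (\<integral>x. indicator C x - tn n (\<lambda>_. 1) x * indicator C x \<partial>\<pi>)"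
      by (intro Bochner_Integration.integral_cong refl)
        (simp add: hit_sum sum_distrib_right[symmetric] left_diff_distrib)
    also have "\<dots> = q - (\<integral>x. tn n (\<lambda>_. 1) x * indicator C x \<partial>\<pi>)"
      using i1 i2 by (simp add: q_def)
    finally show ?thesis .
  qed
  then show ?thesis
    unfolding sums_def using tendsto_diff[OF tendsto_const[of q] lim] by simp
qed

lemma et_power_summable:
  assumes r: "1 < r" "r \<le> 1 / lam" and D: "DD r > 0"
  shows "summable (\<lambda>n. r ^ n * et n)"
proof (rule summableI_nonneg_bounded)
  show "0 \<le> r ^ n * et n" for n using et_nonneg r by simp
  fix n
  have "(\<Sum>k<n. r ^ k * et k) = (\<integral>x. (\<Sum>k<n. r ^ k * (bt * tn k (indicator C) x * indicator C x)) \<partial>\<pi>)"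
    unfolding et_def using h_int by (subst Bochner_Integration.integral_sum) auto
  also have "\<dots> \<le> (\<integral>x. bt / DD r \<partial>\<pi>)"
  proof (rule integral_mono)
    show "integrable \<pi> (\<lambda>x. \<Sum>k<n. r ^ k * (bt * tn k (indicator C) x * indicator C x))"
      using h_int by (intro Bochner_Integration.integrable_sum integrable_mult_right) auto
    fix x assume "x \<in> space \<pi>"
    then have x: "x \<in> space S" by simp
    show "(\<Sum>k<n. r ^ k * (bt * tn k (indicator C) x * indicator C x)) \<le> bt / DD r"
    proof (cases "x \<in> C")
      case True
      have "0 \<le> r ^ n * tn n (\<lambda>_. 1) x" using r by simp
      then have "(\<Sum>k<n. r ^ k * (bt * tn k (indicator C) x)) \<le> bt / DD r * Phi r x"
        using hit_real_partial[OF less_imp_le[OF r(1)] r(2) D x, of n] by linarith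
      then show ?thesis using True by (simp add: Phi_def)
    next
      case False
      then show ?thesis using bt_pos D by simp
    qed
  qed simp
  finally show "(\<Sum>k<n. r ^ k * et k) \<le> bt / DD r" using pi.prob_space by simp
qed

section \<open>Generating function identities and the zeros of the denominator\<close>

lemma fps_renewal:
  defines "TT \<equiv> Abs_fps (\<lambda>n. complex_of_real (cn n (\<lambda>_. 1)))"
    and "UU \<equiv> Abs_fps (\<lambda>n. complex_of_real (un n))"
    and "BB \<equiv> Abs_fps (\<lambda>n. complex_of_real (bt * cn n (indicator C)))"
  shows "(1 - fps_X) * TT = 1 - fps_X * BB" "(1 - fps_X * BB) * UU = 1"
proof -
  show "(1 - fps_X) * TT = 1 - fps_X * BB"
  proof (rule fps_ext)
    fix n
    show "fps_nth ((1 - fps_X) * TT) n = fps_nth (1 - fps_X * BB) n"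
      using cn_one_step[of "n - 1"]
      by (cases n) (auto simp: left_diff_distrib TT_def BB_def cn_0_one of_real_mult[symmetric] of_real_diff[symmetric]
          simp del: of_real_mult of_real_diff)
  qed
  have "UU = 1 + fps_X * (BB * UU)"
  proof (rule fps_ext)
    fix n
    show "fps_nth UU n = fps_nth (1 + fps_X * (BB * UU)) n"
    proof (cases n)
      case 0
      then show ?thesis by (simp add: UU_def un_def)
    next
      case (Suc m)
      have "fps_nth UU n = complex_of_real (\<Sum>i\<le>m. bt * cn i (indicator C) * un (m - i))"
        using renewal_un[of m] Suc by (simp add: UU_def)
      also have "\<dots> = fps_nth (BB * UU) m"
        by (simp add: fps_mult_nth BB_def UU_def atLeast0AtMost)
      finally show ?thesis using Suc by simp
    qed
  qed
  then show "(1 - fps_X * BB) * UU = 1" by (simp add: algebra_simps)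
qed

text \<open>By \<open>bt_v\<close>, \<open>v\<close> is a convolution of \<open>et / bt\<close> with
  \<open>un\<close> minus the constant \<open>q\<^sup>2\<close>. The factor
  \<open>(1 - fps_X) * TT\<close> is the inverse of the series of \<open>un\<close>; it cancels that
  series and turns the constant into \<open>q\<^sup>2\<close> times \<open>TT\<close>.\<close>

lemma fps_identity:
  defines "TT \<equiv> Abs_fps (\<lambda>n. complex_of_real (cn n (\<lambda>_. 1)))"
  shows "(1 - fps_X) * TT * Abs_fps (\<lambda>n. complex_of_real (v n)) =
    Abs_fps (\<lambda>n. complex_of_real (et n / bt - q\<^sup>2 * cn n (\<lambda>_. 1)))"
proof -
  define UU where "UU = Abs_fps (\<lambda>n. complex_of_real (un n))"
  define EE where "EE = Abs_fps (\<lambda>n. complex_of_real (et n / bt))"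
  define GG where "GG = Abs_fps (\<lambda>n. 1 :: complex)"
  have v: "v n = (\<Sum>i\<le>n. et i / bt * un (n - i)) - q\<^sup>2" for n
    using bt_v[of n] bt_pos by (simp add: sum_divide_distrib[symmetric] field_simps)
  have "Abs_fps (\<lambda>n. complex_of_real (v n)) = EE * UU - fps_const (complex_of_real (q\<^sup>2)) * GG"
    by (rule fps_ext) (simp add: v fps_mult_nth EE_def UU_def GG_def atLeast0AtMost)
  moreover have "(1 - fps_X) * TT * UU = 1"
    using fps_renewal unfolding TT_def UU_def by simp
  moreover have "(1 - fps_X) * GG = 1"
    by (rule fps_ext) (auto simp: GG_def left_diff_distrib)
  moreover have "(1 - fps_X) * TT * (EE * UU - fps_const (complex_of_real (q\<^sup>2)) * GG) =
      EE * ((1 - fps_X) * TT * UU) - fps_const (complex_of_real (q\<^sup>2)) * TT * ((1 - fps_X) * GG)"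
    by (simp add: algebra_simps)
  ultimately have "(1 - fps_X) * TT * Abs_fps (\<lambda>n. complex_of_real (v n)) =
      EE - fps_const (complex_of_real (q\<^sup>2)) * TT"
    by simp
  also have "\<dots> = Abs_fps (\<lambda>n. complex_of_real (et n / bt - q\<^sup>2 * cn n (\<lambda>_. 1)))"
    by (rule fps_ext) (simp add: EE_def TT_def)
  finally show ?thesis .
qed

lemma bgen_summable:
  assumes R: "R \<le> 1 / lam" "\<And>r. 1 < r \<Longrightarrow> r < R \<Longrightarrow> DD r > 0" and t: "\<bar>t\<bar> < R" "1 < R"
  shows "summable (\<lambda>k. \<bar>t ^ k * (bt * cn k (indicator C))\<bar>)"
    "summable (\<lambda>k. t ^ k * (bt * cn k (indicator C)))"
    "summable (\<lambda>k. \<bar>t ^ k * cn k (\<lambda>_. 1)\<bar>)"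
    "summable (\<lambda>k. t ^ k * cn k (\<lambda>_. 1))"
proof -
  obtain r where r: "max 1 \<bar>t\<bar> < r" "r < R" using dense[of "max 1 \<bar>t\<bar>" R] t by auto
  have r1: "1 \<le> r" "1 < r" "r \<le> 1 / lam" "DD r > 0" "\<bar>t\<bar> \<le> r" using r R by auto
  have p: "\<bar>t\<bar> ^ k \<le> r ^ k" for k using r1 by (intro power_mono) auto
  show 1: "summable (\<lambda>k. \<bar>t ^ k * (bt * cn k (indicator C))\<bar>)"
    by (rule summable_comparison_test'[OF hit_mass(1)[OF r1(1,3,4)]])
      (use p bt_pos in \<open>auto simp: abs_mult power_abs intro!: mult_right_mono\<close>)
  show 2: "summable (\<lambda>k. \<bar>t ^ k * cn k (\<lambda>_. 1)\<bar>)"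
    by (rule summable_comparison_test'[OF mass_tail(1)[OF r1(2,3,4)]])
      (use p in \<open>auto simp: abs_mult power_abs intro!: mult_right_mono\<close>)
  show "summable (\<lambda>k. t ^ k * (bt * cn k (indicator C)))" "summable (\<lambda>k. t ^ k * cn k (\<lambda>_. 1))"
    using 1 2 by (auto intro: summable_rabs_cancel)
qed

text \<open>The first identity of \<open>fps_renewal\<close> at real points, valid on all of
  \<open>(- R, R)\<close>. It reduces the nonvanishing of the denominator at negative
  \<open>t\<close> to \<open>bgen t \<noteq> 1\<close>.\<close>

lemma tail_bgen:
  assumes R: "R \<le> 1 / lam" "\<And>r. 1 < r \<Longrightarrow> r < R \<Longrightarrow> DD r > 0" and t: "\<bar>t\<bar> < R" "1 < R"
  shows "(1 - t) * (\<Sum>k. t ^ k * cn k (\<lambda>_. 1)) = 1 - bgen t"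
proof -
  note sm = bgen_summable[OF R t]
  have "(\<Sum>k. t ^ k * cn k (\<lambda>_. 1)) = 1 + (\<Sum>k. t ^ Suc k * cn (Suc k) (\<lambda>_. 1))"
    using suminf_split_head[OF sm(4)] by (simp add: cn_0_one)
  also have "(\<lambda>k. t ^ Suc k * cn (Suc k) (\<lambda>_. 1)) =
      (\<lambda>k. t * (t ^ k * cn k (\<lambda>_. 1)) - t * (t ^ k * (bt * cn k (indicator C))))"
  proof
    fix k
    have "cn (Suc k) (\<lambda>_. 1) = cn k (\<lambda>_. 1) - bt * cn k (indicator C)" using cn_one_step[of k] by simp
    then show "t ^ Suc k * cn (Suc k) (\<lambda>_. 1) =
        t * (t ^ k * cn k (\<lambda>_. 1)) - t * (t ^ k * (bt * cn k (indicator C)))"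
      by (simp only: power_Suc right_diff_distrib mult.assoc)
  qed
  also have "suminf \<dots> = t * (\<Sum>k. t ^ k * cn k (\<lambda>_. 1)) - t * (\<Sum>k. t ^ k * (bt * cn k (indicator C)))"
    using sm by (simp add: suminf_diff[symmetric] summable_mult suminf_mult)
  finally show ?thesis by (simp add: bgen_def algebra_simps)
qed

text \<open>Changing the sign of the argument flips at least the first term, which is at least \<open>\<beta> t\<close>.\<close>
lemma bgen_neg_less_1:
  assumes R: "R \<le> 1 / lam" "\<And>r. 1 < r \<Longrightarrow> r < R \<Longrightarrow> DD r > 0" "1 < R"
    and b: "\<And>r. 1 < r \<Longrightarrow> r < R \<Longrightarrow> bgen r < 1 + 2 * \<beta> * r"
    and t: "0 \<le> t" "t < R"
  shows "bgen (- t) < 1"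
proof -
  define b where "b k = bt * cn k (indicator C)" for k
  have b0: "b k \<ge> 0" for k using bt_pos by (simp add: b_def)
  \<comment> \<open>Since \<open>bgen\<close> has no constant term, \<open>bgen t\<close> is at most
    \<open>t / r\<close> times \<open>bgen r\<close>. A point \<open>r\<close> above
    \<open>max 1 t\<close> lies where the hypothesis applies, and \<open>t / r < 1\<close> supplies
    the strict inequality.\<close>
  obtain r where r: "max 1 t < r" "r < R" using dense[of "max 1 t" R] R t by auto
  have abt: "\<bar>t\<bar> < R" "\<bar>- t\<bar> < R" "\<bar>r\<bar> < R" using t r by auto
  note st = bgen_summable[OF R(1,2) abt(1) R(3)] and sn = bgen_summable[OF R(1,2) abt(2) R(3)]
    and sr = bgen_summable[OF R(1,2) abt(3) R(3)]
  have b_1: "b 0 \<ge> \<beta>"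
  proof -
    have "cn 0 (indicator C) = measure \<nu> C" by (simp add: cn_def nuT_def measure_def)
    then show ?thesis using aper by (simp add: b_def)
  qed
  have "bgen (- t) = (\<Sum>k. - t * ((- t) ^ k * b k))"
  proof -
    have "(\<Sum>k. - t * ((- t) ^ k * b k)) = - t * (\<Sum>k. (- t) ^ k * b k)"
      by (rule suminf_mult) (use sn(2) in \<open>simp add: b_def\<close>)
    then show ?thesis by (simp add: bgen_def b_def)
  qed
  also have "\<dots> \<le> (\<Sum>k. t * (t ^ k * b k) - (if k = 0 then 2 * t * b 0 else 0))"
  proof (rule suminf_le)
    fix k
    show "- t * ((- t) ^ k * b k) \<le> t * (t ^ k * b k) - (if k = 0 then 2 * t * b 0 else 0)"
    proof (cases "k = 0")
      case False
      have "- t * ((- t) ^ k * b k) \<le> \<bar>- t * ((- t) ^ k * b k)\<bar>" by (rule abs_ge_self)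
      also have "\<dots> = t * (t ^ k * b k)" using t b0 by (simp add: abs_mult power_abs)
      finally show ?thesis using False by simp
    qed simp
    show "summable (\<lambda>k. - t * ((- t) ^ k * b k))" using sn(2) by (intro summable_mult) (simp add: b_def)
    show "summable (\<lambda>k. t * (t ^ k * b k) - (if k = 0 then 2 * t * b 0 else 0))"
      using st(2) by (intro summable_diff summable_mult summable_If_finite) (simp_all add: b_def)
  qed
  also have "\<dots> = (\<Sum>k. t * (t ^ k * b k)) - 2 * t * b 0"
  proof -
    have "(\<lambda>k::nat. if k = 0 then 2 * t * b 0 else 0) sums (2 * t * b 0)"
      by (rule sums_If_finite_set'[of "\<lambda>_. 0" 0 "{0}", simplified]) simp_all
    then have s: "summable (\<lambda>k::nat. if k = 0 then 2 * t * b 0 else 0)"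
      and e: "(\<Sum>k::nat. if k = 0 then 2 * t * b 0 else 0) = 2 * t * b 0" by (auto simp: sums_iff)
    have s2: "summable (\<lambda>k. t * (t ^ k * b k))" using st(2) by (intro summable_mult) (simp add: b_def)
    show ?thesis using suminf_diff[OF s2 s] e by simp
  qed
  also have "(\<Sum>k. t * (t ^ k * b k)) \<le> (\<Sum>k. t / r * (r * (r ^ k * b k)))"
  proof (rule suminf_le)
    fix k
    have "t ^ k * b k \<le> r ^ k * b k" using t r b0 by (intro mult_right_mono power_mono) auto
    then have "t * (t ^ k * b k) \<le> t * (r ^ k * b k)" using t by (intro mult_left_mono)
    then show "t * (t ^ k * b k) \<le> t / r * (r * (r ^ k * b k))" using r by simp
    show "summable (\<lambda>k. t * (t ^ k * b k))" using st(2) by (intro summable_mult) (simp add: b_def)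
    show "summable (\<lambda>k. t / r * (r * (r ^ k * b k)))" using sr(2) by (intro summable_mult) (simp add: b_def)
  qed
  also have "(\<Sum>k. t / r * (r * (r ^ k * b k))) = t / r * bgen r"
    using sr(2) by (simp add: bgen_def b_def suminf_mult summable_mult mult.commute)
  finally have 1: "bgen (- t) \<le> t / r * bgen r - 2 * t * b 0" by simp
  have r0: "0 < r" "1 < r" using r by auto
  have "t / r * bgen r \<le> t / r * (1 + 2 * \<beta> * r)"
    using b[OF r0(2) r(2)] t r0 by (intro mult_left_mono) auto
  also have "\<dots> = t / r + 2 * t * \<beta>" using r0 by (simp add: field_simps)
  also have "\<dots> < 1 + 2 * t * b 0"
  proof -
    have "t / r < 1" using r r0 by simp
    moreover have "2 * t * \<beta> \<le> 2 * t * b 0" using b_1 t by (intro mult_left_mono) auto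
    ultimately show ?thesis by simp
  qed
  finally show ?thesis using 1 by simp
qed

lemma v_decay:
  assumes R: "R \<le> 1 / lam" "\<And>r. 1 < r \<Longrightarrow> r < R \<Longrightarrow> DD r > 0" "1 < R"
    and b: "\<And>r. 1 < r \<Longrightarrow> r < R \<Longrightarrow> bgen r < 1 + 2 * \<beta> * r"
  shows "v (2 * n) \<le> v 0 * (1 / R) ^ (2 * n)"
proof (rule moment_decay[where \<tau> = "\<lambda>n. cn n (\<lambda>_. 1)" and \<eta> = "\<lambda>n. et n / bt - q\<^sup>2 * cn n (\<lambda>_. 1)" and Bd = 1])
  let ?T = "Abs_fps (\<lambda>n. complex_of_real (cn n (\<lambda>_. 1)))"
  let ?N = "Abs_fps (\<lambda>n. complex_of_real (et n / bt - q\<^sup>2 * cn n (\<lambda>_. 1)))"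
  show radT: "fps_conv_radius ?T \<ge> ereal R"
    by (rule summable_powser_conv_radius) (use R in \<open>auto intro!: mass_tail(1)\<close>)
  show "fps_conv_radius ?N \<ge> ereal R"
  proof (rule summable_powser_conv_radius)
    fix r assume r: "1 < r" "r < R"
    have "summable (\<lambda>n. (r ^ n * et n) / bt - q\<^sup>2 * (r ^ n * cn n (\<lambda>_. 1)))"
      using r R by (intro summable_diff summable_divide summable_mult et_power_summable mass_tail(1)) auto
    then show "summable (\<lambda>n. r ^ n * (et n / bt - q\<^sup>2 * cn n (\<lambda>_. 1)))"
      by (simp add: right_diff_distrib mult_ac)
  qed fact
  show "(1 - fps_X) * ?T * Abs_fps (\<lambda>n. complex_of_real (v n)) = ?N" by (rule fps_identity)
  show "eval_fps ?N 1 = 0"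
  proof -
    have "(\<lambda>n. et n / bt - q\<^sup>2 * cn n (\<lambda>_. 1)) sums (q / bt - q\<^sup>2 * mass)"
      unfolding mass_def using cn_one_summable
      by (intro sums_diff sums_divide sums_mult et_sums summable_sums)
    moreover have "q / bt - q\<^sup>2 * mass = 0"
      using q_bt q_bounds bt_pos mass_ge_1 by (simp add: field_simps power2_eq_square)
    ultimately have "(\<lambda>n. et n / bt - q\<^sup>2 * cn n (\<lambda>_. 1)) sums 0" by simp
    then have "(\<lambda>n. complex_of_real (et n / bt - q\<^sup>2 * cn n (\<lambda>_. 1))) sums complex_of_real 0"
      by (rule sums_of_real)
    then show ?thesis by (simp add: eval_fps_def sums_iff)
  qed
  show "eval_fps ?T (of_real t) \<noteq> 0" if t: "\<bar>t\<bar> < R" for t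
  proof -
    note sm = bgen_summable[OF R(1,2) t R(3)]
    have ev: "eval_fps ?T (of_real t) = of_real (\<Sum>k. t ^ k * cn k (\<lambda>_. 1))"
    proof -
      have "(\<lambda>k. complex_of_real (t ^ k * cn k (\<lambda>_. 1))) sums of_real (\<Sum>k. t ^ k * cn k (\<lambda>_. 1))"
        using sm(4) by (intro sums_of_real summable_sums)
      then show ?thesis by (simp add: eval_fps_def sums_iff mult.commute)
    qed
    \<comment> \<open>For \<open>t \<ge> 0\<close> the constant coefficient 1 already bounds the sum
      from below, so only negative \<open>t\<close> requires \<open>bgen t < 1\<close>.\<close>
    have "(\<Sum>k. t ^ k * cn k (\<lambda>_. 1)) \<noteq> 0"
    proof (cases "t \<ge> 0")
      case True
      have "(\<Sum>k\<in>{0}. t ^ k * cn k (\<lambda>_. 1)) \<le> (\<Sum>k. t ^ k * cn k (\<lambda>_. 1))"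
        using True by (intro sum_le_suminf sm) auto
      then show ?thesis by (simp add: cn_0_one)
    next
      case False
      have "bgen (- (- t)) < 1" by (rule bgen_neg_less_1[OF R b]) (use False t in auto)
      then show ?thesis using tail_bgen[OF R(1,2) t R(3)] by auto
    qed
    then show ?thesis by (simp add: ev)
  qed
qed (use R v_even_nonneg v_log_convex v_bd in auto)

section \<open>The error in the renewal theorem\<close>

lemma renewal_error:
  assumes R: "R \<le> 1 / lam" "\<And>r. 1 < r \<Longrightarrow> r < R \<Longrightarrow> DD r > 0" "1 < R"
    and b: "\<And>r. 1 < r \<Longrightarrow> r < R \<Longrightarrow> bgen r < 1 + 2 * \<beta> * r"
  shows "\<bar>un (Suc j) - 1 / mass\<bar> \<le> sqrt bt * (1 / R) ^ j"
proof -
  have nu_int: "integrable \<nu> f" if "f \<in> borel_measurable S" "\<And>x. x \<in> space S \<Longrightarrow> \<bar>f x\<bar> \<le> 1" for f :: "'a \<Rightarrow> real"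
    by (rule nu.integrable_const_bound[of _ 1]) (use that in \<open>auto intro!: AE_I2\<close>)
  have i2: "integrable \<nu> (\<lambda>x. pc j x * pc j x)" by (rule nu_int, measurable, erule pc_prod_bd)
  have i1: "integrable \<nu> (pc j)" by (rule nu_int) (auto simp: pc_bd)
  have un: "un (Suc j) - 1 / mass = bt * (\<integral>x. pc j x \<partial>\<nu>)"
  proof -
    have "(\<integral>\<^sup>+y. (N ^^ j) (indicator C) y \<partial>\<nu>) = (\<integral>\<^sup>+y. ennreal (pn j y) \<partial>\<nu>)"
      by (intro nn_integral_cong) (simp add: pn_eq)
    then have "un (Suc j) = bt * (\<integral>y. pn j y \<partial>\<nu>)"
      by (subst integral_eq_nn_integral) (auto simp: un_def pn_def[abs_def])
    moreover have "integrable \<nu> (pn j)" by (rule nu_int) (use pn_bounds in auto)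
    ultimately show ?thesis
      unfolding pc_def using nu.prob_space by (simp add: q_bt[symmetric] right_diff_distrib)
  qed
  \<comment> \<open>One step of \<pi> through \<open>C\<close> gives
    \<open>bt * q * \<nu> \<le> \<pi>\<close>, so the second moment under \<nu> is controlled by
    \<open>v (2 * j)\<close>; \<open>v_0_le\<close> then cancels \<open>q\<close>.\<close>
  have sq: "bt * (\<integral>x. pc j x * pc j x \<partial>\<nu>) \<le> (1 / R) ^ (2 * j)"
  proof -
    let ?f = "\<lambda>x. ennreal (pc j x * pc j x)"
    have "(\<integral>\<^sup>+x. ennreal bt * (\<integral>\<^sup>+y. ?f y \<partial>\<nu>) * indicator C x \<partial>\<pi>) \<le> (\<integral>\<^sup>+x. N ?f x \<partial>\<pi>)"
      by (intro nn_integral_mono) (simp add: N_eq_T mult_ac)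
    also have "\<dots> = (\<integral>\<^sup>+x. ?f x \<partial>\<pi>)" by (rule stationary_N[OF st, symmetric]) measurable
    also have "\<dots> = ennreal (v (2 * j))"
      using pc_prod[of j j] by (subst nn_integral_eq_integral[OF pc_prod_int]) (auto simp: mult_2)
    also have "(\<integral>\<^sup>+x. ennreal bt * (\<integral>\<^sup>+y. ?f y \<partial>\<nu>) * indicator C x \<partial>\<pi>) =
        ennreal bt * (\<integral>\<^sup>+y. ?f y \<partial>\<nu>) * ennreal q"
      by (subst nn_integral_cmult_indicator) (auto simp: q_def pi.emeasure_eq_measure)
    also have "(\<integral>\<^sup>+y. ?f y \<partial>\<nu>) = ennreal (\<integral>x. pc j x * pc j x \<partial>\<nu>)"
      by (subst nn_integral_eq_integral[OF i2]) auto
    also have "ennreal bt * ennreal (\<integral>x. pc j x * pc j x \<partial>\<nu>) * ennreal q =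
        ennreal (bt * (\<integral>x. pc j x * pc j x \<partial>\<nu>) * q)"
      using bt_pos q_bounds by (simp add: ennreal_mult[symmetric])
    finally have "bt * (\<integral>x. pc j x * pc j x \<partial>\<nu>) * q \<le> v (2 * j)"
      by (subst (asm) ennreal_le_iff) (auto simp: v_even_nonneg)
    also have "\<dots> \<le> v 0 * (1 / R) ^ (2 * j)" by (rule v_decay[OF R b])
    also have "\<dots> \<le> q * (1 / R) ^ (2 * j)" using v_0_le R by (intro mult_right_mono) auto
    finally show ?thesis using q_bounds by (simp add: mult.commute)
  qed
  have "(\<integral>x. pc j x * 1 \<partial>\<nu>)\<^sup>2 \<le> (\<integral>x. pc j x * pc j x \<partial>\<nu>) * (\<integral>x. 1 * 1 \<partial>\<nu>)"
    using i1 i2 by (intro Cauchy_Schwarz_integral) auto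
  then have cs: "(\<integral>x. pc j x \<partial>\<nu>)\<^sup>2 \<le> (\<integral>x. pc j x * pc j x \<partial>\<nu>)" using nu.prob_space by simp
  \<comment> \<open>Of the two factors \<open>bt\<close>, one is consumed by \<open>sq\<close>; the
    other survives and is the origin of \<open>sqrt bt\<close> in the constant.\<close>
  have "(un (Suc j) - 1 / mass)\<^sup>2 = bt * (bt * (\<integral>x. pc j x \<partial>\<nu>)\<^sup>2)"
    by (simp add: un power_mult_distrib power2_eq_square)
  also have "\<dots> \<le> bt * (bt * (\<integral>x. pc j x * pc j x \<partial>\<nu>))" using cs bt_pos by (intro mult_left_mono) auto
  also have "\<dots> \<le> bt * (1 / R) ^ (2 * j)" using sq bt_pos by (intro mult_left_mono) auto
  also have "\<dots> = (sqrt bt * (1 / R) ^ j)\<^sup>2"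
    using bt_pos by (simp add: power_mult_distrib power_mult[symmetric] mult.commute)
  finally have "\<bar>un (Suc j) - 1 / mass\<bar> \<le> \<bar>sqrt bt * (1 / R) ^ j\<bar>"
    by (simp only: abs_le_square_iff)
  moreover have "0 \<le> sqrt bt * (1 / R) ^ j" using R bt_pos by simp
  ultimately show ?thesis by (simp only: abs_of_nonneg)
qed

text \<open>The term \<open>j = 0\<close> is \<open>1 - 1 / mass\<close>, at most 1, and the rest is
  a geometric series. At \<open>r = 1 / \<gamma>\<close> the total is the \<kappa> of the stated
  constants.\<close>

lemma renewal_error_sum:
  assumes R: "R \<le> 1 / lam" "\<And>r. 1 < r \<Longrightarrow> r < R \<Longrightarrow> DD r > 0" "1 < R"
    and b: "\<And>r. 1 < r \<Longrightarrow> r < R \<Longrightarrow> bgen r < 1 + 2 * \<beta> * r"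
    and r: "1 < r" "r < R"
  shows "summable (\<lambda>j. r ^ j * \<bar>un j - 1 / mass\<bar>)"
    "(\<Sum>j. r ^ j * \<bar>un j - 1 / mass\<bar>) \<le> 1 + sqrt bt / (1 / r - 1 / R)"
proof -
  let ?f = "\<lambda>j. r ^ j * \<bar>un j - 1 / mass\<bar>"
  have rR: "norm (r / R) < 1" using r R by simp
  have le: "?f (Suc j) \<le> r * sqrt bt * (r / R) ^ j" for j
  proof -
    have "?f (Suc j) \<le> r ^ Suc j * (sqrt bt * (1 / R) ^ j)"
      using renewal_error[OF R b, of j] r by (intro mult_left_mono) auto
    also have "\<dots> = r * sqrt bt * (r / R) ^ j" by (simp add: power_divide)
    finally show ?thesis .
  qed
  have g: "(\<lambda>j. r * sqrt bt * (r / R) ^ j) sums (r * sqrt bt * (1 / (1 - r / R)))"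
    using rR by (intro sums_mult geometric_sums)
  have s1: "summable (\<lambda>j. ?f (Suc j))"
    by (rule summable_comparison_test'[OF sums_summable[OF g]]) (use le r in auto)
  then show s: "summable ?f" by (rule summable_Suc_iff[of ?f, THEN iffD1])
  have "(\<Sum>j. ?f j) = \<bar>1 - 1 / mass\<bar> + (\<Sum>j. ?f (Suc j))"
    using suminf_split_head[OF s] by (simp add: un_def)
  also have "(\<Sum>j. ?f (Suc j)) \<le> r * sqrt bt * (1 / (1 - r / R))"
    using suminf_le[OF le s1 sums_summable[OF g]] g by (simp add: sums_iff)
  also have "\<bar>1 - 1 / mass\<bar> \<le> 1" using mass_ge_1 by simp
  also have "r * sqrt bt * (1 / (1 - r / R)) = sqrt bt / (1 / r - 1 / R)"
    using r R by (simp add: field_simps)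
  finally show "(\<Sum>j. ?f j) \<le> 1 + sqrt bt / (1 / r - 1 / R)" by simp
qed

end

context drift_kernel
begin

section \<open>The explicit constants\<close>

text \<open>With \<open>r = 1 / \<gamma>\<close>, \<open>MN\<close> and \<open>MA\<close> are the constants \<open>M_non\<close> and \<open>M_at\<close>.\<close>

definition "GC r = r * (1 + (1 + cc r) * (K - 1))"
definition "QC r = r * ((1 - bt) + (1 + cc r) * (K - 1))"

definition "MN r \<kappa> = max (cc r) (GC r) + K * r * QC r / DD r + bt * pp r * (K * r) * GC r / (DD r)\<^sup>2 * \<kappa> +
  pp r * GC r / (DD r)\<^sup>2 * (bt * (max lam (K - lam) / (1 - lam)) + (bt - DD r) / (r - 1)) +
  pp r * (r * dd r * (K - 1)) / DD r + QC 1 * (r / (r - 1)) * (pp r / DD r - 1 / bt)"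

definition "MA r \<kappa> = max (cc r) (GC r) + K * r * GC r * \<kappa> + GC r * (max lam (K - lam) / (1 - lam)) + r * dd r * (K - 1)"

lemma pp_ge_1: "1 \<le> r \<Longrightarrow> 1 \<le> pp r"
proof -
  assume r: "1 \<le> r"
  have "ln Kt / ln (1 / lam) \<ge> 0" using Kt_ge_1 ln_lam by simp
  then have "1 \<le> mm r" using r by (simp add: mm_def ge_one_powr_ge_zero)
  then show ?thesis using r mult_mono[of 1 r 1 "mm r"] by (simp add: pp_def)
qed

lemma dd_nonneg: "1 \<le> r \<Longrightarrow> r < 1 / lam \<Longrightarrow> 0 \<le> dd r"
  using cc_props[of r] cc_props[OF order_refl one_less_inv_lam] by (simp add: dd_def)

lemma GC_ge:
  assumes r: "1 \<le> r" "r < 1 / lam"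
  shows "(K - lam) / (1 - lam) \<le> GC r" "1 \<le> GC r" "0 \<le> QC r"
proof -
  note c = cc_props[OF r]
  have "cc 1 \<le> cc r"
  proof -
    have "lam / (1 - lam) \<le> r * lam / (1 - r * lam)"
      using r lam c(1) by (intro frac_le) auto
    then show ?thesis by (simp add: cc_def)
  qed
  then have "1 + (1 + cc 1) * (K - 1) \<le> 1 + (1 + cc r) * (K - 1)"
    using K_ge_1 by (intro add_left_mono mult_right_mono) auto
  also have "\<dots> \<le> GC r"
    using r c K_ge_1 mult_right_mono[of 1 r "1 + (1 + cc r) * (K - 1)"] by (simp add: GC_def)
  also have "1 + (1 + cc 1) * (K - 1) = (K - lam) / (1 - lam)"
    using lam by (simp add: cc_def field_simps)
  finally show "(K - lam) / (1 - lam) \<le> GC r" .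
  moreover have "1 \<le> (K - lam) / (1 - lam)" using lam K_ge_1 by simp
  ultimately show "1 \<le> GC r" by simp
  show "0 \<le> QC r" using r c K_ge_1 bt_le_1 by (simp add: QC_def)
qed

lemma qq_eq: "bt \<noteq> 1 \<Longrightarrow> qq r = GC r - bt * (r * (1 + (1 + cc r) * v1))"
  by (simp add: qq_def GC_def k1_def algebra_simps)

lemma qq_le: "1 \<le> r \<Longrightarrow> r < 1 / lam \<Longrightarrow> qq r \<le> QC r"
proof -
  assume r: "1 \<le> r" "r < 1 / lam"
  have "k1 \<le> K - 1" using v1_k1 mult_nonneg_nonneg[of bt v1] v1_nonneg bt_pos by linarith
  then show ?thesis
    unfolding qq_def QC_def using r cc_props[OF r] by (intro mult_left_mono add_left_mono) auto
qed

lemma max_lam: "lam / (1 - lam) \<le> max lam (K - lam) / (1 - lam)"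
  using lam by (intro divide_right_mono) auto

text \<open>Raising \<open>v1\<close> by one unit lowers \<open>k1\<close> by \<open>bt\<close>
  (compare \<open>qq_eq\<close>), while it adds once to the integrals under \<nu>. As
  \<open>D \<le> p * bt\<close>, the net factor \<open>1 - p * bt / D\<close> is nonpositive, and
  the terms in \<open>v1\<close> may be dropped. The other comparisons only enlarge, by
  \<open>K * r \<ge> 1\<close> or by the maximum.\<close>

lemma MM_le_MN:
  assumes r: "1 < r" "r < 1 / lam" and D: "DD r > 0" and bt1: "bt \<noteq> 1" and k: "\<kappa> \<ge> 0"
  shows "MM r \<kappa> \<le> MN r \<kappa>"
proof -
  have r1: "1 \<le> r" using r by simp
  define p D G where "p = pp r" and "D = DD r" and "G = r * (1 + (1 + cc r) * v1)"
  note c = cc_props[OF r1 r(2)]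
  have p: "p \<ge> 1" using pp_ge_1[OF r1] by (simp add: p_def)
  have D0: "D > 0" "D \<le> bt" using D DD_le[OF r1] by (auto simp: D_def)
  have G0: "G \<ge> 0" using r c v1_nonneg by (simp add: G_def)
  note GC = GC_ge[OF r1 r(2)]
  have pb: "D \<le> p * bt" using D0 p mult_right_mono[of 1 p bt] bt_pos by linarith
  have Kr: "1 \<le> K * r" using K_ge_1 r mult_mono[of 1 K 1 r] by simp
  have B3: "B3 r \<le> p * GC r / D"
  proof -
    have "B3 r = G + p * qq r / D" by (simp add: B3_def G_def p_def pp_def D_def algebra_simps)
    also have "\<dots> = p * GC r / D + G * (1 - p * bt / D)"
    proof -
      have "qq r = GC r - bt * G" by (simp only: qq_eq[OF bt1] G_def)
      then show ?thesis using D0 by (simp only:) (simp add: field_simps)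
    qed
    also have "G * (1 - p * bt / D) \<le> 0"
      using G0 pb D0 by (intro mult_nonneg_nonpos) auto
    finally show ?thesis by simp
  qed
  have t1: "cc r + qq r / D \<le> max (cc r) (GC r) + K * r * QC r / D"
  proof -
    have "qq r \<le> K * r * QC r" using qq_le[OF r1 r(2)] mult_right_mono[OF Kr GC(3)] by simp
    then have "qq r / D \<le> K * r * QC r / D" using D0 by (intro divide_right_mono) auto
    then show ?thesis by linarith
  qed
  define A where "A = bt * lam / (1 - lam) + (bt - D) / (r - 1)"
  define A' where "A' = bt * (max lam (K - lam) / (1 - lam)) + (bt - D) / (r - 1)"
  have A: "0 \<le> A" "A \<le> A'"
    using D0 bt_pos lam r mult_left_mono[OF max_lam, of bt] by (auto simp: A_def A'_def)
  have t2: "(bt / D * \<kappa> + A / D) * B3 r \<le> bt * p * (K * r) * GC r / D\<^sup>2 * \<kappa> + p * GC r / D\<^sup>2 * A'"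
  proof -
    have "(bt / D * \<kappa> + A / D) * B3 r \<le> (bt / D * \<kappa> + A / D) * (p * GC r / D)"
      using B3 bt_pos D0 k A by (intro mult_left_mono) auto
    also have "\<dots> = (bt * p * GC r / D\<^sup>2 * \<kappa>) * 1 + p * GC r / D\<^sup>2 * A"
      by (simp add: power2_eq_square algebra_simps)
    also have "\<dots> \<le> (bt * p * GC r / D\<^sup>2 * \<kappa>) * (K * r) + p * GC r / D\<^sup>2 * A'"
      using Kr A bt_pos p GC D0 k by (intro add_mono mult_left_mono) auto
    also have "(bt * p * GC r / D\<^sup>2 * \<kappa>) * (K * r) = bt * p * (K * r) * GC r / D\<^sup>2 * \<kappa>"
      by (simp add: mult_ac)
    finally show ?thesis .
  qed
  have t3: "r * dd r * v1 + p * (r * dd r * k1) / D \<le> p * (r * dd r * (K - 1)) / D"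
  proof -
    have k1: "k1 = K - 1 - bt * v1" using bt1 by (simp add: k1_def)
    have "r * dd r * v1 + p * (r * dd r * k1) / D = p * (r * dd r * (K - 1)) / D + (r * dd r * v1) * (1 - p * bt / D)"
      using D0 by (simp add: k1 field_simps)
    also have "(r * dd r * v1) * (1 - p * bt / D) \<le> 0"
      using pb D0 r dd_nonneg[OF r1 r(2)] v1_nonneg by (intro mult_nonneg_nonpos) auto
    finally show ?thesis by simp
  qed
  have t4: "qq 1 / bt * (r / (r - 1)) * (bt / D * p - 1) \<le> QC 1 * (r / (r - 1)) * (p / D - 1 / bt)"
  proof -
    have "qq 1 / bt * (r / (r - 1)) * (bt / D * p - 1) = qq 1 * ((r / (r - 1)) * (p / D - 1 / bt))"
      using bt_pos by (simp add: field_simps)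
    also have "\<dots> \<le> QC 1 * ((r / (r - 1)) * (p / D - 1 / bt))"
    proof (rule mult_right_mono)
      have "1 / bt \<le> p / D" using D0 pb bt_pos by (simp add: field_simps)
      then show "0 \<le> r / (r - 1) * (p / D - 1 / bt)" using r by simp
    qed (use qq_le one_less_inv_lam in auto)
    finally show ?thesis by (simp add: mult.assoc)
  qed
  show ?thesis
    using t1 t2 t3 t4 unfolding MM_def MN_def A_def A'_def p_def D_def by linarith
qed

text \<open>Serves time 0: \<open>GC r\<close> alone exceeds \<open>(K - lam) / (1 - lam)\<close>,
  and the term with \<kappa> supplies the remaining 1.\<close>

lemma MN_ge:
  assumes r: "1 < r" "r < 1 / lam" and D: "DD r > 0" and k: "\<kappa> \<ge> 1"
  shows "1 + (K - lam) / (1 - lam) \<le> MN r \<kappa>"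
proof -
  have r1: "1 \<le> r" using r by simp
  note c = cc_props[OF r1 r(2)] and GC = GC_ge[OF r1 r(2)] and p = pp_ge_1[OF r1]
  have D0: "DD r \<le> bt" "DD r \<le> 1" using DD_le[OF r1] bt_le_1 by auto
  have Kr: "1 \<le> K * r" using K_ge_1 r mult_mono[of 1 K 1 r] by simp
  have "1 \<le> bt * pp r * (K * r) * GC r / (DD r)\<^sup>2 * \<kappa>"
  proof -
    have "1 \<le> bt / DD r" "1 \<le> pp r / DD r" using D0 D p by (auto simp: field_simps)
    then have "1 * 1 * 1 * 1 * 1 \<le> (bt / DD r) * (pp r / DD r) * (K * r) * GC r * \<kappa>"
      using Kr GC k D bt_pos p by (intro mult_mono) auto
    then show ?thesis by (simp add: power2_eq_square mult_ac)
  qed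
  moreover have "0 \<le> K * r * QC r / DD r" using Kr GC D by simp
  moreover have "0 \<le> pp r * GC r / (DD r)\<^sup>2 * (bt * (max lam (K - lam) / (1 - lam)) + (bt - DD r) / (r - 1))"
    using p GC D0 bt_pos lam r by (intro mult_nonneg_nonneg add_nonneg_nonneg divide_nonneg_nonneg) auto
  moreover have "0 \<le> pp r * (r * dd r * (K - 1)) / DD r"
    using p r dd_nonneg[OF r1 r(2)] K_ge_1 D by simp
  moreover have "0 \<le> QC 1 * (r / (r - 1)) * (pp r / DD r - 1 / bt)"
  proof -
    have "DD r \<le> pp r * bt" using D0 p mult_right_mono[of 1 "pp r" bt] bt_pos by linarith
    then have "1 / bt \<le> pp r / DD r" using D bt_pos by (simp add: field_simps)
    then show ?thesis using GC_ge(3)[OF order_refl one_less_inv_lam] r by simp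
  qed
  ultimately show ?thesis using GC(1) unfolding MN_def by linarith
qed

text \<open>With \<open>bt = 1\<close> the residual quantities \<open>k1\<close> and
  \<open>qq\<close> vanish. \<open>MM\<close> is then increasing in \<open>v1\<close>, and
  \<open>v1 \<le> K - 1\<close> finishes the comparison.\<close>

lemma MM_le_MA:
  assumes r: "1 < r" "r < 1 / lam" and bt1: "bt = 1" and k: "\<kappa> \<ge> 0"
  shows "MM r \<kappa> \<le> MA r \<kappa>"
proof -
  have r1: "1 \<le> r" using r by simp
  note c = cc_props[OF r1 r(2)] and GC = GC_ge[OF r1 r(2)]
  have z: "DD r = 1" "k1 = 0" "qq r = 0" "qq 1 = 0"
    unfolding DD_def k1_def qq_def using bt1 by simp_all
  have v: "v1 \<le> K - 1" using v1_k1 z bt1 by simp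
  have Kr: "1 \<le> K * r" using K_ge_1 r mult_mono[of 1 K 1 r] by simp
  have B3: "B3 r \<le> GC r"
    unfolding B3_def GC_def z using r c v by (simp add: mult_left_mono add.commute)
  have "(\<kappa> + lam / (1 - lam)) * B3 r \<le> (\<kappa> + lam / (1 - lam)) * GC r"
    using B3 k lam by (intro mult_left_mono) auto
  also have "\<dots> = 1 * (GC r * \<kappa>) + GC r * (lam / (1 - lam))" by (simp add: algebra_simps)
  also have "\<dots> \<le> K * r * (GC r * \<kappa>) + GC r * (max lam (K - lam) / (1 - lam))"
    using Kr GC k max_lam by (intro add_mono mult_right_mono mult_left_mono) auto
  finally have t2: "(\<kappa> + lam / (1 - lam)) * B3 r \<le> K * r * GC r * \<kappa> + GC r * (max lam (K - lam) / (1 - lam))"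
    by (simp add: mult_ac)
  have t3: "r * dd r * v1 \<le> r * dd r * (K - 1)"
    using v r dd_nonneg[OF r1 r(2)] by (intro mult_left_mono) auto
  have "MM r \<kappa> = cc r + (\<kappa> + lam / (1 - lam)) * B3 r + r * dd r * v1"
    unfolding MM_def z using bt1 by simp
  then show ?thesis using t2 t3 unfolding MA_def by linarith
qed

lemma MA_ge:
  assumes r: "1 < r" "r < 1 / lam" and k: "\<kappa> \<ge> 1"
  shows "1 + (K - lam) / (1 - lam) \<le> MA r \<kappa>"
proof -
  have r1: "1 \<le> r" using r by simp
  note GC = GC_ge[OF r1 r(2)]
  have Kr: "1 \<le> K * r" using K_ge_1 r mult_mono[of 1 K 1 r] by simp
  have "1 * 1 * 1 \<le> K * r * GC r * \<kappa>" using Kr GC k by (intro mult_mono) auto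
  moreover have "0 \<le> GC r * (max lam (K - lam) / (1 - lam))" using GC lam by (intro mult_nonneg_nonneg) auto
  moreover have "0 \<le> r * dd r * (K - 1)" using r dd_nonneg[OF r1 r(2)] K_ge_1 by simp
  ultimately show ?thesis using GC(1) unfolding MA_def by linarith
qed

lemma GC_gamma: "0 < \<gamma> \<Longrightarrow> lam < \<gamma> \<Longrightarrow> GC (1 / \<gamma>) = (K - lam / \<gamma>) / (\<gamma> - lam)"
  by (simp add: GC_def cc_def field_simps)

lemma cc_gamma: "0 < \<gamma> \<Longrightarrow> lam < \<gamma> \<Longrightarrow> cc (1 / \<gamma>) = lam / (\<gamma> - lam)"
  by (simp add: cc_def field_simps)

lemma dd_gamma: "0 < \<gamma> \<Longrightarrow> lam < \<gamma> \<Longrightarrow> 1 / \<gamma> * dd (1 / \<gamma>) = lam / ((\<gamma> - lam) * (1 - lam))"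
  by (simp add: dd_def cc_def divide_simps)

lemma max_gamma:
  assumes "0 < \<gamma>" "lam < \<gamma>"
  shows "max (cc (1 / \<gamma>)) (GC (1 / \<gamma>)) = max lam (K - lam / \<gamma>) / (\<gamma> - lam)"
  using assms by (simp add: GC_gamma cc_gamma max_divide_distrib_right)

text \<open>For \<open>lam < \<gamma> < 1\<close> every denominator is nonzero, so the extended-real
  expression is a real number; this yields the finiteness of the constant.\<close>

lemma M_at_eq:
  assumes g: "lam < \<gamma>" "\<gamma> < 1"
  shows "M_at lam K \<gamma> \<kappa> = ereal (MA (1 / \<gamma>) \<kappa>)"
proof -
  have g0: "0 < \<gamma>" "\<gamma> - lam \<noteq> 0" "1 - lam \<noteq> 0" "\<gamma> \<noteq> 0" using g lam by auto
  have "M_at lam K \<gamma> \<kappa> = ereal (max lam (K - lam / \<gamma>) / (\<gamma> - lam)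
    + K * (K - lam / \<gamma>) / (\<gamma> * (\<gamma> - lam)) * \<kappa>
    + (K - lam / \<gamma>) * max lam (K - lam) / ((\<gamma> - lam) * (1 - lam))
    + lam * (K - 1) / ((\<gamma> - lam) * (1 - lam)))"
    unfolding M_at_def using g0 by (simp del: ereal_max)
  also have "\<dots> = ereal (MA (1 / \<gamma>) \<kappa>)"
  proof -
    have "1 / \<gamma> * dd (1 / \<gamma>) * (K - 1) = lam * (K - 1) / ((\<gamma> - lam) * (1 - lam))"
      by (simp only: dd_gamma[OF g0(1) g(1)]) simp
    then show ?thesis
      unfolding MA_def max_gamma[OF g0(1) g(1)] unfolding GC_gamma[OF g0(1) g(1)] by simp
  qed
  finally show ?thesis .
qed

lemma M_non_eq:
  assumes g: "lam < \<gamma>" "\<gamma> < 1" and D: "DD (1 / \<gamma>) > 0" and a2: "a2 = 1 + ln Kt / ln (1 / lam)"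
  shows "M_non bt lam K a2 \<gamma> \<kappa> = ereal (MN (1 / \<gamma>) \<kappa>)"
proof -
  have g0: "0 < \<gamma>" "\<gamma> - lam \<noteq> 0" "1 - lam \<noteq> 0" "\<gamma> \<noteq> 0" "1 - \<gamma> \<noteq> 0" "1 / \<gamma> - 1 \<noteq> 0" using g lam by auto
  define r D p where "r = 1 / \<gamma>" and "D = DD r" and "p = pp r"
  have r0: "r > 0" using g0 by (simp add: r_def)
  have D0: "D > 0" using D by (simp add: D_def r_def)
  have pw: "\<gamma> powr (- a) = r powr a" for a
    using g0 by (simp add: r_def powr_minus powr_divide field_simps)
  have D_eq: "1 - (1 - bt) * \<gamma> powr (- alpha1 bt lam K) = D"
    by (simp add: pw D_def DD_def)
  have p_eq: "\<gamma> powr (- a2) = p"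
  proof -
    have "\<gamma> powr (- a2) = r powr a2" by (rule pw)
    also have "\<dots> = p" using r0 by (simp add: p_def pp_def mm_def a2 powr_add)
    finally show ?thesis .
  qed
  have p1: "\<gamma> powr (- a2 - 1) = p / \<gamma>" using g0 by (simp add: powr_diff p_eq)
  have p2: "\<gamma> powr (- a2 - 2) = p / \<gamma>\<^sup>2" using g0 by (simp add: powr_diff p_eq powr_numeral)
  have a1: "(1 - bt) * (\<gamma> powr (- alpha1 bt lam K) - 1) = bt - D"
    by (simp add: D_def DD_def pw algebra_simps)
  have "M_non bt lam K a2 \<gamma> \<kappa> = ereal (max lam (K - lam / \<gamma>) / (\<gamma> - lam)
   + K * (K * \<gamma> - lam - bt * (\<gamma> - lam)) / (\<gamma>\<^sup>2 * (\<gamma> - lam) * D)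
   + bt * (p / \<gamma>\<^sup>2) * K * (K * \<gamma> - lam) / ((\<gamma> - lam) * D\<^sup>2) * \<kappa>
   + p / \<gamma> * (K * \<gamma> - lam) / ((\<gamma> - lam) * D\<^sup>2)
     * (bt * max lam (K - lam) / (1 - lam) + (bt - D) / (1 / \<gamma> - 1))
   + p * lam * (K - 1) / ((1 - lam) * (\<gamma> - lam) * D)
   + (K - lam - bt * (1 - lam)) / ((1 - lam) * (1 - \<gamma>) * D) * ((p - 1) + (bt - D) / bt))"
    unfolding M_non_def Let_def D_eq p_eq p1 p2 a1 using g0 D0 bt_pos
    by (simp del: ereal_max)
  also have "\<dots> = ereal (MN (1 / \<gamma>) \<kappa>)"
  proof -
    have QC1: "QC 1 = (K - lam - bt * (1 - lam)) / (1 - lam)"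
      using g0 by (simp add: QC_def cc_def field_simps)
    have e2: "K * (K * \<gamma> - lam - bt * (\<gamma> - lam)) / (\<gamma>\<^sup>2 * (\<gamma> - lam) * D) = K * r * QC r / D"
    proof -
      have "QC r = (K * \<gamma> - lam - bt * (\<gamma> - lam)) / (\<gamma> * (\<gamma> - lam))"
        using g0 by (simp add: QC_def cc_def r_def field_simps)
      then show ?thesis using g0 by (simp add: r_def power2_eq_square)
    qed
    have GCr: "GC r = (K * \<gamma> - lam) / (\<gamma> * (\<gamma> - lam))"
      using g0 by (simp add: GC_gamma[OF g0(1) g(1)] r_def field_simps)
    have e3: "bt * (p / \<gamma>\<^sup>2) * K * (K * \<gamma> - lam) / ((\<gamma> - lam) * D\<^sup>2) * \<kappa> = bt * p * (K * r) * GC r / D\<^sup>2 * \<kappa>"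
      unfolding GCr using g0 by (simp add: r_def power2_eq_square)
    have e4: "p / \<gamma> * (K * \<gamma> - lam) / ((\<gamma> - lam) * D\<^sup>2) * (bt * max lam (K - lam) / (1 - lam) + (bt - D) / (1 / \<gamma> - 1))
        = p * GC r / D\<^sup>2 * (bt * (max lam (K - lam) / (1 - lam)) + (bt - D) / (r - 1))"
      unfolding GCr using g0 by (simp add: r_def)
    have e5: "p * lam * (K - 1) / ((1 - lam) * (\<gamma> - lam) * D) = p * (r * dd r * (K - 1)) / D"
      using dd_gamma[OF g0(1) g(1)] by (simp add: r_def mult_ac)
    have e6: "(K - lam - bt * (1 - lam)) / ((1 - lam) * (1 - \<gamma>) * D) * ((p - 1) + (bt - D) / bt) =
        QC 1 * (r / (r - 1)) * (p / D - 1 / bt)"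
    proof -
      have "r / (r - 1) = 1 / (1 - \<gamma>)" using g0 by (simp add: r_def field_simps)
      moreover have "p / D - 1 / bt = ((p - 1) + (bt - D) / bt) / D" using D0 bt_pos by (simp add: field_simps)
      ultimately show ?thesis unfolding QC1 by simp
    qed
    show ?thesis
      unfolding e2 e3 e4 e5 e6 MN_def max_gamma[OF g0(1) g(1)] by (simp only: r_def D_def p_def)
  qed
  finally show ?thesis .
qed

section \<open>The radius R_2\<close>

lemma bgen_le:
  assumes "1 \<le> r" "r \<le> 1 / lam" "DD r > 0"
  shows "bgen r \<le> bt * pp r / DD r"
  using hit_mass(2)[OF assms] assms(1) mult_right_mono[of "\<Sum>k. r ^ k * (bt * cn k (indicator C))" "bt / DD r * mm r" r]
  by (simp add: bgen_def pp_def mult_ac)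

text \<open>\<open>bgen r / r\<close> is nondecreasing, having nonnegative coefficients, while
  \<open>(1 + 2 * b * r) / r\<close> strictly decreases. A weak inequality at \<open>z\<close> is
  thus strict at every smaller \<open>r\<close>.\<close>

lemma bgen_good:
  assumes z: "1 \<le> z" "z \<le> 1 / lam" "DD z > 0" "bgen z \<le> 1 + 2 * b * z" and r: "0 < r" "r < z"
  shows "bgen r < 1 + 2 * b * r"
proof -
  have sm: "summable (\<lambda>k. z ^ k * (bt * cn k (indicator C)))" by (rule hit_mass(1)[OF z(1-3)])
  have le: "r ^ k * (bt * cn k (indicator C)) \<le> z ^ k * (bt * cn k (indicator C))" for k
    using r bt_pos by (intro mult_right_mono power_mono) auto
  have smr: "summable (\<lambda>k. r ^ k * (bt * cn k (indicator C)))"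
    by (rule summable_comparison_test'[OF sm]) (use le r bt_pos in auto)
  have "bgen r \<le> r / z * bgen z"
    unfolding bgen_def using suminf_le[OF le smr sm] r z by (simp add: mult.commute mult_right_mono)
  also have "\<dots> \<le> r / z * (1 + 2 * b * z)" using z r by (intro mult_left_mono) auto
  also have "\<dots> = r / z + 2 * b * r" using z by (simp add: field_simps)
  also have "r / z < 1" using r z by simp
  finally show ?thesis by simp
qed

text \<open>\<open>Z\<close> is \<open>1 / lam\<close> if \<open>C\<close> is an atom and \<open>R_0\<close> otherwise.\<close>
lemma radius_Sup:
  assumes Z: "1 < Z" "Z \<le> 1 / lam" and D: "\<And>r. 1 \<le> r \<Longrightarrow> r < Z \<Longrightarrow> DD r > 0" and b: "b > 0"
    and R: "R = Sup {r. 0 < r \<and> r < Z \<and> Q r}"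
    and Q: "\<And>r. 1 \<le> r \<Longrightarrow> r < Z \<Longrightarrow> Q r \<longleftrightarrow> bt * pp r / DD r < 1 + 2 * b * r"
  shows "1 < R" "R \<le> Z" "\<And>r. 1 < r \<Longrightarrow> r < R \<Longrightarrow> bgen r < 1 + 2 * b * r"
proof -
  define X where "X = {r. 0 < r \<and> r < Z \<and> Q r}"
  have RX: "R = Sup X" by (simp add: R X_def)
  have bdd: "bdd_above X" unfolding X_def by (rule bdd_aboveI[of _ Z]) auto
  have D1p: "DD 1 \<noteq> 0" using D1 by simp
  \<comment> \<open>At \<open>r = 1\<close> the quotient is 1 and the difference is
    \<open>2 * b > 0\<close>, so by continuity \<open>X\<close> reaches beyond 1.\<close>
  have "isCont (\<lambda>r. 1 + 2 * b * r - bt * pp r / DD r) 1"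
    unfolding pp_def mm_def DD_def using D1p[unfolded DD_def] by (intro continuous_intros) auto
  moreover have "1 + 2 * b * 1 - bt * pp 1 / DD 1 > 0"
    using b bt_pos by (simp add: DD_1 pp_def mm_def)
  ultimately have "eventually (\<lambda>r. 1 + 2 * b * r - bt * pp r / DD r > 0) (at 1)"
    unfolding isCont_def by (intro order_tendstoD(1)) auto
  then have "eventually (\<lambda>r. 1 + 2 * b * r - bt * pp r / DD r > 0) (at_right 1)"
    by (simp add: eventually_at_split)
  moreover have "eventually (\<lambda>r. r \<in> {1<..<Z}) (at_right 1)"
    using Z by (intro eventually_at_rightI[of 1 Z]) auto
  ultimately have "eventually (\<lambda>r. r \<in> {1<..<Z} \<and> 1 + 2 * b * r - bt * pp r / DD r > 0) (at_right 1)"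
    by (rule eventually_conj[rotated])
  then obtain r where "r \<in> {1<..<Z} \<and> 1 + 2 * b * r - bt * pp r / DD r > 0"
    using eventually_happens[of _ "at_right (1 :: real)"] trivial_limit_at_right_real by blast
  then have r: "1 < r" "r \<in> X" using Q[of r] by (auto simp: X_def)
  then have "r \<le> R" unfolding RX by (intro cSup_upper bdd)
  then show "1 < R" using r by simp
  show "R \<le> Z" unfolding RX using r by (intro cSup_least) (auto simp: X_def)
  fix t assume t: "1 < t" "t < R"
  \<comment> \<open>One element of \<open>X\<close> above \<open>t\<close> is enough:
    \<open>bgen_good\<close> carries its inequality down to \<open>t\<close>, whether or not
    \<open>X\<close> is an interval.\<close>
  then obtain s where s: "s \<in> X" "t < s" using less_cSup_iff[of X t] r bdd unfolding RX by auto
  then have s': "1 \<le> s" "s \<le> 1 / lam" "DD s > 0" "s < Z" "Q s" using t Z D by (auto simp: X_def)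
  have "bgen s \<le> bt * pp s / DD s" using s' by (intro bgen_le) auto
  also have "\<dots> < 1 + 2 * b * s" using Q[of s] s' by simp
  finally show "bgen t < 1 + 2 * b * t"
    using s' s t by (intro bgen_good[of s]) auto
qed

lemma radius_end:
  assumes Z: "1 < Z" "Z \<le> 1 / lam" and D: "DD Z > 0" and le: "bt * pp Z / DD Z \<le> 1 + 2 * b * Z"
    and t: "1 < t" "t < Z"
  shows "bgen t < 1 + 2 * b * t"
proof (rule bgen_good[of Z])
  have "bgen Z \<le> bt * pp Z / DD Z" using Z D by (intro bgen_le) auto
  then show "bgen Z \<le> 1 + 2 * b * Z" using le by simp
qed (use Z D t in auto)

lemma R2_at_props:
  assumes bt1: "bt = 1" and Kt: "Kt = K" and b: "b > 0"
  shows "1 < R2_at b lam K" "R2_at b lam K \<le> 1 / lam"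
    "\<And>r. 1 < r \<Longrightarrow> r < R2_at b lam K \<Longrightarrow> bgen r < 1 + 2 * b * r"
proof -
  have D: "DD r = 1" for r unfolding DD_def using bt1 by simp
  have pw: "r powr (1 + ln K / ln (1 / lam)) = pp r" if "r > 0" for r
    unfolding pp_def mm_def unfolding Kt using that by (simp add: powr_add)
  have "1 < R2_at b lam K \<and> R2_at b lam K \<le> 1 / lam \<and> (\<forall>r. 1 < r \<longrightarrow> r < R2_at b lam K \<longrightarrow> bgen r < 1 + 2 * b * r)"
  proof (cases "K > lam + 2 * b")
    case True
    then have R: "R2_at b lam K = Sup {r. 0 < r \<and> r < 1 / lam \<and> 1 + 2 * b * r > r powr (1 + ln K / ln (1 / lam))}"
      by (simp add: R2_at_def)
    have Q: "1 + 2 * b * r > r powr (1 + ln K / ln (1 / lam)) \<longleftrightarrow> bt * pp r / DD r < 1 + 2 * b * r" if "1 \<le> r" for r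
    proof -
      have "bt * pp r / DD r = pp r" by (simp only: D) (simp add: bt1)
      then show ?thesis using that by (simp add: pw)
    qed
    show ?thesis
      using radius_Sup[OF one_less_inv_lam order_refl _ b R Q] D by auto
  next
    case False
    then have R: "R2_at b lam K = 1 / lam" by (simp add: R2_at_def)
    \<comment> \<open>Hence \<open>pp (1 / lam) = K / lam\<close>, and
      \<open>K \<le> lam + 2 * b\<close> is precisely the inequality at the endpoint
      \<open>1 / lam\<close>.\<close>
    have "(1 / lam) powr (ln K / ln (1 / lam)) = K"
      using K_ge_1 ln_lam lam by (simp add: powr_def)
    then have "pp (1 / lam) = 1 / lam * K" unfolding pp_def mm_def unfolding Kt by simp
    also have "\<dots> \<le> 1 + 2 * b * (1 / lam)" using False lam by (simp add: field_simps)
    finally have "pp (1 / lam) \<le> 1 + 2 * b * (1 / lam)" .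
    moreover have "bt * pp (1 / lam) / DD (1 / lam) = pp (1 / lam)" by (simp only: D) (simp add: bt1)
    ultimately have "bt * pp (1 / lam) / DD (1 / lam) \<le> 1 + 2 * b * (1 / lam)" by simp
    then show ?thesis
      unfolding R using radius_end[of "1 / lam" b] one_less_inv_lam D by simp
  qed
  then show "1 < R2_at b lam K" "R2_at b lam K \<le> 1 / lam"
    "\<And>r. 1 < r \<Longrightarrow> r < R2_at b lam K \<Longrightarrow> bgen r < 1 + 2 * b * r" by auto
qed

lemma R0_props:
  assumes bt1: "bt < 1"
  shows "1 < R0 bt lam K" "R0 bt lam K \<le> 1 / lam" "DD (R0 bt lam K) \<ge> 0"
    "\<And>r. 0 < r \<Longrightarrow> r < R0 bt lam K \<Longrightarrow> DD r > 0"
proof -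
  define \<alpha> where "\<alpha> = alpha1 bt lam K"
  \<comment> \<open>\<open>Z\<close> is the zero of \<open>DD\<close>, which decreases because
    \<open>\<alpha> \<ge> 1\<close>. So \<open>DD\<close> is positive below \<open>R0\<close> but
    may vanish at \<open>R0\<close> itself, where \<open>L_fun\<close> is then infinite.\<close>
  define Z where "Z = (1 - bt) powr (- 1 / \<alpha>)"
  have R0: "R0 bt lam K = min (1 / lam) Z" by (simp add: R0_def Z_def \<alpha>_def)
  have "(K - bt) / (1 - bt) \<ge> 1" using bt1 K_ge_1 by simp
  then have a: "\<alpha> \<ge> 1" using ln_lam by (simp add: \<alpha>_def alpha1_def)
  have Za: "Z powr \<alpha> = 1 / (1 - bt)" using a bt1 by (simp only: Z_def powr_powr) (simp add: powr_minus_divide)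
  have "1 < 1 / (1 - bt)" using bt1 bt_pos by simp
  then have Z_gt: "1 < Z powr \<alpha>" by (simp add: Za)
  have "1 < Z"
  proof (rule ccontr)
    assume "\<not> 1 < Z"
    then have "Z powr \<alpha> \<le> 1" using a by (intro powr_le1) (auto simp: Z_def)
    then show False using Z_gt by simp
  qed
  then show R1: "1 < R0 bt lam K" using one_less_inv_lam by (simp add: R0)
  show "R0 bt lam K \<le> 1 / lam" by (simp add: R0)
  have "R0 bt lam K powr \<alpha> \<le> Z powr \<alpha>" using R1 a lam by (intro powr_mono2) (auto simp: R0)
  then have "(1 - bt) * R0 bt lam K powr \<alpha> \<le> (1 - bt) * (1 / (1 - bt))"
    unfolding Za using bt1 by (intro mult_left_mono) auto
  then show "DD (R0 bt lam K) \<ge> 0" using bt1 by (simp add: DD_def \<alpha>_def)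
  fix r assume r: "0 < r" "r < R0 bt lam K"
  have "r powr \<alpha> < Z powr \<alpha>" using r a by (intro powr_less_mono2) (auto simp: R0)
  then have "(1 - bt) * r powr \<alpha> < (1 - bt) * (1 / (1 - bt))"
    unfolding Za using bt1 by (intro mult_strict_left_mono) auto
  then show "DD r > 0" using bt1 by (simp add: DD_def \<alpha>_def)
qed

lemma R2_non_props:
  assumes bt1: "bt < 1" and a2: "a2 = 1 + ln Kt / ln (1 / lam)" and b: "b > 0"
  shows "1 < R2_non b bt lam K a2" "R2_non b bt lam K a2 \<le> R0 bt lam K"
    "\<And>r. 1 < r \<Longrightarrow> r < R2_non b bt lam K a2 \<Longrightarrow> bgen r < 1 + 2 * b * r"
proof -
  note R0 = R0_props[OF bt1]
  have pw: "r powr a2 = pp r" if "r > 0" for r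
    using that by (simp add: pp_def mm_def powr_add a2)
  have L: "L_fun bt lam K a2 r = ereal (bt * pp r / DD r)" if "DD r \<noteq> 0" "r > 0" for r
    using that by (simp add: L_fun_def Let_def DD_def[symmetric] pw)
  have "1 < R2_non b bt lam K a2 \<and> R2_non b bt lam K a2 \<le> R0 bt lam K \<and>
    (\<forall>r. 1 < r \<longrightarrow> r < R2_non b bt lam K a2 \<longrightarrow> bgen r < 1 + 2 * b * r)"
  proof (cases "L_fun bt lam K a2 (R0 bt lam K) > ereal (1 + 2 * b * R0 bt lam K)")
    case True
    then have R: "R2_non b bt lam K a2 = Sup {r. 0 < r \<and> r < R0 bt lam K \<and> ereal (1 + 2 * b * r) > L_fun bt lam K a2 r}"
      by (simp add: R2_non_def)
    have Q: "ereal (1 + 2 * b * r) > L_fun bt lam K a2 r \<longleftrightarrow> bt * pp r / DD r < 1 + 2 * b * r"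
      if "1 \<le> r" "r < R0 bt lam K" for r
      using that R0(4)[of r] by (subst L) auto
    show ?thesis
      using radius_Sup[OF R0(1,2) _ b R Q] R0(4) by auto
  next
    case False
    then have R: "R2_non b bt lam K a2 = R0 bt lam K" by (simp add: R2_non_def)
    have "DD (R0 bt lam K) \<noteq> 0"
    proof
      assume "DD (R0 bt lam K) = 0"
      then have "L_fun bt lam K a2 (R0 bt lam K) = \<infinity>" by (simp add: L_fun_def Let_def DD_def[symmetric])
      then show False using False by simp
    qed
    then have D: "DD (R0 bt lam K) > 0" using R0(3) by simp
    then have "bt * pp (R0 bt lam K) / DD (R0 bt lam K) \<le> 1 + 2 * b * R0 bt lam K"
      using False R0(1) by (simp add: L)
    then show ?thesis
      unfolding R using radius_end[OF R0(1,2) D] R0(1) by simp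
  qed
  then show "1 < R2_non b bt lam K a2" "R2_non b bt lam K a2 \<le> R0 bt lam K"
    "\<And>r. 1 < r \<Longrightarrow> r < R2_non b bt lam K a2 \<Longrightarrow> bgen r < 1 + 2 * b * r" by auto
qed

end

context reversible_drift
begin

text \<open>Common to both cases, with \<open>m\<close> standing for either explicit constant: the
  first bound in \<open>M\<close> serves \<open>n \<ge> 1\<close>, the second
  \<open>n = 0\<close>.\<close>

lemma rate_bound:
  assumes R: "1 < R" "R \<le> 1 / lam" "\<And>r. 1 < r \<Longrightarrow> r < R \<Longrightarrow> DD r > 0"
    and b: "\<And>r. 1 < r \<Longrightarrow> r < R \<Longrightarrow> bgen r < 1 + 2 * \<beta> * r"
    and g: "1 / R < \<gamma>" "\<gamma> < 1"
    and M: "MM (1 / \<gamma>) (1 + sqrt bt / (\<gamma> - 1 / R)) \<le> m" "1 + (K - lam) / (1 - lam) \<le> m"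
    and x: "x \<in> space S"
  shows "(SUP g\<in>{g \<in> borel_measurable S. \<forall>y\<in>space S. \<bar>g y\<bar> \<le> V y}.
      ereal \<bar>kernel_op (kernel_pow S P n) g x - (\<integral>y. g y \<partial>\<pi>)\<bar>) \<le> ereal m * ereal (V x * \<gamma> ^ n)"
proof (rule SUP_least)
  fix g assume "g \<in> {g \<in> borel_measurable S. \<forall>y\<in>space S. \<bar>g y\<bar> \<le> V y}"
  then have gm: "g \<in> borel_measurable S" and gV: "\<And>y. y \<in> space S \<Longrightarrow> \<bar>g y\<bar> \<le> V y" by auto
  have g0: "0 < \<gamma>" using g R by (smt (verit) zero_less_divide_1_iff)
  define r where "r = 1 / \<gamma>"
  have r: "1 < r" "r < R" using g g0 R by (auto simp: r_def field_simps)
  have rl: "r < 1 / lam" using r R by simp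
  note Vx = V_ge_1[OF x]
  have "\<bar>kernel_op (kernel_pow S P n) g x - (\<integral>y. g y \<partial>\<pi>)\<bar> \<le> m * (V x * \<gamma> ^ n)"
  proof (cases n)
    case 0
    have "\<bar>kernel_op (kernel_pow S P 0) g x - (\<integral>y. g y \<partial>\<pi>)\<bar> \<le> (1 + (K - lam) / (1 - lam)) * V x"
      by (rule initial_bound[OF st x gm gV])
    also have "\<dots> \<le> m * V x" using M(2) Vx by (intro mult_right_mono) auto
    finally show ?thesis using 0 by simp
  next
    case (Suc j)
    note rs = renewal_error_sum[OF R(2,3,1) b r]
    have "1 / r = \<gamma>" by (simp add: r_def)
    then have rs2: "(\<Sum>j. r ^ j * \<bar>un j - 1 / mass\<bar>) \<le> 1 + sqrt bt / (\<gamma> - 1 / R)"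
      using rs(2) by (simp only:)
    have "r ^ n * \<bar>kernel_op (kernel_pow S P n) g x - (\<integral>y. g y \<partial>\<pi>)\<bar> \<le> MM r (1 + sqrt bt / (\<gamma> - 1 / R)) * V x"
      unfolding Suc by (rule geometric_bound[OF r(1) rl R(3)[OF r] st x rs(1) rs2 gm gV])
    also have "\<dots> \<le> m * V x" using M(1) Vx by (intro mult_right_mono) (auto simp: r_def)
    finally have "\<gamma> ^ n * (r ^ n * \<bar>kernel_op (kernel_pow S P n) g x - (\<integral>y. g y \<partial>\<pi>)\<bar>) \<le> \<gamma> ^ n * (m * V x)"
      using g0 by (intro mult_left_mono) auto
    moreover have "\<gamma> ^ n * r ^ n = 1" using g0 by (simp add: r_def power_mult_distrib[symmetric])
    ultimately show ?thesis by (simp add: mult.assoc[symmetric]) (simp add: mult_ac)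
  qed
  then show "ereal \<bar>kernel_op (kernel_pow S P n) g x - (\<integral>y. g y \<partial>\<pi>)\<bar> \<le> ereal m * ereal (V x * \<gamma> ^ n)"
    by simp
qed

end

context drift_kernel
begin

lemma stationary_ex1: "\<exists>!\<pi>. stationary S P \<pi>"
  using stationary_exists stationary_unique by blast

lemma integrable_weighted:
  assumes st: "stationary S P \<pi>" and g: "g \<in> borel_measurable S" and bdd: "bdd_above ((\<lambda>x. \<bar>g x\<bar> / V x) ` space S)"
  shows "integrable \<pi> g \<and> (\<forall>n. \<forall>x\<in>space S. integrable (kernel_pow S P n x) g)"
proof -
  obtain c where c: "\<And>x. x \<in> space S \<Longrightarrow> \<bar>g x\<bar> / V x \<le> c" using bdd by (auto simp: bdd_above_def)
  have gV: "\<bar>g y\<bar> \<le> c * V y" if "y \<in> space S" for y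
    using c[OF that] V_ge_1[OF that] by (simp add: pos_divide_le_eq)
  show ?thesis
    using integrable_dominated[OF _ g gV] sets_stationary[OF st] stationary_V_finite[OF st] sets_Pn kernel_pow_V_finite
    by blast
qed

end

theorem theorem1p2:
  fixes S :: "'a measure" and P :: "'a \<Rightarrow> 'a measure" and C :: "'a set" and \<nu> :: "'a measure"
    and V :: "'a \<Rightarrow> real" and bt \<beta> lam K a2 :: real
  assumes kernel: "P \<in> S \<rightarrow>\<^sub>M prob_algebra S"
    and A1: "minorization S P C bt \<nu>"
    and A2: "drift S P C V lam K"
    and A3: "strong_aperiodicity C bt \<nu> \<beta>"
    and atom: "is_atom P C \<Longrightarrow> bt = 1 \<and> (\<forall>x\<in>C. \<nu> = P x)"
    and non_atom: "\<not> is_atom P C \<Longrightarrow> bt < 1"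
    and alpha2: "\<not> is_atom P C \<Longrightarrow> alpha2_admissible S C V \<nu> bt lam K a2"
  shows "(\<exists>!\<pi>. stationary S P \<pi>) \<and>
    (\<forall>\<pi>. stationary S P \<pi> \<longrightarrow>
      (\<integral>\<^sup>+x. ennreal (V x) \<partial>\<pi>) < \<infinity> \<and>
      (reversible P \<pi> \<longrightarrow>
        rho P C \<beta> bt lam K a2 < 1 \<and>
        (\<forall>\<gamma>. rho P C \<beta> bt lam K a2 < \<gamma> \<and> \<gamma> < 1 \<longrightarrow>
          M_const P C \<beta> bt lam K a2 \<gamma> < \<infinity> \<and>
          (\<forall>x\<in>space S. \<forall>n.
            (SUP g\<in>{g \<in> borel_measurable S. \<forall>y\<in>space S. \<bar>g y\<bar> \<le> V y}.
               ereal \<bar>kernel_op (kernel_pow S P n) g x - (\<integral>y. g y \<partial>\<pi>)\<bar>)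
            \<le> M_const P C \<beta> bt lam K a2 \<gamma> * ereal (V x * \<gamma> ^ n))) \<and>
        (\<forall>g\<in>borel_measurable S. bdd_above ((\<lambda>x. \<bar>g x\<bar> / V x) ` space S) \<longrightarrow>
          integrable \<pi> g \<and> (\<forall>n. \<forall>x\<in>space S. integrable (kernel_pow S P n x) g))))"
proof -
  let ?claim = "\<lambda>\<pi> \<gamma>. M_const P C \<beta> bt lam K a2 \<gamma> < \<infinity> \<and>
          (\<forall>x\<in>space S. \<forall>n.
            (SUP g\<in>{g \<in> borel_measurable S. \<forall>y\<in>space S. \<bar>g y\<bar> \<le> V y}.
               ereal \<bar>kernel_op (kernel_pow S P n) g x - (\<integral>y. g y \<partial>\<pi>)\<bar>)
            \<le> M_const P C \<beta> bt lam K a2 \<gamma> * ereal (V x * \<gamma> ^ n))"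
  have bt_le: "bt \<le> 1" using atom non_atom by fastforce
  interpret mk: minorized_kernel S P C bt \<nu> by unfold_locales fact+
  have beta: "\<beta> > 0" "bt * measure \<nu> C \<ge> \<beta>" using A3 by (auto simp: strong_aperiodicity_def)
  have nuC: "measure \<nu> C > 0"
    using beta mk.bt_pos by (metis less_le_trans zero_less_mult_pos)
  have Vm [measurable]: "V \<in> borel_measurable S" and V1: "\<And>x. x \<in> space S \<Longrightarrow> 1 \<le> V x"
    and lam: "0 < lam" "lam < 1" and din: "\<And>x. x \<in> C \<Longrightarrow> (\<integral>\<^sup>+y. ennreal (V y) \<partial>P x) \<le> ennreal K"
    using A2 by (auto simp: drift_def)
  \<comment> \<open>Because \<open>V \<ge> 1\<close> on \<open>C\<close>, any bound on the integral
    of \<open>V\<close> under \<nu> is a valid \<open>Kt\<close>.\<close>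
  have split_le: "emeasure \<nu> C + (\<integral>\<^sup>+x\<in>space S - C. ennreal (V x) \<partial>\<nu>) \<le> (\<integral>\<^sup>+x. ennreal (V x) \<partial>\<nu>)"
  proof -
    have "emeasure \<nu> C + (\<integral>\<^sup>+x\<in>space S - C. ennreal (V x) \<partial>\<nu>) =
        (\<integral>\<^sup>+x. indicator C x + ennreal (V x) * indicator (space S - C) x \<partial>\<nu>)"
      by (subst nn_integral_add) auto
    also have "\<dots> \<le> (\<integral>\<^sup>+x. ennreal (V x) \<partial>\<nu>)"
    proof (rule nn_integral_mono)
      fix x assume "x \<in> space \<nu>"
      then have "ennreal 1 \<le> ennreal (V x)" by (intro ennreal_leI V1) simp
      then show "indicator C x + ennreal (V x) * indicator (space S - C) x \<le> ennreal (V x)"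
        by (auto simp: indicator_def)
    qed
    finally show ?thesis .
  qed
  have C_ne: "C \<noteq> {}" using nuC by auto
  show ?thesis
  proof (cases "is_atom P C")
    case True
    then have bt1: "bt = 1" and nuP: "\<And>x. x \<in> C \<Longrightarrow> \<nu> = P x" using atom by auto
    obtain x0 where x0: "x0 \<in> C" using C_ne by auto
    \<comment> \<open>For an atom \<nu> is \<open>P x0\<close> with \<open>x0 \<in> C\<close>, so
      the drift bound itself gives \<open>Kt = K\<close>, in agreement with the exponent in
      \<open>R2_at\<close>.\<close>
    have Kt: "emeasure \<nu> C + (\<integral>\<^sup>+x\<in>space S - C. ennreal (V x) \<partial>\<nu>) \<le> ennreal K"
      using split_le din[OF x0] nuP[OF x0] by (auto intro: order_trans)
    interpret dk: drift_kernel S P C bt \<nu> V lam K K by unfold_locales fact+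
    define R where "R = R2_at \<beta> lam K"
    note R = dk.R2_at_props[OF bt1 refl beta(1), folded R_def]
    have rho: "rho P C \<beta> bt lam K a2 = 1 / R" using True by (simp add: rho_def R_def)
    have main: "?claim \<pi> \<gamma>"
      if st: "stationary S P \<pi>" and rev: "reversible P \<pi>" and g: "1 / R < \<gamma>" "\<gamma> < 1" for \<pi> \<gamma>
    proof -
      interpret rd: reversible_drift S P C bt \<nu> V lam K K \<pi> \<beta>
        by unfold_locales (use st rev beta in auto)
      have lR: "lam \<le> 1 / R" using R lam by (simp add: field_simps)
      then have lg: "lam < \<gamma>" and g0: "0 < \<gamma>" using g lam by linarith+
      define \<kappa> where "\<kappa> = 1 + 1 / (\<gamma> - 1 / R)"
      have k: "\<kappa> \<ge> 1" using g by (simp add: \<kappa>_def)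
      have r: "1 < 1 / \<gamma>" "1 / \<gamma> < 1 / lam" using g g0 lg lam by (auto simp: field_simps)
      have M: "M_const P C \<beta> bt lam K a2 \<gamma> = ereal (dk.MA (1 / \<gamma>) \<kappa>)"
        using True rho dk.M_at_eq[OF lg g(2), of \<kappa>] by (simp add: M_const_def \<kappa>_def)
      have D: "dk.DD r > 0" for r unfolding dk.DD_def using bt1 by simp
      have k': "1 + sqrt bt / (\<gamma> - 1 / R) = \<kappa>" by (simp add: \<kappa>_def bt1)
      have "dk.MM (1 / \<gamma>) (1 + sqrt bt / (\<gamma> - 1 / R)) \<le> dk.MA (1 / \<gamma>) \<kappa>"
        unfolding k' using k by (intro dk.MM_le_MA[OF r bt1]) auto
      note rb = rd.rate_bound[OF R(1,2) D R(3) g this dk.MA_ge[OF r k]]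
      show ?thesis unfolding M using rb by simp
    qed
    show ?thesis
      using dk.stationary_ex1 dk.stationary_V_finite dk.integrable_weighted main R(1) unfolding rho by auto
  next
    case False
    then have bt1: "bt < 1" and al: "alpha2_admissible S C V \<nu> bt lam K a2" using non_atom alpha2 by auto
    \<comment> \<open>Minorization at a point of \<open>C\<close> bounds \<open>bt\<close> times
      this integral by \<open>PV \<le> K\<close>; this is the origin of the default
      \<alpha>_2.\<close>
    have nuV: "(\<integral>\<^sup>+x. ennreal (V x) \<partial>\<nu>) \<le> ennreal (K / bt)"
    proof -
      obtain x0 where x0: "x0 \<in> C" using C_ne by auto
      have "ennreal bt * (\<integral>\<^sup>+x. ennreal (V x) \<partial>\<nu>) \<le> mk.N (\<lambda>x. ennreal (V x)) x0"
        using x0 mk.C_subset[OF x0] by (simp add: mk.N_eq_T)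
      also have "\<dots> \<le> ennreal K" using din[OF x0] by (simp add: mk.N_def)
      finally have le: "ennreal bt * (\<integral>\<^sup>+x. ennreal (V x) \<partial>\<nu>) \<le> ennreal K" .
      have "(\<integral>\<^sup>+x. ennreal (V x) \<partial>\<nu>) = ennreal (1 / bt) * (ennreal bt * (\<integral>\<^sup>+x. ennreal (V x) \<partial>\<nu>))"
        using mk.bt_pos by (simp add: mult.assoc[symmetric] ennreal_mult[symmetric])
      also have "\<dots> \<le> ennreal (1 / bt) * ennreal K" using le by (intro mult_left_mono) auto
      also have "\<dots> = ennreal (K / bt)" using mk.bt_pos by (simp add: ennreal_mult'[symmetric])
      finally show ?thesis .
    qed
    \<comment> \<open>All admissible values of \<open>a2\<close> have one form. The choice
      \<open>a2 = 1\<close> corresponds to \<open>Kt = 1\<close>, with \<open>ln 1 = 0\<close>,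
      since then \<nu> does not charge the complement of \<open>C\<close>.\<close>
    obtain Kt where Kt: "emeasure \<nu> C + (\<integral>\<^sup>+x\<in>space S - C. ennreal (V x) \<partial>\<nu>) \<le> ennreal Kt"
      and a2: "a2 = 1 + ln Kt / ln (1 / lam)"
    proof -
      consider "a2 = 1 + ln (K / bt) / ln (1 / lam)" | "measure \<nu> C = 1" "a2 = 1"
        | Kt where "emeasure \<nu> C + (\<integral>\<^sup>+x\<in>space S - C. ennreal (V x) \<partial>\<nu>) \<le> ennreal Kt" "a2 = 1 + ln Kt / ln (1 / lam)"
        using al by (auto simp: alpha2_admissible_def)
      then show thesis
      proof cases
        case 1
        then show thesis using that[of "K / bt"] order_trans[OF split_le nuV] by simp
      next
        case 2
        have "AE x in \<nu>. x \<in> C" using 2 mk.nu.prob_eq_1 by simp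
        then have "AE x in \<nu>. ennreal (V x) * indicator (space S - C) x = 0"
          by eventually_elim auto
        then have "(\<integral>\<^sup>+x\<in>space S - C. ennreal (V x) \<partial>\<nu>) = 0"
          by (subst nn_integral_0_iff_AE) auto
        then show thesis using that[of 1] 2 by (simp add: mk.nu.emeasure_eq_measure)
      next
        case 3
        then show thesis using that by simp
      qed
    qed
    interpret dk: drift_kernel S P C bt \<nu> V lam K Kt by unfold_locales fact+
    define R where "R = R2_non \<beta> bt lam K a2"
    note R = dk.R2_non_props[OF bt1 a2 beta(1), folded R_def]
    note R0 = dk.R0_props[OF bt1]
    have Rl: "R \<le> 1 / lam" using R(2) R0(2) by simp
    have rho: "rho P C \<beta> bt lam K a2 = 1 / R" using False by (simp add: rho_def R_def)
    have main: "?claim \<pi> \<gamma>"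
      if st: "stationary S P \<pi>" and rev: "reversible P \<pi>" and g: "1 / R < \<gamma>" "\<gamma> < 1" for \<pi> \<gamma>
    proof -
      interpret rd: reversible_drift S P C bt \<nu> V lam K Kt \<pi> \<beta>
        by unfold_locales (use st rev beta in auto)
      have lR: "lam \<le> 1 / R" using R Rl lam by (simp add: field_simps)
      then have lg: "lam < \<gamma>" and g0: "0 < \<gamma>" using g lam by linarith+
      define \<kappa> where "\<kappa> = 1 + sqrt bt / (\<gamma> - 1 / R)"
      have k: "\<kappa> \<ge> 1" using g mk.bt_pos by (simp add: \<kappa>_def)
      have r: "1 < 1 / \<gamma>" "1 / \<gamma> < 1 / lam" using g g0 lg lam by (auto simp: field_simps)
      have rR: "1 / \<gamma> < R" using g g0 R(1) by (simp add: field_simps)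
      have D: "dk.DD r > 0" if "1 < r" "r < R" for r using that R(2) by (intro R0(4)) auto
      note Dg = D[OF r(1) rR]
      have M: "M_const P C \<beta> bt lam K a2 \<gamma> = ereal (dk.MN (1 / \<gamma>) \<kappa>)"
        using False rho dk.M_non_eq[OF lg g(2) Dg a2, of \<kappa>] by (simp add: M_const_def \<kappa>_def)
      have "dk.MM (1 / \<gamma>) \<kappa> \<le> dk.MN (1 / \<gamma>) \<kappa>"
        using k bt1 by (intro dk.MM_le_MN[OF r Dg]) auto
      note rb = rd.rate_bound[OF R(1) Rl D R(3) g this[unfolded \<kappa>_def] dk.MN_ge[OF r Dg k, unfolded \<kappa>_def]]
      show ?thesis unfolding M \<kappa>_def using rb by simp
    qed
    show ?thesis
      using dk.stationary_ex1 dk.stationary_V_finite dk.integrable_weighted main R(1) unfolding rho by auto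
  qed
qed

end
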